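(* There exists a point $(\bar\beta,\bar c)$ with $\bar\beta>0$ and $\bar c>c^{cj}$ (turning point) such that: (i) $\beta_0(\bar c)=\bar\beta$ and $\beta_0'(\bar c)=0$; (ii) $0<\bar\beta\le\beta_0(c)$ for all $c\ge c^{cj}$; (iii) for $(\beta,c)=(\bar\beta,\bar c)$ there is a strong reactive wave of special type; (iv) for every $\beta\in(0,\bar\beta)$ and every $c>c^{cj}$ there is a strong reactive wave with a bump.
   Context: Fix real numbers $q_0>0$, $K>0$, $0\le\alpha<1$ and $T_i$ with $0<T_i<\sqrt{2q_0}$. The function $\varphi:[0,\infty)\to[0,\infty)$ vanishes on $[0,T_i)$ and is $C^\infty$ and positive on $[T_i,\infty)$ (hence discontinuous at $T_i$); moreover $\psi(V)=\varphi(1/V)$ extends smoothly to $V=0$ with $\psi(0)>0$. (Examples: $\varphi(T)=H(T-T_i)$ with $H$ the Heaviside function, and $\varphi(T)=H(T-T_i)e^{-T_a/T}$ with $T_a>0$.) Notation: $c^{cj}=\sqrt{2q_0}$, and for $c\ge c^{cj}$, $T_0(c)=c+\sqrt{c^2-2q_0}$, $T_1(c)=c-\sqrt{c^2-2q_0}$. For $\beta>0$ and $c\ge c^{cj}$, a solution (reactive traveling wave of speed $c$ with viscosity $\beta$) is a pair $(T,Z)\in C^1(\mathbb R)\times C^0(\mathbb R)$ for which there is $\ell\in(0,\infty)$ with: - $T(0)=T_i$, $T(\xi)<T_i$ for $\xi>0$, $T(\xi)>T_i$ for $\xi<0$; - for $\xi>0$: $Z\equiv1$, $\beta T_\xi=-cT+\frac{T^2}{2}$,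 and $T(\xi)\to0$ as $\xi\to+\infty$; - for $-\ell<\xi<0$ (reaction zone): $Z>0$, $\beta T_\xi=-cT+\frac{T^2}2+q_0(1-Z)$, $Z_\xi=K\varphi(T)Z^\alpha$, with $Z(0)=1$ and $Z(-\ell)=0$; - for $\xi<-\ell$: $Z\equiv0$, $\beta T_\xi=-cT+\frac{T^2}2+q_0$, and $T(\xi)$ has a finite limit $T_-$ as $\xi\to-\infty$ (necessarily $T_-\in\{T_0(c),T_1(c)\}$). A solution is strong if $T_-=T_0(c)$. A strong solution is of special type if $T\equiv T_0(c)$ on $\{\xi\le-\ell\}$. For $c>c^{cj}$, a strong solution with a bump is one with $T$ non-monotonic, having a maximum (bump) inside the reaction zone, and $T(\xi)\to T_0(c)$ exponentially as $\xi\to-\infty$. For $c\in[c^{cj},\infty)$, $\beta_0(c)$ denotes the unique $\beta>0$ for which there is a solution of speed $c$ with $T\equiv T_0(c)$ on $\{\xi\le-\ell\}$. *)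

theory Defs
  imports "HOL-Analysis.Analysis"
begin

text \<open>
  \<open>C\<^sup>\<infinity>\<close> regularity on a set of reals, with derivatives taken relative to the set
  (so one-sided at the end points of an interval): \<open>D n\<close> is the \<open>n\<close>-th derivative.
\<close>

definition smooth_within :: "real set \<Rightarrow> (real \<Rightarrow> real) \<Rightarrow> bool" where
  "smooth_within S f \<longleftrightarrow>
     (\<exists>D :: nat \<Rightarrow> real \<Rightarrow> real.
        (\<forall>x\<in>S. D 0 x = f x) \<and>
        (\<forall>n. \<forall>x\<in>S. (D n has_real_derivative D (Suc n) x) (at x within S)))"

text \<open>
  Values of \<open>\<phi>\<close> at negative temperatures are irrelevant and left unconstrained.
  In the last clause \<open>\<psi>\<close> is the smooth extension to \<open>V = 0\<close> of \<open>V \<mapsto> \<phi> (1 / V)\<close>; the interval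
  \<open>0 < V \<le> 1 / Ti\<close> corresponds to \<open>T \<ge> Ti\<close>.
\<close>

definition ignition_rate :: "real \<Rightarrow> (real \<Rightarrow> real) \<Rightarrow> bool" where
  "ignition_rate Ti \<phi> \<longleftrightarrow>
     (\<forall>T. 0 \<le> T \<and> T < Ti \<longrightarrow> \<phi> T = 0) \<and>
     (\<forall>T\<ge>Ti. \<phi> T > 0) \<and>
     smooth_within {Ti..} \<phi> \<and>
     (\<exists>\<psi>. smooth_within {0..1 / Ti} \<psi> \<and>
          (\<forall>V\<in>{0<..1 / Ti}. \<psi> V = \<phi> (1 / V)) \<and> \<psi> 0 > 0)"

definition c_cj :: "real \<Rightarrow> real" where
  "c_cj q0 = sqrt (2 * q0)"

definition T_zero :: "real \<Rightarrow> real \<Rightarrow> real" where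
  "T_zero q0 c = c + sqrt (c\<^sup>2 - 2 * q0)"

text \<open>Reactive traveling wave of speed \<open>c\<close> and viscosity \<open>\<beta>\<close>, with reaction zone \<open>-l < \<xi> < 0\<close>.\<close>

definition reactive_wave ::
  "real \<Rightarrow> real \<Rightarrow> real \<Rightarrow> real \<Rightarrow> (real \<Rightarrow> real) \<Rightarrow> real \<Rightarrow> real \<Rightarrow> real
     \<Rightarrow> (real \<Rightarrow> real) \<Rightarrow> (real \<Rightarrow> real) \<Rightarrow> bool" where
  "reactive_wave q0 K \<alpha> Ti \<phi> \<beta> c l T Z \<longleftrightarrow>
     \<beta> > 0 \<and> c \<ge> c_cj q0 \<and> l > 0 \<and>
     T C1_differentiable_on UNIV \<and> continuous_on UNIV Z \<and>
     T 0 = Ti \<and> (\<forall>\<xi>>0. T \<xi> < Ti) \<and> (\<forall>\<xi><0. T \<xi> > Ti) \<and>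
     (\<forall>\<xi>>0. Z \<xi> = 1 \<and> \<beta> * deriv T \<xi> = - c * T \<xi> + (T \<xi>)\<^sup>2 / 2) \<and>
     (T \<longlongrightarrow> 0) at_top \<and>
     (\<forall>\<xi>. - l < \<xi> \<and> \<xi> < 0 \<longrightarrow>
        Z \<xi> > 0 \<and>
        \<beta> * deriv T \<xi> = - c * T \<xi> + (T \<xi>)\<^sup>2 / 2 + q0 * (1 - Z \<xi>) \<and>
        (Z has_real_derivative K * \<phi> (T \<xi>) * Z \<xi> powr \<alpha>) (at \<xi>)) \<and>
     Z 0 = 1 \<and> Z (- l) = 0 \<and>
     (\<forall>\<xi>. \<xi> < - l \<longrightarrow> Z \<xi> = 0 \<and> \<beta> * deriv T \<xi> = - c * T \<xi> + (T \<xi>)\<^sup>2 / 2 + q0) \<and>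
     (\<exists>T_minus. (T \<longlongrightarrow> T_minus) at_bot)"

definition strong_wave ::
  "real \<Rightarrow> real \<Rightarrow> real \<Rightarrow> real \<Rightarrow> (real \<Rightarrow> real) \<Rightarrow> real \<Rightarrow> real \<Rightarrow> real
     \<Rightarrow> (real \<Rightarrow> real) \<Rightarrow> (real \<Rightarrow> real) \<Rightarrow> bool" where
  "strong_wave q0 K \<alpha> Ti \<phi> \<beta> c l T Z \<longleftrightarrow>
     reactive_wave q0 K \<alpha> Ti \<phi> \<beta> c l T Z \<and> (T \<longlongrightarrow> T_zero q0 c) at_bot"

definition special_strong_wave ::
  "real \<Rightarrow> real \<Rightarrow> real \<Rightarrow> real \<Rightarrow> (real \<Rightarrow> real) \<Rightarrow> real \<Rightarrow> real \<Rightarrow> real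
     \<Rightarrow> (real \<Rightarrow> real) \<Rightarrow> (real \<Rightarrow> real) \<Rightarrow> bool" where
  "special_strong_wave q0 K \<alpha> Ti \<phi> \<beta> c l T Z \<longleftrightarrow>
     strong_wave q0 K \<alpha> Ti \<phi> \<beta> c l T Z \<and> (\<forall>\<xi>\<le>- l. T \<xi> = T_zero q0 c)"

text \<open>
  The bump is the global maximum of \<open>T\<close>, attained in the reaction zone; exponential convergence
  is the bound \<open>\<bar>T \<xi> - T\<^sub>0(c)\<bar> \<le> C * exp (r * \<xi>)\<close> with some rate \<open>r > 0\<close> behind the reaction zone.
\<close>

definition bump_strong_wave ::
  "real \<Rightarrow> real \<Rightarrow> real \<Rightarrow> real \<Rightarrow> (real \<Rightarrow> real) \<Rightarrow> real \<Rightarrow> real \<Rightarrow> real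
     \<Rightarrow> (real \<Rightarrow> real) \<Rightarrow> (real \<Rightarrow> real) \<Rightarrow> bool" where
  "bump_strong_wave q0 K \<alpha> Ti \<phi> \<beta> c l T Z \<longleftrightarrow>
     c > c_cj q0 \<and> strong_wave q0 K \<alpha> Ti \<phi> \<beta> c l T Z \<and>
     \<not> mono T \<and> \<not> antimono T \<and>
     (\<exists>\<xi>\<^sub>m. - l < \<xi>\<^sub>m \<and> \<xi>\<^sub>m < 0 \<and> (\<forall>\<xi>. T \<xi> \<le> T \<xi>\<^sub>m)) \<and>
     (\<exists>C r. r > 0 \<and> (\<forall>\<xi>\<le>- l. \<bar>T \<xi> - T_zero q0 c\<bar> \<le> C * exp (r * \<xi>)))"

definition beta0 ::
  "real \<Rightarrow> real \<Rightarrow> real \<Rightarrow> real \<Rightarrow> (real \<Rightarrow> real) \<Rightarrow> real \<Rightarrow> real" where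
  "beta0 q0 K \<alpha> Ti \<phi> c =
     (THE \<beta>. \<beta> > 0 \<and>
        (\<exists>l T Z. reactive_wave q0 K \<alpha> Ti \<phi> \<beta> c l T Z \<and> (\<forall>\<xi>\<le>- l. T \<xi> = T_zero q0 c)))"

end

theory Submission
  imports Defs
begin

text \<open>
  In the reaction zone \<open>w = 1 - Z powr (1 - \<alpha>)\<close> can replace \<open>\<xi>\<close> as independent variable: it runs
  through all of \<open>[0, 1]\<close> at a positive rate, and a wave becomes a solution of the scalar problem
  \<open>T' = lam * heat c w T / \<phi> T\<close>, \<open>T 0 = Ti\<close>, where
  \<open>heat c w T = c * T - T\<^sup>2 / 2 - q0 * (1 - (1 - w) powr (1 / (1 - \<alpha>)))\<close> and
  \<open>lam = 1 / (\<beta> * k)\<close> with \<open>k = (1 - \<alpha>) * K\<close>. The wave is of special type exactly if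
  \<open>T 1 = T\<^sub>0(c)\<close> (\<open>profile_of_special_wave\<close>, \<open>special_wave_lam0\<close>); if \<open>T 1 > T\<^sub>0(c)\<close> and
  \<open>c > c\<^sup>c\<^sup>j\<close>, the temperature overshoots and relaxes to \<open>T\<^sub>0(c)\<close> exponentially from above, which
  gives a bump (\<open>bump_wave_exists\<close>).

  Along a solution, \<open>heat\<close> times an integrating factor is strictly decreasing, because \<open>heat\<close>
  decreases in \<open>w\<close>. Hence \<open>heat\<close> changes sign at most once (\<open>heat_sign_change\<close>), so it is positive
  in a special wave before \<open>w = 1\<close>, and the solution for a larger \<open>lam\<close> with the same \<open>c\<close> ends
  strictly higher, with a quantitative gap (\<open>profile_endpoint_strictly_increasing\<close>). So for every
  \<open>c\<close> there is exactly one critical value \<open>lam0 c\<close>, and \<open>\<beta>\<^sub>0(c) = 1 / (k * lam0 c)\<close> (\<open>beta0_eq\<close>); all smaller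
  viscosities give bumps when \<open>c > c\<^sup>c\<^sup>j\<close>. It remains to maximise \<open>lam0\<close>.

  A maximum is attained (\<open>lam0_attains_max\<close>): the set of pairs \<open>(lam, c)\<close> with \<open>T 1 = T\<^sub>0(c)\<close> is
  closed, and \<open>lam0\<close> is at most of order \<open>ln c / c\<close>, since the quotient \<open>T / (2 * c - T)\<close> grows
  exponentially in \<open>w\<close> at a rate proportional to \<open>lam * c\<close>. It is not attained at \<open>c = c\<^sup>c\<^sup>j\<close>: there \<open>T\<^sub>0(c)\<close> rises like a square root, but the
  endpoint of the solution for fixed \<open>lam\<close> moves only linearly in \<open>c\<close>, so a larger \<open>lam\<close> is needed to
  reach \<open>T\<^sub>0(c)\<close> for \<open>c\<close> slightly above \<open>c\<^sup>c\<^sup>j\<close>.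

  The derivative of \<open>\<beta>\<^sub>0\<close> at the maximiser \<open>cbar\<close> exists and vanishes because \<open>\<beta>\<^sub>0\<close> differs there from
  its minimum only by a quadratic term. To see this, fix \<open>lam = lam0 cbar\<close> and let \<open>h c\<close> be the
  excess of the endpoint over \<open>T\<^sub>0(c)\<close>. By maximality \<open>h \<ge> 0\<close>, and \<open>h cbar = 0\<close>. Gronwall's inequality for the second
  difference of solutions in \<open>c\<close> gives \<open>h (cbar + e) + h (cbar - e) \<le> Q * e\<^sup>2\<close>; both terms being
  nonnegative, each is quadratically small, and the quantitative monotonicity in \<open>lam\<close> makes
  \<open>lam0 cbar - lam0 c\<close> quadratically small as well.
\<close>

section \<open>Differential inequalities\<close>

text \<open>
  After the last time at which \<open>D \<ge> 0\<close>, the function \<open>D w * exp (- L * w)\<close> would be nondecreasing.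
  The differential inequality is assumed only where \<open>D\<close> is negative, because a barrier argument knows
  the sign of the derivative only on the wrong side of the barrier.
\<close>

lemma nonneg_of_deriv_ge:
  fixes D :: "real \<Rightarrow> real"
  assumes "a \<le> b" and cont: "continuous_on {a..b} D" and init: "D a \<ge> 0"
    and der: "\<And>w. a < w \<Longrightarrow> w < b \<Longrightarrow>
      \<exists>d. (D has_real_derivative d) (at w) \<and> (D w < 0 \<longrightarrow> d \<ge> L * D w)"
  shows "D b \<ge> 0"
proof (rule ccontr)
  assume neg: "\<not> D b \<ge> 0"
  define S where "S = {w\<in>{a..b}. 0 \<le> D w}"
  have "closed S" unfolding S_def
    by (intro continuous_on_closed_Collect_le continuous_on_const cont closed_atLeastAtMost)
  moreover have "a \<in> S" using assms by (auto simp: S_def)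
  moreover have "bdd_above S" by (auto simp: S_def bdd_above_def)
  ultimately have supS: "Sup S \<in> S" by (intro closed_contains_Sup) auto
  define w0 where "w0 = Sup S"
  have w0: "a \<le> w0" "w0 \<le> b" "D w0 \<ge> 0" using supS by (auto simp: S_def w0_def)
  have "w0 < b" using w0 neg by (cases "w0 = b") auto
  have after: "D w < 0" if "w0 < w" "w \<le> b" for w
  proof (rule ccontr)
    assume "\<not> D w < 0"
    hence "w \<in> S" using that w0 by (auto simp: S_def)
    hence "w \<le> w0" unfolding w0_def using \<open>bdd_above S\<close> by (rule cSup_upper)
    with that show False by simp
  qed
  define E where "E = (\<lambda>w. D w * exp (- (L * w)))"
  have "E w0 \<le> E b"
  proof (rule DERIV_nonneg_imp_increasing_open[where f = E])
    show "w0 \<le> b" using w0 by simp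
    show "continuous_on {w0..b} E" unfolding E_def
      by (intro continuous_intros continuous_on_subset[OF cont]) (use w0 in auto)
    fix w assume w: "w0 < w" "w < b"
    obtain d where d: "(D has_real_derivative d) (at w)" "D w < 0 \<longrightarrow> d \<ge> L * D w"
      using der[of w] w w0 by auto
    have "(E has_real_derivative (d - L * D w) * exp (- (L * w))) (at w)"
      unfolding E_def by (auto intro!: derivative_eq_intros d simp: algebra_simps)
    moreover have "(d - L * D w) * exp (- (L * w)) \<ge> 0" using d after[of w] w by simp
    ultimately show "\<exists>y. (E has_real_derivative y) (at w) \<and> 0 \<le> y" by blast
  qed
  moreover have "E w0 \<ge> 0" using w0 by (simp add: E_def)
  moreover have "E b < 0" using neg by (simp add: E_def mult_neg_pos)
  ultimately show False by simp
qed

text \<open>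
  The square of \<open>D\<close> is differentiable also where \<open>D\<close> vanishes, unlike \<open>\<bar>D\<bar>\<close>; its derivative is at most
  \<open>(2 * L + 1) * D\<^sup>2 + M\<^sup>2\<close>.
\<close>

lemma gronwall_abs:
  fixes D :: "real \<Rightarrow> real"
  assumes cont: "continuous_on {0..1} D" and init: "D 0 = 0" and "M \<ge> 0"
    and der: "\<And>w. 0 < w \<Longrightarrow> w < 1 \<Longrightarrow>
      \<exists>d. (D has_real_derivative d) (at w) \<and> \<bar>d\<bar> \<le> L * \<bar>D w\<bar> + M"
    and "0 \<le> w" "w \<le> 1" and "L \<ge> 0"
  shows "\<bar>D w\<bar> \<le> M * exp (L + 1)"
proof -
  define A where "A = 2 * L + 1"
  define E where "E = (\<lambda>w. M\<^sup>2 * w - (D w)\<^sup>2 * exp (- (A * w)))"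
  have "E 0 \<le> E w"
  proof (rule DERIV_nonneg_imp_increasing_open[where f = E])
    show "0 \<le> w" by fact
    show "continuous_on {0..w} E" unfolding E_def
      by (intro continuous_intros continuous_on_subset[OF cont]) (use assms in auto)
    fix s assume s: "0 < s" "s < w"
    obtain d where d: "(D has_real_derivative d) (at s)" "\<bar>d\<bar> \<le> L * \<bar>D s\<bar> + M"
      using der[of s] s \<open>w \<le> 1\<close> by force
    have 1: "(E has_real_derivative M\<^sup>2 - (2 * D s * d - A * (D s)\<^sup>2) * exp (- (A * s))) (at s)"
      unfolding E_def by (auto intro!: derivative_eq_intros d simp: algebra_simps power2_eq_square)
    have "2 * D s * d \<le> 2 * \<bar>D s\<bar> * \<bar>d\<bar>" by (metis abs_ge_self abs_mult abs_numeral)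
    also have "\<dots> \<le> 2 * \<bar>D s\<bar> * (L * \<bar>D s\<bar> + M)" by (intro mult_left_mono d) auto
    also have "\<dots> = 2 * L * (D s)\<^sup>2 + 2 * \<bar>D s\<bar> * M"
      by (simp add: algebra_simps power2_eq_square)
    also have "2 * \<bar>D s\<bar> * M \<le> (D s)\<^sup>2 + M\<^sup>2"
      using sum_squares_bound[of "\<bar>D s\<bar>" M] by simp
    finally have "2 * D s * d - A * (D s)\<^sup>2 \<le> M\<^sup>2" by (simp add: A_def algebra_simps)
    hence "(2 * D s * d - A * (D s)\<^sup>2) * exp (- (A * s)) \<le> M\<^sup>2 * exp (- (A * s))"
      by (intro mult_right_mono) auto
    also have "\<dots> \<le> M\<^sup>2 * 1"
      using s \<open>L \<ge> 0\<close> by (intro mult_left_mono) (auto simp: A_def)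
    finally show "\<exists>y. (E has_real_derivative y) (at s) \<and> 0 \<le> y" using 1 by (intro exI conjI) auto
  qed
  hence "(D w)\<^sup>2 * exp (- (A * w)) \<le> M\<^sup>2 * w" using init by (simp add: E_def)
  also have "\<dots> \<le> M\<^sup>2" using assms by (simp add: mult_left_le)
  finally have "(D w)\<^sup>2 * exp (- (A * w)) * exp (A * w) \<le> M\<^sup>2 * exp (A * w)"
    by (rule mult_right_mono) auto
  hence "(D w)\<^sup>2 \<le> M\<^sup>2 * exp (A * w)" by (simp add: mult.assoc flip: exp_add)
  also have "\<dots> \<le> M\<^sup>2 * exp (2 * (L + 1))"
  proof -
    have "A * w \<le> A * 1" using assms by (intro mult_left_mono) (auto simp: A_def)
    thus ?thesis by (intro mult_left_mono) (auto simp: A_def)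
  qed
  also have "\<dots> = (M * exp (L + 1))\<^sup>2" by (simp add: power_mult_distrib exp_double[symmetric])
  finally show ?thesis using \<open>M \<ge> 0\<close> by (simp add: abs_le_square_iff[symmetric] abs_mult)
qed

section \<open>Solutions of scalar differential equations\<close>

text \<open>
  The unknown is multiplied by \<open>exp (- M * w)\<close> with \<open>M > 2 * L\<close>. In these variables the Picard operator
  contracts the supremum norm and yields a solution on the whole interval at once.
\<close>

lemma picard_lindelof_unit_interval:
  fixes f :: "real \<Rightarrow> real \<Rightarrow> real" and x0 :: real
  assumes cont: "\<And>u. continuous_on {0..1} u \<Longrightarrow> continuous_on {0..1} (\<lambda>w. f w (u w))"
    and lip: "\<And>w x y. 0 \<le> w \<Longrightarrow> w \<le> 1 \<Longrightarrow> \<bar>f w x - f w y\<bar> \<le> L * \<bar>x - y\<bar>"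
    and "L \<ge> 0"
  obtains u where "continuous_on {0..1} u" "u 0 = x0"
    "\<And>w. 0 < w \<Longrightarrow> w < 1 \<Longrightarrow> (u has_real_derivative f w (u w)) (at w)"
proof -
  define M where "M = 2 * L + 1"
  have M: "M > 0" "L / M \<le> 1 / 2" using \<open>L \<ge> 0\<close> by (auto simp: M_def field_simps)
  define cl :: "real \<Rightarrow> real" where "cl = (\<lambda>t. max 0 (min t 1))"
  have cl01: "cl t \<in> {0..1}" for t by (auto simp: cl_def)
  define h where "h = (\<lambda>(u :: real \<Rightarrow>\<^sub>C real) s. f s (exp (M * s) * u s))"
  define P0 where "P0 = (\<lambda>u t. exp (- (M * t)) * (x0 + integral {0..t} (h u)))"
  have conth: "continuous_on {0..1} (h u)" for u
    unfolding h_def by (intro cont continuous_intros continuous_on_apply_bcontfun)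
  have int: "h u integrable_on {0..t}" if "t \<in> {0..1}" for u t
    by (rule integrable_continuous_real, rule continuous_on_subset[OF conth]) (use that in auto)
  have contI: "continuous_on {0..1} (\<lambda>t. integral {0..t} (h u))" for u
    by (rule indefinite_integral_continuous_1) (auto intro: int)
  have contP0: "continuous_on {0..1} (P0 u)" for u
    unfolding P0_def by (intro continuous_intros contI)
  have contP: "continuous_on UNIV (\<lambda>t. P0 u (cl t))" for u
    by (rule continuous_on_compose2[OF contP0])
       (use cl01 in \<open>auto simp: cl_def intro!: continuous_intros\<close>)
  have bc: "(\<lambda>t. P0 u (cl t)) \<in> bcontfun" for u
  proof -
    have "compact (P0 u ` {0..1})" by (intro compact_continuous_image contP0) auto
    hence "bounded (P0 u ` {0..1})" by (rule compact_imp_bounded)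
    hence "bounded (range (\<lambda>t. P0 u (cl t)))" by (rule bounded_subset) (use cl01 in auto)
    thus ?thesis using contP by (simp add: bcontfun_def)
  qed
  define P where "P = (\<lambda>u. Bcontfun (\<lambda>t. P0 u (cl t)))"
  have P: "apply_bcontfun (P u) t = P0 u (cl t)" for u t
    by (simp add: P_def Bcontfun_inverse[OF bc])
  have "\<exists>!u. P u = u"
  proof (rule banach_fix_type[of "1/2"])
    show "\<forall>u v. dist (P u) (P v) \<le> 1 / 2 * dist u v"
    proof (intro allI dist_bound)
      fix u v :: "real \<Rightarrow>\<^sub>C real" and t0 :: real
      define t where "t = cl t0"
      have t: "t \<in> {0..1}" using cl01[of t0] by (simp add: t_def)
      define d where "d = dist u v"
      have d: "d \<ge> 0" by (simp add: d_def)
      have I: "((\<lambda>s. L * d * exp (M * s)) has_integral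
          (L * d * exp (M * t) / M - L * d * exp (M * 0) / M)) {0..t}"
        using t M by (intro fundamental_theorem_of_calculus)
          (auto intro!: derivative_eq_intros simp flip: has_real_derivative_iff_has_vector_derivative)
      have "norm (integral {0..t} (\<lambda>s. h u s - h v s)) \<le> integral {0..t} (\<lambda>s. L * d * exp (M * s))"
      proof (rule integral_norm_bound_integral)
        show "(\<lambda>s. h u s - h v s) integrable_on {0..t}"
          using int[OF t] by (intro integrable_diff) auto
        show "(\<lambda>s. L * d * exp (M * s)) integrable_on {0..t}" using I by blast
        fix s assume s: "s \<in> {0..t}"
        have "\<bar>h u s - h v s\<bar> \<le> L * \<bar>exp (M * s) * u s - exp (M * s) * v s\<bar>"
          unfolding h_def using s t by (intro lip) auto
        also have "\<dots> = L * (exp (M * s) * dist (u s) (v s))"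
          by (simp add: dist_real_def abs_mult flip: right_diff_distrib)
        also have "\<dots> \<le> L * (exp (M * s) * d)"
          unfolding d_def using \<open>L \<ge> 0\<close> by (intro mult_left_mono dist_bounded) auto
        finally show "norm (h u s - h v s) \<le> L * d * exp (M * s)" by (simp add: algebra_simps)
      qed
      also have "\<dots> = L * d / M * (exp (M * t) - 1)"
        unfolding integral_unique[OF I] by (simp add: algebra_simps)
      also have "\<dots> \<le> L * d / M * exp (M * t)" using M d \<open>L \<ge> 0\<close> by (intro mult_left_mono) auto
      finally have *: "\<bar>integral {0..t} (h u) - integral {0..t} (h v)\<bar> \<le> L * d / M * exp (M * t)"
        using int[OF t] by (simp add: integral_diff)
      have "dist (P u t0) (P v t0) = exp (- (M * t)) * \<bar>integral {0..t} (h u) - integral {0..t} (h v)\<bar>"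
        by (simp add: P P0_def dist_real_def t_def[symmetric] abs_mult flip: right_diff_distrib)
      also have "\<dots> \<le> exp (- (M * t)) * (L * d / M * exp (M * t))"
        by (intro mult_left_mono *) auto
      also have "\<dots> = L / M * d" by (simp add: exp_minus field_simps)
      also have "\<dots> \<le> 1 / 2 * d" using d M by (intro mult_right_mono) auto
      finally show "dist (P u t0) (P v t0) \<le> 1 / 2 * dist u v" by (simp add: d_def)
    qed
  qed auto
  then obtain v where v: "P v = v" by auto
  define u where "u = (\<lambda>t. x0 + integral {0..t} (h v))"
  have uv: "exp (M * t) * v t = u t" if "t \<in> {0..1}" for t
  proof -
    have "v t = P0 v (cl t)" using P[of v t] v by simp
    also have "cl t = t" using that by (auto simp: cl_def)
    finally show ?thesis by (simp add: P0_def u_def exp_minus field_simps)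
  qed
  show ?thesis
  proof
    show "continuous_on {0..1} u" unfolding u_def by (intro continuous_intros contI)
    show "u 0 = x0" by (simp add: u_def)
    fix w :: real assume w: "0 < w" "w < 1"
    have "(u has_real_derivative h v w) (at w within {0..1})"
      unfolding u_def using w
      by (auto intro!: derivative_eq_intros integral_has_real_derivative conth)
    moreover have "at w within {0..1} = at w" using w by (intro at_within_interior) auto
    moreover have "h v w = f w (u w)" using uv[of w] w by (simp add: h_def)
    ultimately show "(u has_real_derivative f w (u w)) (at w)" by simp
  qed
qed

section \<open>Derivatives at a point and inverse functions\<close>

text \<open>
  For gluing pieces: a continuous function whose derivative away from \<open>a\<close> has a limit at \<open>a\<close> is
  differentiable there, by l'Hopital's rule applied to the difference quotient.
\<close>

lemma has_real_derivative_of_limit: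
  fixes f h :: "real \<Rightarrow> real"
  assumes "isCont f a" "isCont h a"
    and ev: "\<forall>\<^sub>F x in at a. (f has_real_derivative h x) (at x)"
  shows "(f has_real_derivative h a) (at a)"
proof -
  have "((\<lambda>x. (f x - f a) / (x - a)) \<longlongrightarrow> h a) (at a)"
  proof (rule lhopital[where f' = h and g' = "\<lambda>_. 1"])
    show "((\<lambda>x. f x - f a) \<longlongrightarrow> 0) (at a)" using assms(1) by (simp add: isCont_def LIM_zero)
    show "((\<lambda>x. x - a) \<longlongrightarrow> 0) (at a)" by (auto intro!: tendsto_eq_intros)
    show "\<forall>\<^sub>F x in at a. x - a \<noteq> 0" by (auto simp: eventually_at_filter)
    show "\<forall>\<^sub>F x in at a. ((\<lambda>x. f x - f a) has_real_derivative h x) (at x)"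
      using ev by eventually_elim (auto intro!: derivative_eq_intros)
    show "\<forall>\<^sub>F x in at a. ((\<lambda>x. x - a) has_real_derivative 1) (at x)"
      by (auto intro!: always_eventually derivative_eq_intros)
    show "((\<lambda>x. h x / 1) \<longlongrightarrow> h a) (at a)" using assms(2) by (simp add: isCont_def)
  qed auto
  thus ?thesis by (simp add: has_field_derivative_iff)
qed

lemma has_real_derivative_zero_of_quadratic_bound:
  fixes f :: "real \<Rightarrow> real"
  assumes "e > 0" and bd: "\<And>x. \<bar>x - a\<bar> < e \<Longrightarrow> \<bar>f x - f a\<bar> \<le> Q * (x - a)\<^sup>2"
  shows "(f has_real_derivative 0) (at a)"
  unfolding has_field_derivative_iff
proof (rule Lim_null_comparison)
  show "\<forall>\<^sub>F x in at a. norm ((f x - f a) / (x - a)) \<le> Q * \<bar>x - a\<bar>"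
    unfolding eventually_at
  proof (intro exI[of _ e] conjI ballI impI)
    fix x assume x: "x \<noteq> a \<and> dist x a < e"
    have "\<bar>f x - f a\<bar> \<le> Q * \<bar>x - a\<bar> * \<bar>x - a\<bar>"
      using bd[of x] x by (simp add: dist_real_def power2_eq_square mult.assoc)
    thus "norm ((f x - f a) / (x - a)) \<le> Q * \<bar>x - a\<bar>" using x by (simp add: pos_divide_le_eq)
  qed fact
  show "((\<lambda>x. Q * \<bar>x - a\<bar>) \<longlongrightarrow> 0) (at a)"
    by (auto intro!: tendsto_eq_intros)
qed

lemma has_real_derivative_cong_eventually:
  assumes "(f has_real_derivative d) (at x)" "\<forall>\<^sub>F y in nhds x. f y = h y"
  shows "(h has_real_derivative d) (at x)"
  using DERIV_cong_ev[OF refl assms(2) refl] assms(1) by simp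

text \<open>
  The change of variables between \<open>\<xi>\<close> and the reaction coordinate, in both directions. Differentiability
  is confined to open intervals, since at the end points only continuity is known.
\<close>

lemma decreasing_inverse:
  fixes f f' :: "real \<Rightarrow> real"
  assumes "a < b" and cont: "continuous_on {a..b} f"
    and der: "\<And>x. a < x \<Longrightarrow> x < b \<Longrightarrow> (f has_real_derivative f' x) (at x)"
    and neg: "\<And>x. a < x \<Longrightarrow> x < b \<Longrightarrow> f' x < 0"
  shows "\<exists>g. continuous_on {f b..f a} g \<and> g (f a) = a \<and> g (f b) = b \<and> f b < f a \<and>
     (\<forall>y\<in>{f b..f a}. g y \<in> {a..b} \<and> f (g y) = y) \<and>
     (\<forall>y\<in>{f b<..<f a}. g y \<in> {a<..<b} \<and> (g has_real_derivative 1 / f' (g y)) (at y))"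
proof -
  have dec: "f y < f x" if "a \<le> x" "x < y" "y \<le> b" for x y
  proof (rule DERIV_neg_imp_decreasing_open[where f = f])
    show "continuous_on {x..y} f" by (rule continuous_on_subset[OF cont]) (use that in auto)
    show "\<exists>d. (f has_real_derivative d) (at z) \<and> d < 0" if "x < z" "z < y" for z
      using der[of z] neg[of z] that \<open>a \<le> x\<close> \<open>y \<le> b\<close> by auto
  qed fact
  have inj: "inj_on f {a..b}"
    by (rule linorder_inj_onI) (use dec in force)+
  have image: "f ` {a..b} = {f b..f a}"
  proof (intro equalityI subsetI)
    fix y assume "y \<in> f ` {a..b}"
    then obtain x where "x \<in> {a..b}" "y = f x" by auto
    thus "y \<in> {f b..f a}" using dec[of a x] dec[of x b] by (cases "x = a"; cases "x = b") auto
  next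
    fix y assume "y \<in> {f b..f a}"
    thus "y \<in> f ` {a..b}" using IVT2'[of f b y a] \<open>a < b\<close> cont by auto
  qed
  define g where "g = the_inv_into {a..b} f"
  have gf: "g (f x) = x" if "x \<in> {a..b}" for x
    unfolding g_def by (rule the_inv_into_f_f[OF inj that])
  have fg: "g y \<in> {a..b} \<and> f (g y) = y" if "y \<in> {f b..f a}" for y
    using that gf unfolding image[symmetric] by auto
  have contg: "continuous_on {f b..f a} g"
    unfolding image[symmetric] by (rule continuous_on_inv[OF cont]) (use gf in auto)
  have "g y \<in> {a<..<b} \<and> (g has_real_derivative 1 / f' (g y)) (at y)" if y: "y \<in> {f b<..<f a}" for y
  proof -
    have g: "g y \<in> {a..b}" "f (g y) = y" using fg[of y] y by auto
    hence gy: "a < g y" "g y < b" using y by (auto simp: order_le_less)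
    have "(g has_real_derivative inverse (f' (g y))) (at y)"
    proof (rule DERIV_inverse_function[where a = "f b" and b = "f a"])
      show "(f has_real_derivative f' (g y)) (at (g y))" using der gy by blast
      show "f' (g y) \<noteq> 0" using neg[OF gy] by simp
      show "isCont g y" using contg y by (intro continuous_on_interior) auto
    qed (use y fg in auto)
    thus ?thesis using gy by (simp add: inverse_eq_divide)
  qed
  thus ?thesis using contg fg gf \<open>a < b\<close> dec[of a b] by (intro exI[of _ g]) auto
qed

section \<open>Second differences of twice continuously differentiable functions\<close>

definition C2_on :: "real set \<Rightarrow> (real \<Rightarrow> real) \<Rightarrow> bool" where
  "C2_on S h \<longleftrightarrow> (\<exists>h' h''. continuous_on S h'' \<and>
     (\<forall>x\<in>S. (h has_real_derivative h' x) (at x within S) \<and>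
            (h' has_real_derivative h'' x) (at x within S)))"

lemma C2_on_ident: "C2_on S (\<lambda>x. x)"
  unfolding C2_on_def by (rule exI[of _ "\<lambda>x. 1"], rule exI[of _ "\<lambda>x. 0"]) auto

lemma C2_on_mult:
  assumes "C2_on S f" "C2_on S g"
  shows "C2_on S (\<lambda>x. f x * g x)"
proof -
  obtain f' f'' where f: "continuous_on S f''"
    "\<And>x. x \<in> S \<Longrightarrow> (f has_real_derivative f' x) (at x within S)"
    "\<And>x. x \<in> S \<Longrightarrow> (f' has_real_derivative f'' x) (at x within S)"
    using assms(1) unfolding C2_on_def by meson
  obtain g' g'' where g: "continuous_on S g''"
    "\<And>x. x \<in> S \<Longrightarrow> (g has_real_derivative g' x) (at x within S)"
    "\<And>x. x \<in> S \<Longrightarrow> (g' has_real_derivative g'' x) (at x within S)"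
    using assms(2) unfolding C2_on_def by meson
  have c: "continuous_on S f" "continuous_on S f'" "continuous_on S g" "continuous_on S g'"
    by (metis DERIV_continuous_on f(2), metis DERIV_continuous_on f(3),
        metis DERIV_continuous_on g(2), metis DERIV_continuous_on g(3))
  show ?thesis unfolding C2_on_def
    by (rule exI[of _ "\<lambda>x. f' x * g x + f x * g' x"],
        rule exI[of _ "\<lambda>x. f'' x * g x + 2 * f' x * g' x + f x * g'' x"])
       (auto intro!: derivative_eq_intros continuous_intros f g c simp: algebra_simps)
qed

lemma C2_on_inverse:
  assumes "C2_on S f" and nz: "\<And>x. x \<in> S \<Longrightarrow> f x \<noteq> 0"
  shows "C2_on S (\<lambda>x. 1 / f x)"
proof -
  obtain f' f'' where f: "continuous_on S f''"
    "\<And>x. x \<in> S \<Longrightarrow> (f has_real_derivative f' x) (at x within S)"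
    "\<And>x. x \<in> S \<Longrightarrow> (f' has_real_derivative f'' x) (at x within S)"
    using assms(1) unfolding C2_on_def by meson
  have c: "continuous_on S f" "continuous_on S f'"
    by (metis DERIV_continuous_on f(2), metis DERIV_continuous_on f(3))
  show ?thesis unfolding C2_on_def
    by (rule exI[of _ "\<lambda>x. - f' x / (f x)\<^sup>2"],
        rule exI[of _ "\<lambda>x. 2 * (f' x)\<^sup>2 / (f x)^3 - f'' x / (f x)\<^sup>2"])
       (auto intro!: derivative_eq_intros continuous_intros f c simp: nz
         simp: divide_simps power2_eq_square power3_eq_cube, auto simp: nz algebra_simps)
qed

text \<open>
  One constant for the three consequences of twice continuous differentiability on a compact interval
  that enter the estimates. The last clause bounds second differences of \<open>h\<close> by those of the
  arguments, up to terms of second order.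
\<close>

definition C2_bounded :: "real \<Rightarrow> real set \<Rightarrow> (real \<Rightarrow> real) \<Rightarrow> bool" where
  "C2_bounded N S h \<longleftrightarrow> (\<forall>x\<in>S. \<bar>h x\<bar> \<le> N) \<and> (\<forall>x\<in>S. \<forall>y\<in>S. \<bar>h x - h y\<bar> \<le> N * \<bar>x - y\<bar>) \<and>
     (\<forall>x\<in>S. \<forall>y\<in>S. \<forall>z\<in>S.
        \<bar>h y + h z - 2 * h x\<bar> \<le> N * (\<bar>y + z - 2 * x\<bar> + (y - x)\<^sup>2 + (z - x)\<^sup>2))"

lemma C2_boundedD:
  assumes "C2_bounded N S h"
  shows "x \<in> S \<Longrightarrow> \<bar>h x\<bar> \<le> N"
    and "x \<in> S \<Longrightarrow> y \<in> S \<Longrightarrow> \<bar>h x - h y\<bar> \<le> N * \<bar>x - y\<bar>"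
    and "x \<in> S \<Longrightarrow> y \<in> S \<Longrightarrow> z \<in> S \<Longrightarrow>
      \<bar>h y + h z - 2 * h x\<bar> \<le> N * (\<bar>y + z - 2 * x\<bar> + (y - x)\<^sup>2 + (z - x)\<^sup>2)"
  using assms unfolding C2_bounded_def by blast+

lemma C2_bounded_mono:
  assumes "C2_bounded N S h" "N \<le> N'"
  shows "C2_bounded N' S h"
proof -
  have up: "u \<le> N' * t" if "u \<le> N * t" "t \<ge> 0" for u t
    using that mult_right_mono[OF assms(2), of t] by linarith
  show ?thesis unfolding C2_bounded_def
    using C2_boundedD[OF assms(1)] assms(2) by (auto intro!: up intro: order_trans)
qed

text \<open>
  The second difference is the sum of two first order Taylor remainders at \<open>x\<close> and of
  \<open>h' x * (y + z - 2 * x)\<close>. Each remainder follows from the mean value inequality for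
  \<open>h t - h' x * t\<close>, whose derivative is small because \<open>h'\<close> is Lipschitz.
\<close>

lemma C2_on_imp_C2_bounded:
  assumes "C2_on {a..b} h"
  shows "\<exists>N\<ge>0. C2_bounded N {a..b} h"
proof -
  let ?S = "{a..b}"
  obtain h' h'' where h: "continuous_on ?S h''"
    "\<And>x. x \<in> ?S \<Longrightarrow> (h has_real_derivative h' x) (at x within ?S)"
    "\<And>x. x \<in> ?S \<Longrightarrow> (h' has_real_derivative h'' x) (at x within ?S)"
    using assms(1) unfolding C2_on_def by meson
  have c: "continuous_on ?S h" "continuous_on ?S h'"
    by (metis DERIV_continuous_on h(2), metis DERIV_continuous_on h(3))
  have bnd: "\<exists>B. \<forall>x\<in>?S. \<bar>g x\<bar> \<le> B" if "continuous_on ?S g" for g :: "real \<Rightarrow> real"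
  proof -
    have "bounded (g ` ?S)" using that by (intro compact_imp_bounded compact_continuous_image) auto
    thus ?thesis by (auto simp: bounded_iff)
  qed
  obtain B0 B1 B2 where B: "\<forall>x\<in>?S. \<bar>h x\<bar> \<le> B0" "\<forall>x\<in>?S. \<bar>h' x\<bar> \<le> B1" "\<forall>x\<in>?S. \<bar>h'' x\<bar> \<le> B2"
    using bnd c h(1) by metis
  define N where "N = \<bar>B0\<bar> + \<bar>B1\<bar> + \<bar>B2\<bar>"
  have N: "\<bar>h x\<bar> \<le> N" "\<bar>h' x\<bar> \<le> N" "\<bar>h'' x\<bar> \<le> N" if "x \<in> ?S" for x
    using B[rule_format, OF that] by (auto simp: N_def)
  have lip1: "\<bar>h x - h y\<bar> \<le> N * \<bar>x - y\<bar>" if "x \<in> ?S" "y \<in> ?S" for x y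
    using field_differentiable_bound[of ?S h h' N x y] that h N by auto
  have lip2: "\<bar>h' x - h' y\<bar> \<le> N * \<bar>x - y\<bar>" if "x \<in> ?S" "y \<in> ?S" for x y
    using field_differentiable_bound[of ?S h' h'' N x y] that h N by auto
  have taylor: "\<bar>h y - h x - h' x * (y - x)\<bar> \<le> N * (y - x)\<^sup>2" if "x \<in> ?S" "y \<in> ?S" for x y
  proof -
    let ?I = "{min x y..max x y}"
    have I: "?I \<subseteq> ?S" using that by auto
    have "norm ((h y - h' x * y) - (h x - h' x * x)) \<le> (N * \<bar>y - x\<bar>) * norm (y - x)"
    proof (rule field_differentiable_bound[where S = ?I and f' = "\<lambda>t. h' t - h' x"])
      fix t assume t: "t \<in> ?I"
      show "((\<lambda>t. h t - h' x * t) has_real_derivative h' t - h' x) (at t within ?I)"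
        using t I by (auto intro!: derivative_eq_intros DERIV_subset[OF h(2) I])
      have "\<bar>h' t - h' x\<bar> \<le> N * \<bar>t - x\<bar>" using t I that by (intro lip2) auto
      also have "\<dots> \<le> N * \<bar>y - x\<bar>" using t by (intro mult_left_mono) (auto simp: N_def)
      finally show "norm (h' t - h' x) \<le> N * \<bar>y - x\<bar>" by simp
    qed auto
    thus ?thesis by (simp add: algebra_simps power2_eq_square abs_mult_self_eq flip: abs_mult)
  qed
  have "\<bar>h y + h z - 2 * h x\<bar> \<le> N * (\<bar>y + z - 2 * x\<bar> + (y - x)\<^sup>2 + (z - x)\<^sup>2)"
    if xyz: "x \<in> ?S" "y \<in> ?S" "z \<in> ?S" for x y z
  proof -
    have "\<bar>h' x * (y + z - 2 * x)\<bar> \<le> N * \<bar>y + z - 2 * x\<bar>"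
      unfolding abs_mult by (intro mult_right_mono N xyz) auto
    moreover have "h y + h z - 2 * h x = (h y - h x - h' x * (y - x)) + (h z - h x - h' x * (z - x))
       + h' x * (y + z - 2 * x)" by (simp add: algebra_simps)
    ultimately show ?thesis
      using taylor[of x y] taylor[of x z] xyz unfolding ring_distribs by linarith
  qed
  hence "C2_bounded N ?S h" unfolding C2_bounded_def using N(1) lip1 by blast
  moreover have "N \<ge> 0" by (simp add: N_def)
  ultimately show ?thesis by blast
qed

lemma smooth_within_C2_on:
  assumes "smooth_within S f" "I \<subseteq> S"
  shows "C2_on I f"
proof -
  obtain D :: "nat \<Rightarrow> real \<Rightarrow> real" where D0: "\<And>x. x \<in> S \<Longrightarrow> D 0 x = f x"
    and D: "\<And>n x. x \<in> S \<Longrightarrow> (D n has_real_derivative D (Suc n) x) (at x within S)"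
    using assms(1) unfolding smooth_within_def by auto
  have DI: "(D n has_real_derivative D (Suc n) x) (at x within I)" if "x \<in> I" for n x
    using D[of x n] that assms(2) by (auto intro: DERIV_subset)
  have "(f has_real_derivative D 1 x) (at x within I)" if "x \<in> I" for x
    using DI[OF that, of 0] that D0 assms(2)
    by (subst has_field_derivative_cong_eventually[where g = "D 0"])
       (auto simp: eventually_at_filter subset_iff)
  moreover have "continuous_on I (D 2)" by (rule DERIV_continuous_on[OF DI])
  ultimately show ?thesis unfolding C2_on_def using DI[of _ 1]
    by (intro exI[of _ "D 1"] exI[of _ "D 2"]) (auto simp: numeral_2_eq_2)
qed

lemma C2_on_continuous_on: "C2_on S h \<Longrightarrow> continuous_on S h"
  unfolding C2_on_def by (metis DERIV_continuous_on)

section \<open>The reaction zone as an initial value problem\<close>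

locale combustion =
  fixes q0 K \<alpha> Ti :: real and \<phi> :: "real \<Rightarrow> real"
  assumes q0: "q0 > 0" and K: "K > 0" and \<alpha>0: "0 \<le> \<alpha>" and \<alpha>1: "\<alpha> < 1"
    and Ti0: "0 < Ti" and Ti_less: "Ti < sqrt (2 * q0)"
    and ignition: "ignition_rate Ti \<phi>"
begin

text \<open>
  \<open>k * \<phi> T\<close> is the rate of \<open>Z powr (1 - \<alpha>)\<close> in \<open>\<xi>\<close>, and \<open>\<gamma>\<close> is the exponent that recovers \<open>Z\<close> from
  \<open>1 - w = Z powr (1 - \<alpha>)\<close>; thus \<open>burnt w\<close> is \<open>1 - Z\<close>.
\<close>

definition k :: real where "k = (1 - \<alpha>) * K"
definition \<gamma> :: real where "\<gamma> = 1 / (1 - \<alpha>)"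
definition burnt :: "real \<Rightarrow> real" where "burnt w = 1 - (1 - w) powr \<gamma>"
text \<open>
  \<open>- heat c w T\<close> is \<open>\<beta> * T\<^sub>\<xi>\<close> in the reaction zone.
\<close>

definition heat :: "real \<Rightarrow> real \<Rightarrow> real \<Rightarrow> real" where
  "heat c w T = c * T - T\<^sup>2 / 2 - q0 * burnt w"
text \<open>
  Clipping the temperature to \<open>[Ti, 2 * c]\<close> makes the right-hand side bounded and globally Lipschitz, so
  that solutions exist on all of \<open>[0, 1]\<close> for every \<open>lam \<ge> 0\<close>. The solutions that correspond to waves
  stay in this interval.
\<close>

definition clip :: "real \<Rightarrow> real \<Rightarrow> real" where "clip c T = max Ti (min T (2 * c))"
definition slope :: "real \<Rightarrow> real \<Rightarrow> real \<Rightarrow> real" where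
  "slope c w T = heat c w (clip c T) / \<phi> (clip c T)"
text \<open>
  The derivative is required on the open interval only: this is all that the change of variables
  gives for a wave, and it determines the solution.
\<close>

definition profile :: "real \<Rightarrow> real \<Rightarrow> (real \<Rightarrow> real) \<Rightarrow> bool" where
  "profile lam c T \<longleftrightarrow> continuous_on {0..1} T \<and> T 0 = Ti \<and>
     (\<forall>w. 0 < w \<and> w < 1 \<longrightarrow> (T has_real_derivative lam * slope c w (T w)) (at w))"
abbreviation ccj :: real where "ccj \<equiv> c_cj q0"
abbreviation T0 :: "real \<Rightarrow> real" where "T0 \<equiv> T_zero q0"

lemma k_pos: "k > 0" using K \<alpha>1 by (simp add: k_def)

lemma \<gamma>_ge: "\<gamma> \<ge> 1" using \<alpha>0 \<alpha>1 by (simp add: \<gamma>_def)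

lemma ccj_sq: "ccj\<^sup>2 = 2 * q0" using q0 by (simp add: c_cj_def)

lemma Ti_less_ccj: "Ti < ccj" using Ti_less by (simp add: c_cj_def)

lemma ccj_pos: "0 < ccj" using Ti_less_ccj Ti0 by simp

lemma T0_root:
  assumes "c \<ge> ccj"
  shows "T0 c * (2 * c - T0 c) = 2 * q0" "c \<le> T0 c" "T0 c < 2 * c" "0 < T0 c"
proof -
  define r where "r = sqrt (c\<^sup>2 - 2 * q0)"
  have T0r: "T0 c = c + r" by (simp add: T_zero_def r_def)
  have "c\<^sup>2 \<ge> 2 * q0" using assms ccj_pos by (simp flip: ccj_sq)
  hence r: "r \<ge> 0" "r\<^sup>2 = c\<^sup>2 - 2 * q0" by (auto simp: r_def)
  have c: "c > 0" using assms ccj_pos by simp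
  have "r\<^sup>2 < c\<^sup>2" using r q0 by simp
  hence "r < c" using c by (rule power_less_imp_less_base[OF _ less_imp_le])
  thus "T0 c * (2 * c - T0 c) = 2 * q0" "c \<le> T0 c" "T0 c < 2 * c" "0 < T0 c"
    unfolding T0r using r c by (auto simp: algebra_simps power2_eq_square)
qed

lemma Ti_less_T0: "c \<ge> ccj \<Longrightarrow> Ti < T0 c"
  using T0_root(2)[of c] Ti_less_ccj by simp

lemma burnt_0 [simp]: "burnt 0 = 0" and burnt_1 [simp]: "burnt 1 = 1"
  by (simp_all add: burnt_def)

lemma burnt_mono: "x \<le> y \<Longrightarrow> y \<le> 1 \<Longrightarrow> burnt x \<le> burnt y"
  unfolding burnt_def using \<gamma>_ge by (simp add: powr_mono2)

lemma burnt_bounds: "0 \<le> w \<Longrightarrow> w \<le> 1 \<Longrightarrow> 0 \<le> burnt w \<and> burnt w \<le> 1"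
  using burnt_mono[of 0 w] burnt_mono[of w 1] by simp

lemma continuous_on_burnt: "continuous_on {..1} burnt"
  unfolding burnt_def using \<gamma>_ge by (intro continuous_intros continuous_on_powr') auto

lemma burnt_deriv:
  assumes "w < 1"
  shows "(burnt has_real_derivative \<gamma> * (1 - w) powr (\<gamma> - 1)) (at w)"
  unfolding burnt_def using assms by (auto intro!: derivative_eq_intros)

text \<open>
  \<open>T\<^sub>0(c)\<close> is a root of \<open>T * (2 * c - T) = 2 * q0\<close>. Hence \<open>heat\<close> is nonnegative at \<open>T\<^sub>0(c)\<close> and
  vanishes there only at the end of the reaction.
\<close>

lemma heat_T0:
  assumes "c \<ge> ccj" shows "heat c w (T0 c) = q0 * (1 - burnt w)"
proof -
  have "c * T0 c - (T0 c)\<^sup>2 / 2 = T0 c * (2 * c - T0 c) / 2"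
    by (simp add: field_simps power2_eq_square)
  also have "\<dots> = q0" using T0_root(1)[OF assms] by simp
  finally show ?thesis by (simp add: heat_def algebra_simps)
qed

lemma heat_top: "heat c w (2 * c) = - q0 * burnt w"
  by (simp add: heat_def power2_eq_square)

lemma \<phi>_pos: "T \<ge> Ti \<Longrightarrow> \<phi> T > 0"
  using ignition by (auto simp: ignition_rate_def)

lemma \<phi>_C2: "C2_on {Ti..R} \<phi>"
  using ignition by (intro smooth_within_C2_on[of "{Ti..}"]) (auto simp: ignition_rate_def)

text \<open>
  On \<open>[Ti, \<infinity>)\<close> the rate is \<open>\<psi> (1 / T)\<close>, with \<open>1 / T\<close> in the compact interval on which \<open>\<psi>\<close> is
  continuous.
\<close>

lemma \<phi>_bounded: "\<exists>B>0. \<forall>T\<ge>Ti. \<phi> T \<le> B"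
proof -
  obtain \<psi> where \<psi>: "smooth_within {0..1 / Ti} \<psi>" "\<forall>V\<in>{0<..1 / Ti}. \<psi> V = \<phi> (1 / V)"
    using ignition unfolding ignition_rate_def by auto
  have "continuous_on {0..1 / Ti} \<psi>"
    by (rule C2_on_continuous_on[OF smooth_within_C2_on[OF \<psi>(1) order_refl]])
  hence "bounded (\<psi> ` {0..1 / Ti})"
    by (intro compact_imp_bounded compact_continuous_image) auto
  then obtain B where B: "\<forall>V\<in>{0..1 / Ti}. \<bar>\<psi> V\<bar> \<le> B" by (auto simp: bounded_iff)
  have "\<phi> T \<le> \<bar>B\<bar> + 1" if "T \<ge> Ti" for T
  proof -
    have "1 / T \<in> {0<..1 / Ti}" using that Ti0 by (auto simp: field_simps)
    moreover from this have "\<bar>\<psi> (1 / T)\<bar> \<le> B" using B by (auto intro: less_imp_le)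
    ultimately have "\<bar>\<phi> T\<bar> \<le> B" using \<psi>(2) by simp
    thus ?thesis by simp
  qed
  thus ?thesis by (intro exI[of _ "\<bar>B\<bar> + 1"]) auto
qed

text \<open>
  A positive lower bound of \<open>1 / \<phi>\<close> on the whole of \<open>[Ti, \<infinity>)\<close>, independent of the speed: this is what
  makes the estimates uniform as \<open>c \<rightarrow> \<infinity>\<close>.
\<close>

definition inv_rate_lb :: real where "inv_rate_lb = (SOME g. g > 0 \<and> (\<forall>T\<ge>Ti. g \<le> 1 / \<phi> T))"

lemma inv_rate_lb: "inv_rate_lb > 0" "T \<ge> Ti \<Longrightarrow> inv_rate_lb \<le> 1 / \<phi> T"
proof -
  obtain B where B: "B > 0" "\<forall>T\<ge>Ti. \<phi> T \<le> B" using \<phi>_bounded by auto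
  have "\<exists>g. g > 0 \<and> (\<forall>T\<ge>Ti. g \<le> 1 / \<phi> T)"
    using B \<phi>_pos by (intro exI[of _ "1 / B"]) (auto intro!: frac_le)
  from someI_ex[OF this] show "inv_rate_lb > 0" "T \<ge> Ti \<Longrightarrow> inv_rate_lb \<le> 1 / \<phi> T" by (auto simp: inv_rate_lb_def)
qed

lemma clip_ge: "Ti \<le> clip c T" by (simp add: clip_def)

lemma clip_le: "c \<ge> ccj \<Longrightarrow> c \<le> C \<Longrightarrow> clip c T \<le> 2 * C"
  using Ti_less_ccj ccj_pos by (auto simp: clip_def)

lemma clip_id: "Ti \<le> T \<Longrightarrow> T \<le> 2 * c \<Longrightarrow> clip c T = T" by (simp add: clip_def)

lemma clip_lipschitz: "\<bar>clip c T - clip c' T'\<bar> \<le> \<bar>T - T'\<bar> + 2 * \<bar>c - c'\<bar>"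
proof -
  have mx: "\<bar>max a x - max a y\<bar> \<le> \<bar>x - y\<bar>" for a x y :: real by (simp add: max_def)
  have mn: "\<bar>min x a - min y b\<bar> \<le> \<bar>x - y\<bar> + \<bar>a - b\<bar>" for a b x y :: real
    by (cases "x \<le> a"; cases "y \<le> b"; simp add: min_def; linarith)
  have "\<bar>clip c T - clip c' T'\<bar> \<le> \<bar>min T (2 * c) - min T' (2 * c')\<bar>"
    unfolding clip_def by (rule mx)
  also have "\<dots> \<le> \<bar>T - T'\<bar> + \<bar>2 * c - 2 * c'\<bar>" by (rule mn)
  also have "\<bar>2 * c - 2 * c'\<bar> = 2 * \<bar>c - c'\<bar>" using abs_mult[of 2 "c - c'"] by (simp add: right_diff_distrib)
  finally show ?thesis .
qed

lemma rate_weights_C2_bounded: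
  "\<exists>N\<ge>0. C2_bounded N {Ti..R} (\<lambda>T. 1 / \<phi> T) \<and> C2_bounded N {Ti..R} (\<lambda>T. T / \<phi> T) \<and>
     C2_bounded N {Ti..R} (\<lambda>T. T\<^sup>2 / \<phi> T)"
proof -
  have inv: "C2_on {Ti..R} (\<lambda>T. 1 / \<phi> T)"
    using \<phi>_pos by (intro C2_on_inverse \<phi>_C2) (auto simp: less_le)
  have lin: "C2_on {Ti..R} (\<lambda>T. T / \<phi> T)"
    using C2_on_mult[OF C2_on_ident inv] by simp
  have quad: "C2_on {Ti..R} (\<lambda>T. T\<^sup>2 / \<phi> T)"
    using C2_on_mult[OF C2_on_ident lin] by (simp add: power2_eq_square)
  obtain N0 N1 N2 where "N0 \<ge> 0" "N1 \<ge> 0" "N2 \<ge> 0" "C2_bounded N0 {Ti..R} (\<lambda>T. 1 / \<phi> T)"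
    "C2_bounded N1 {Ti..R} (\<lambda>T. T / \<phi> T)" "C2_bounded N2 {Ti..R} (\<lambda>T. T\<^sup>2 / \<phi> T)"
    using inv lin quad by (blast dest!: C2_on_imp_C2_bounded)
  thus ?thesis
    by (intro exI[of _ "N0 + N1 + N2"] conjI) (auto elim!: C2_bounded_mono)
qed

lemma slope_expand:
  "slope c w T = c * (clip c T / \<phi> (clip c T)) - (clip c T)\<^sup>2 / \<phi> (clip c T) / 2
     - q0 * burnt w * (1 / \<phi> (clip c T))"
  by (simp add: slope_def heat_def diff_divide_distrib)

text \<open>
  \<open>B\<close> bounds \<open>slope\<close> and its Lipschitz constants in \<open>T\<close> and \<open>c\<close>, uniformly for speeds up to \<open>C\<close>.
\<close>

definition slope_bounded :: "real \<Rightarrow> real \<Rightarrow> bool" where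
  "slope_bounded C B \<longleftrightarrow> B \<ge> 0 \<and>
     (\<forall>c w T. ccj \<le> c \<and> c \<le> C \<and> 0 \<le> w \<and> w \<le> 1 \<longrightarrow> \<bar>slope c w T\<bar> \<le> B) \<and>
     (\<forall>c c' w T T'. ccj \<le> c \<and> c \<le> C \<and> ccj \<le> c' \<and> c' \<le> C \<and> 0 \<le> w \<and> w \<le> 1 \<longrightarrow>
       \<bar>slope c w T - slope c' w T'\<bar> \<le> B * (\<bar>T - T'\<bar> + \<bar>c - c'\<bar>))"

lemma slope_boundedD:
  assumes "slope_bounded C B" "ccj \<le> c" "c \<le> C" "0 \<le> w" "w \<le> 1"
  shows "B \<ge> 0" "\<bar>slope c w T\<bar> \<le> B" "\<bar>slope c w T - slope c w T'\<bar> \<le> B * \<bar>T - T'\<bar>"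
    and "ccj \<le> c' \<Longrightarrow> c' \<le> C \<Longrightarrow>
      \<bar>slope c w T - slope c' w T'\<bar> \<le> B * (\<bar>T - T'\<bar> + \<bar>c - c'\<bar>)"
proof -
  note a = assms(1)[unfolded slope_bounded_def]
  show "B \<ge> 0" using a by blast
  show "\<bar>slope c w T\<bar> \<le> B" using a assms by blast
  show *: "\<bar>slope c w T - slope c' w T'\<bar> \<le> B * (\<bar>T - T'\<bar> + \<bar>c - c'\<bar>)"
    if "ccj \<le> c'" "c' \<le> C" for c' using a assms that by blast
  show "\<bar>slope c w T - slope c w T'\<bar> \<le> B * \<bar>T - T'\<bar>" using *[of c] assms by simp
qed

lemma slope_bounded_exists: "\<exists>B. slope_bounded C B"
proof -
  obtain N where N: "N \<ge> 0" and h0: "C2_bounded N {Ti..2 * C} (\<lambda>T. 1 / \<phi> T)"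
    and h1: "C2_bounded N {Ti..2 * C} (\<lambda>T. T / \<phi> T)"
    and h2: "C2_bounded N {Ti..2 * C} (\<lambda>T. T\<^sup>2 / \<phi> T)"
    using rate_weights_C2_bounded by blast
  define B where "B = 2 * (\<bar>C\<bar> + 1 + q0) * N + N"
  have "B \<ge> 0" using N q0 by (simp add: B_def)
  moreover have "\<bar>slope c w T\<bar> \<le> B" if c: "ccj \<le> c" "c \<le> C" and w: "0 \<le> w" "w \<le> 1" for c w T
  proof -
    define x where "x = clip c T"
    have x: "x \<in> {Ti..2 * C}" using clip_ge clip_le[OF c] by (auto simp: x_def)
    define X0 X1 X2 where X: "X0 = 1 / \<phi> x" "X1 = x / \<phi> x" "X2 = x\<^sup>2 / \<phi> x"
    have b: "\<bar>X0\<bar> \<le> N" "\<bar>X1\<bar> \<le> N" "\<bar>X2\<bar> \<le> N"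
      unfolding X using C2_boundedD(1)[OF h0 x] C2_boundedD(1)[OF h1 x] C2_boundedD(1)[OF h2 x] .
    have "\<bar>c * X1\<bar> \<le> \<bar>C\<bar> * N" unfolding abs_mult
      using b c ccj_pos N by (intro mult_mono) auto
    moreover have "\<bar>q0 * burnt w * X0\<bar> \<le> (q0 * 1) * N" unfolding abs_mult
      using b q0 burnt_bounds[OF w] N by (intro mult_mono) auto
    moreover have "slope c w T = c * X1 - X2 / 2 - q0 * burnt w * X0"
      unfolding slope_expand x_def X ..
    ultimately have "\<bar>slope c w T\<bar> \<le> \<bar>C\<bar> * N + N + q0 * N" using b by auto
    also have "\<dots> \<le> B" using N q0 by (simp add: B_def algebra_simps)
    finally show ?thesis .
  qed
  moreover have "\<bar>slope c w T - slope c' w T'\<bar> \<le> B * (\<bar>T - T'\<bar> + \<bar>c - c'\<bar>)"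
    if c: "ccj \<le> c" "c \<le> C" and c': "ccj \<le> c'" "c' \<le> C" and w: "0 \<le> w" "w \<le> 1"
    for c c' w T T'
  proof -
    define x where "x = clip c T" define y where "y = clip c' T'"
    have x: "x \<in> {Ti..2 * C}" using clip_ge clip_le[OF c] by (auto simp: x_def)
    have y: "y \<in> {Ti..2 * C}" using clip_ge clip_le[OF c'] by (auto simp: y_def)
    define X0 X1 X2 where X: "X0 = 1 / \<phi> x" "X1 = x / \<phi> x" "X2 = x\<^sup>2 / \<phi> x"
    define Y0 Y1 Y2 where Y: "Y0 = 1 / \<phi> y" "Y1 = y / \<phi> y" "Y2 = y\<^sup>2 / \<phi> y"
    have b: "\<bar>Y1\<bar> \<le> N" unfolding Y using C2_boundedD(1)[OF h1 y] .
    have l: "\<bar>X0 - Y0\<bar> \<le> N * \<bar>x - y\<bar>" "\<bar>X1 - Y1\<bar> \<le> N * \<bar>x - y\<bar>" "\<bar>X2 - Y2\<bar> \<le> N * \<bar>x - y\<bar>"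
      unfolding X Y
      using C2_boundedD(2)[OF h0 x y] C2_boundedD(2)[OF h1 x y] C2_boundedD(2)[OF h2 x y] .
    have triangle: "\<bar>a + b - e / 2 - f\<bar> \<le> A' + B' + E + F"
      if "\<bar>a\<bar> \<le> A'" "\<bar>b\<bar> \<le> B'" "\<bar>e\<bar> \<le> E" "\<bar>f\<bar> \<le> F" for a b e f A' B' E F :: real
      using that by linarith
    have e1: "\<bar>c * (X1 - Y1)\<bar> \<le> \<bar>C\<bar> * (N * \<bar>x - y\<bar>)" unfolding abs_mult
      using l c ccj_pos N by (intro mult_mono) auto
    have e2: "\<bar>(c - c') * Y1\<bar> \<le> \<bar>c - c'\<bar> * N" unfolding abs_mult
      using b by (intro mult_left_mono) auto
    have e3: "\<bar>q0 * burnt w * (X0 - Y0)\<bar> \<le> (q0 * 1) * (N * \<bar>x - y\<bar>)" unfolding abs_mult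
      using l q0 burnt_bounds[OF w] N by (intro mult_mono) auto
    have "slope c w T - slope c' w T' = (c * X1 - X2 / 2 - q0 * burnt w * X0)
        - (c' * Y1 - Y2 / 2 - q0 * burnt w * Y0)"
      unfolding slope_expand x_def X y_def Y ..
    also have "\<dots> = c * (X1 - Y1) + (c - c') * Y1 - (X2 - Y2) / 2 - q0 * burnt w * (X0 - Y0)"
      by (simp add: algebra_simps diff_divide_distrib)
    finally have "\<bar>slope c w T - slope c' w T'\<bar> \<le> \<bar>C\<bar> * (N * \<bar>x - y\<bar>) + \<bar>c - c'\<bar> * N
       + N * \<bar>x - y\<bar> + (q0 * 1) * (N * \<bar>x - y\<bar>)" using triangle[OF e1 e2 l(3) e3] by simp
    also have "\<dots> = (\<bar>C\<bar> + 1 + q0) * N * \<bar>x - y\<bar> + N * \<bar>c - c'\<bar>" by (simp add: algebra_simps)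
    also have "\<dots> \<le> (\<bar>C\<bar> + 1 + q0) * N * (\<bar>T - T'\<bar> + 2 * \<bar>c - c'\<bar>) + N * \<bar>c - c'\<bar>"
      unfolding x_def y_def using clip_lipschitz N q0 by (intro add_right_mono mult_left_mono) auto
    also have "\<dots> \<le> (\<bar>C\<bar> + 1 + q0) * N * (2 * \<bar>T - T'\<bar> + 2 * \<bar>c - c'\<bar>) + N * (\<bar>T - T'\<bar> + \<bar>c - c'\<bar>)"
      using N q0 by (intro add_mono mult_left_mono) auto
    also have "\<dots> = B * (\<bar>T - T'\<bar> + \<bar>c - c'\<bar>)" by (simp add: B_def algebra_simps)
    finally show ?thesis .
  qed
  ultimately show ?thesis unfolding slope_bounded_def by blast
qed

lemma profile_exists:
  assumes "c \<ge> ccj" "lam \<ge> 0"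
  shows "\<exists>T. profile lam c T"
proof -
  obtain B where B: "slope_bounded c B" using slope_bounded_exists by blast
  have B0: "B \<ge> 0" using slope_boundedD(1)[OF B assms(1), of 0] by simp
  obtain T where "continuous_on {0..1} T" "T 0 = Ti"
    "\<And>w. 0 < w \<Longrightarrow> w < 1 \<Longrightarrow> (T has_real_derivative lam * slope c w (T w)) (at w)"
  proof (rule picard_lindelof_unit_interval[where f = "\<lambda>w T. lam * slope c w T" and L = "lam * B"])
    fix u :: "real \<Rightarrow> real" assume u: "continuous_on {0..1} u"
    have cl: "continuous_on {0..1} (\<lambda>w. clip c (u w))"
      unfolding clip_def by (intro continuous_intros u)
    have \<phi>cl: "continuous_on {0..1} (\<lambda>w. \<phi> (clip c (u w)))"
      by (rule continuous_on_compose2[OF C2_on_continuous_on[OF \<phi>_C2[of "2 * c"]] cl])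
         (use clip_ge clip_le[OF assms(1) order_refl] in auto)
    have "continuous_on {0..1} burnt" by (rule continuous_on_subset[OF continuous_on_burnt]) auto
    thus "continuous_on {0..1} (\<lambda>w. lam * slope c w (u w))"
      unfolding slope_def heat_def using \<phi>_pos[OF clip_ge]
      by (intro continuous_intros cl \<phi>cl) (auto simp: less_le)
  next
    fix w x y :: real assume "0 \<le> w" "w \<le> 1"
    thus "\<bar>lam * slope c w x - lam * slope c w y\<bar> \<le> lam * B * \<bar>x - y\<bar>"
      using slope_boundedD(3)[OF B assms(1) order_refl, of w x y] assms(2)
      by (simp add: abs_mult mult_left_mono mult.assoc flip: right_diff_distrib)
  qed (use B0 assms in auto)
  thus ?thesis by (auto simp: profile_def)
qed

text \<open>
  \<open>M\<close> is a Lipschitz constant for the dependence of profiles on \<open>(lam, c)\<close>, for speeds up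
  to \<open>C\<close> and when one of the two values of \<open>lam\<close> is at most \<open>A\<close>.
\<close>

definition dependence_bounded :: "real \<Rightarrow> real \<Rightarrow> real \<Rightarrow> bool" where
  "dependence_bounded A C M \<longleftrightarrow> M \<ge> 0 \<and>
     (\<forall>lam lam' c c' T T' w. 0 \<le> lam \<and> lam \<le> A \<and> ccj \<le> c \<and> c \<le> C \<and>
       ccj \<le> c' \<and> c' \<le> C \<and> profile lam c T \<and> profile lam' c' T' \<and> 0 \<le> w \<and> w \<le> 1 \<longrightarrow>
       \<bar>T w - T' w\<bar> \<le> M * (\<bar>lam - lam'\<bar> + \<bar>c - c'\<bar>))"

lemma dependence_bounded_exists: "\<exists>M. dependence_bounded A C M"
proof (cases "C < ccj")
  case True
  thus ?thesis by (intro exI[of _ 0]) (auto simp: dependence_bounded_def)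
next
  case False
  obtain B where B: "slope_bounded C B" using slope_bounded_exists by blast
  have B0: "B \<ge> 0" using slope_boundedD(1)[OF B, of ccj 0] False by simp
  define P where "P = (\<bar>A\<bar> + 1) * B"
  have P: "P \<ge> 0" "B \<le> P" using B0 by (auto simp: P_def algebra_simps)
  have "\<bar>T w - T' w\<bar> \<le> P * exp (P + 1) * (\<bar>lam - lam'\<bar> + \<bar>c - c'\<bar>)"
    if lam: "0 \<le> lam" "lam \<le> A" and c: "ccj \<le> c" "c \<le> C" "ccj \<le> c'" "c' \<le> C"
      and T: "profile lam c T" "profile lam' c' T'" and w: "0 \<le> w" "w \<le> 1"
    for lam lam' c c' T T' w
  proof -
    define e where "e = \<bar>lam - lam'\<bar> + \<bar>c - c'\<bar>"
    have "\<bar>T w - T' w\<bar> \<le> (P * e) * exp (P + 1)"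
    proof (rule gronwall_abs[where L = P and D = "\<lambda>w. T w - T' w"])
      show "continuous_on {0..1} (\<lambda>w. T w - T' w)" "T 0 - T' 0 = 0"
        using T by (auto simp: profile_def intro!: continuous_intros)
      show "P * e \<ge> 0" using P by (simp add: e_def)
      fix s :: real assume s: "0 < s" "s < 1"
      define d where "d = lam * slope c s (T s) - lam' * slope c' s (T' s)"
      have "((\<lambda>w. T w - T' w) has_real_derivative d) (at s)" unfolding d_def
        using T s by (auto simp: profile_def intro!: derivative_eq_intros)
      moreover have "\<bar>d\<bar> \<le> P * \<bar>T s - T' s\<bar> + P * e"
      proof -
        have "d = lam * (slope c s (T s) - slope c' s (T' s)) + (lam - lam') * slope c' s (T' s)"
          by (simp add: d_def algebra_simps)
        moreover have "\<bar>lam * (slope c s (T s) - slope c' s (T' s))\<bar>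
            \<le> \<bar>A\<bar> * (B * (\<bar>T s - T' s\<bar> + \<bar>c - c'\<bar>))"
          unfolding abs_mult using lam c s B0 by (intro mult_mono slope_boundedD(4)[OF B]) auto
        moreover have "\<bar>(lam - lam') * slope c' s (T' s)\<bar> \<le> \<bar>lam - lam'\<bar> * B"
          unfolding abs_mult using c s by (intro mult_left_mono slope_boundedD(2)[OF B]) auto
        ultimately have "\<bar>d\<bar> \<le> \<bar>A\<bar> * (B * (\<bar>T s - T' s\<bar> + \<bar>c - c'\<bar>)) + \<bar>lam - lam'\<bar> * B"
          by linarith
        also have "\<dots> = (\<bar>A\<bar> * B) * (\<bar>T s - T' s\<bar> + \<bar>c - c'\<bar>) + B * \<bar>lam - lam'\<bar>" by simp
        also have "\<dots> \<le> P * (\<bar>T s - T' s\<bar> + \<bar>c - c'\<bar>) + P * \<bar>lam - lam'\<bar>"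
          using P B0 by (intro add_mono mult_right_mono) (auto simp: P_def algebra_simps)
        finally show ?thesis by (simp add: e_def algebra_simps)
      qed
      ultimately show "\<exists>d. ((\<lambda>w. T w - T' w) has_real_derivative d) (at s) \<and>
          \<bar>d\<bar> \<le> P * \<bar>T s - T' s\<bar> + P * e" by blast
    qed (use w P in auto)
    thus ?thesis by (simp add: e_def mult_ac)
  qed
  moreover have "P * exp (P + 1) \<ge> 0" using P by simp
  ultimately show ?thesis unfolding dependence_bounded_def by blast
qed

lemma dependence_boundedD:
  assumes "dependence_bounded A C M"
  shows "M \<ge> 0"
    and "0 \<le> lam \<Longrightarrow> lam \<le> A \<Longrightarrow> ccj \<le> c \<Longrightarrow> c \<le> C \<Longrightarrow> ccj \<le> c' \<Longrightarrow> c' \<le> C \<Longrightarrow>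
      profile lam c T \<Longrightarrow> profile lam' c' T' \<Longrightarrow> 0 \<le> w \<Longrightarrow> w \<le> 1 \<Longrightarrow>
      \<bar>T w - T' w\<bar> \<le> M * (\<bar>lam - lam'\<bar> + \<bar>c - c'\<bar>)"
  using assms unfolding dependence_bounded_def by blast+

definition sol :: "real \<Rightarrow> real \<Rightarrow> real \<Rightarrow> real" where
  "sol lam c = (SOME T. profile lam c T)"

lemma profile_sol: "c \<ge> ccj \<Longrightarrow> lam \<ge> 0 \<Longrightarrow> profile lam c (sol lam c)"
  unfolding sol_def by (rule someI_ex[OF profile_exists])

lemma profile_unique:
  assumes "c \<ge> ccj" "lam \<ge> 0" "profile lam c T" "0 \<le> w" "w \<le> 1"
  shows "T w = sol lam c w"
proof -
  obtain M where M: "dependence_bounded lam c M" using dependence_bounded_exists by blast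
  show ?thesis
    using dependence_boundedD(2)[OF M, of lam c c T lam "sol lam c" w] profile_sol[OF assms(1,2)] assms
    by simp
qed

section \<open>Shape of the profiles that end at or above the equilibrium\<close>

lemma profileD:
  assumes "profile lam c T"
  shows "continuous_on {0..1} T" "T 0 = Ti"
    "0 < w \<Longrightarrow> w < 1 \<Longrightarrow> (T has_real_derivative lam * slope c w (T w)) (at w)"
  using assms by (auto simp: profile_def)

lemma profile_cont_sub: "profile lam c T \<Longrightarrow> 0 \<le> a \<Longrightarrow> b \<le> 1 \<Longrightarrow> continuous_on {a..b} T"
  by (rule continuous_on_subset[OF profileD(1)]) auto

lemma slope_clipped: "Ti \<le> T \<Longrightarrow> T \<le> 2 * c \<Longrightarrow> slope c w T = heat c w T / \<phi> T"
  by (simp add: slope_def clip_id)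

text \<open>
  \<open>2 * c\<close> is a barrier: \<open>heat c w (2 * c) = - q0 * burnt w \<le> 0\<close>.
\<close>

lemma profile_le_double:
  assumes T: "profile lam c T" and "lam \<ge> 0" "c \<ge> ccj" "0 \<le> w" "w \<le> 1"
  shows "T w \<le> 2 * c"
proof -
  have Tic: "Ti \<le> 2 * c" using assms Ti_less_ccj ccj_pos by linarith
  have "2 * c - T w \<ge> 0"
  proof (rule nonneg_of_deriv_ge[where a = 0 and b = w and D = "\<lambda>s. 2 * c - T s" and L = 0])
    show "continuous_on {0..w} (\<lambda>s. 2 * c - T s)"
      by (intro continuous_intros profile_cont_sub[OF T]) (use assms in auto)
    show "2 * c - T 0 \<ge> 0" using profileD(2)[OF T] Tic by simp
    fix s assume s: "0 < s" "s < w"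
    have "((\<lambda>s. 2 * c - T s) has_real_derivative - (lam * slope c s (T s))) (at s)"
      using s assms by (auto intro!: derivative_eq_intros profileD(3)[OF T])
    moreover have "0 \<le> - (lam * slope c s (T s))" if "2 * c < T s"
    proof -
      have "clip c (T s) = 2 * c" using that Tic by (simp add: clip_def)
      moreover have "0 \<le> burnt s" using burnt_bounds[of s] s assms by simp
      ultimately show ?thesis using \<phi>_pos[OF Tic] q0 \<open>lam \<ge> 0\<close>
        by (simp add: slope_def heat_top mult_nonneg_nonneg)
    qed
    ultimately show "\<exists>d. ((\<lambda>s. 2 * c - T s) has_real_derivative d) (at s) \<and>
        (2 * c - T s < 0 \<longrightarrow> 0 * (2 * c - T s) \<le> d)" by auto
  qed (use assms in auto)
  thus ?thesis by simp
qed

lemma heat_antimono: "s \<le> t \<Longrightarrow> t \<le> 1 \<Longrightarrow> heat c t x \<le> heat c s x"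
  unfolding heat_def using burnt_mono[of s t] q0 by (simp add: mult_left_mono)

text \<open>
  A profile can fall below \<open>Ti\<close> only when \<open>heat c w Ti < 0\<close>, and since \<open>heat\<close> decreases in \<open>w\<close> this
  stays so until \<open>w = 1\<close>. Then \<open>Ti\<close> is an upper barrier, and the profile ends below \<open>Ti < T\<^sub>0(c)\<close>.
\<close>

lemma profile_ge_Ti:
  assumes T: "profile lam c T" and lam: "lam \<ge> 0" and c: "c \<ge> ccj" and fin: "T 1 \<ge> T0 c"
    and w: "0 \<le> w" "w \<le> 1"
  shows "T w \<ge> Ti"
proof (rule ccontr)
  assume neg: "\<not> T w \<ge> Ti"
  have Tic: "Ti \<le> 2 * c" using c Ti_less_ccj ccj_pos by linarith
  have clipTi: "clip c x = Ti" if "x \<le> Ti" for x using that Tic by (simp add: clip_def)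
  have neg_heat: "heat c w Ti < 0"
  proof (rule ccontr)
    assume nn: "\<not> heat c w Ti < 0"
    have "T w - Ti \<ge> 0"
    proof (rule nonneg_of_deriv_ge[where a = 0 and b = w and D = "\<lambda>s. T s - Ti" and L = 0])
      show "continuous_on {0..w} (\<lambda>s. T s - Ti)"
        by (intro continuous_intros profile_cont_sub[OF T]) (use w in auto)
      show "T 0 - Ti \<ge> 0" using profileD(2)[OF T] by simp
      fix s assume s: "0 < s" "s < w"
      have "((\<lambda>s. T s - Ti) has_real_derivative lam * slope c s (T s)) (at s)"
        using s w by (auto intro!: derivative_eq_intros profileD(3)[OF T])
      moreover have "0 \<le> lam * slope c s (T s)" if "T s < Ti"
        using that clipTi[of "T s"] \<phi>_pos[of Ti] lam nn heat_antimono[of s w c Ti] s w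
        by (auto simp: slope_def)
      ultimately show "\<exists>d. ((\<lambda>s. T s - Ti) has_real_derivative d) (at s) \<and>
          (T s - Ti < 0 \<longrightarrow> 0 * (T s - Ti) \<le> d)" by auto
    qed (use w in auto)
    with neg show False by simp
  qed
  obtain B where B: "slope_bounded c B" using slope_bounded_exists by blast
  have "Ti - T 1 \<ge> 0"
  proof (rule nonneg_of_deriv_ge[where a = w and b = 1 and D = "\<lambda>s. Ti - T s" and L = "lam * B"])
    show "continuous_on {w..1} (\<lambda>s. Ti - T s)"
      by (intro continuous_intros profile_cont_sub[OF T]) (use w in auto)
    show "Ti - T w \<ge> 0" using neg by simp
    fix s assume s: "w < s" "s < 1"
    have "((\<lambda>s. Ti - T s) has_real_derivative - (lam * slope c s (T s))) (at s)"
      using s w by (auto intro!: derivative_eq_intros profileD(3)[OF T])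
    moreover have "lam * B * (Ti - T s) \<le> - (lam * slope c s (T s))" if "Ti < T s"
    proof -
      have "slope c s Ti \<le> 0"
        using clipTi[of Ti] \<phi>_pos[of Ti] neg_heat heat_antimono[of w s c Ti] s
        by (auto simp: slope_def divide_nonpos_pos)
      moreover have "\<bar>slope c s (T s) - slope c s Ti\<bar> \<le> B * \<bar>T s - Ti\<bar>"
        using slope_boundedD(3)[OF B c order_refl, of s "T s" Ti] s w by simp
      ultimately have "slope c s (T s) \<le> B * (T s - Ti)" using that by simp
      from mult_left_mono[OF this lam] show ?thesis by (simp add: algebra_simps)
    qed
    ultimately show "\<exists>d. ((\<lambda>s. Ti - T s) has_real_derivative d) (at s) \<and>
        (Ti - T s < 0 \<longrightarrow> lam * B * (Ti - T s) \<le> d)" by auto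
  qed (use w in auto)
  with fin Ti_less_T0[OF c] show False by simp
qed

text \<open>
  The profiles that continue to a strong wave; they never meet the clipping.
\<close>

definition strong_profile :: "real \<Rightarrow> real \<Rightarrow> (real \<Rightarrow> real) \<Rightarrow> bool" where
  "strong_profile lam c T \<longleftrightarrow> profile lam c T \<and> lam > 0 \<and> c \<ge> ccj \<and> T 1 \<ge> T0 c"

lemma strong_profileD:
  assumes "strong_profile lam c T"
  shows "profile lam c T" "lam > 0" "c \<ge> ccj" "T 1 \<ge> T0 c" "continuous_on {0..1} T" "T 0 = Ti"
    and "0 \<le> w \<Longrightarrow> w \<le> 1 \<Longrightarrow> Ti \<le> T w" "0 \<le> w \<Longrightarrow> w \<le> 1 \<Longrightarrow> T w \<le> 2 * c"
    and "0 < w \<Longrightarrow> w < 1 \<Longrightarrow> (T has_real_derivative lam * (heat c w (T w) / \<phi> (T w))) (at w)"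
proof -
  note a = assms[unfolded strong_profile_def]
  show 1: "profile lam c T" "lam > 0" "c \<ge> ccj" "T 1 \<ge> T0 c" using a by auto
  show "continuous_on {0..1} T" "T 0 = Ti" using profileD[OF 1(1)] by auto
  show 2: "Ti \<le> T w" if "0 \<le> w" "w \<le> 1" for w using profile_ge_Ti[OF 1(1)] 1 that by auto
  show 3: "T w \<le> 2 * c" if "0 \<le> w" "w \<le> 1" for w using profile_le_double[OF 1(1)] 1 that by auto
  show "(T has_real_derivative lam * (heat c w (T w) / \<phi> (T w))) (at w)" if "0 < w" "w < 1"
    using profileD(3)[OF 1(1) that] slope_clipped[of "T w" c w] 2[of w] 3[of w] that by simp
qed

lemma continuous_on_\<phi>_comp:
  assumes "continuous_on S T" "\<And>w. w \<in> S \<Longrightarrow> Ti \<le> T w" "\<And>w. w \<in> S \<Longrightarrow> T w \<le> R"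
  shows "continuous_on S (\<lambda>w. \<phi> (T w))"
  by (rule continuous_on_compose2[OF C2_on_continuous_on[OF \<phi>_C2[of R]] assms(1)]) (use assms in auto)

lemma continuous_on_heat_comp:
  assumes "continuous_on S T" "S \<subseteq> {..1}"
  shows "continuous_on S (\<lambda>w. heat c w (T w))"
  unfolding heat_def by (intro continuous_intros assms continuous_on_subset[OF continuous_on_burnt]) auto

text \<open>
  Let \<open>G w = heat c w (T w)\<close>. As \<open>T' = lam * G / \<phi> T\<close>, the chain rule gives
  \<open>G' = a * G - q0 * burnt'\<close> with a continuous coefficient \<open>a\<close>. So \<open>G\<close> times the integrating factor
  \<open>exp (- \<integral> a)\<close> is strictly decreasing, and \<open>G\<close> can only change from positive to negative.
\<close>

lemma heat_sign_change:
  assumes T: "strong_profile lam c T" and xy: "0 \<le> x" "x < y" "y \<le> 1"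
    and neg: "heat c x (T x) \<le> 0"
  shows "heat c y (T y) < 0"
proof -
  note TD = strong_profileD[OF T]
  define G where "G = (\<lambda>w. heat c w (T w))"
  define a where "a = (\<lambda>w. (c - T w) * (lam / \<phi> (T w)))"
  have \<phi>T: "\<phi> (T w) > 0" if "0 \<le> w" "w \<le> 1" for w using TD(7) that by (intro \<phi>_pos) auto
  have conta: "continuous_on {0..1} a" unfolding a_def
    by (intro continuous_intros TD(5) continuous_on_\<phi>_comp[where R = "2 * c"])
       (use TD \<phi>T in \<open>force simp: less_le\<close>)+
  define A where "A = (\<lambda>w. integral {0..w} a)"
  have A: "(A has_real_derivative a w) (at w within {0..1})" if "w \<in> {0..1}" for w
    unfolding A_def by (rule integral_has_real_derivative[OF conta that])
  have contA: "continuous_on {0..1} A" by (rule DERIV_continuous_on[OF A])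
  define E where "E = (\<lambda>w. G w * exp (- A w))"
  have "E y < E x"
  proof (rule DERIV_neg_imp_decreasing_open[where f = E])
    show "continuous_on {x..y} E" unfolding E_def G_def
      by (intro continuous_intros continuous_on_heat_comp continuous_on_subset[OF TD(5)]
           continuous_on_subset[OF contA]) (use xy in auto)
    fix w assume w: "x < w" "w < y"
    hence w01: "0 < w" "w < 1" using xy by auto
    hence nhd: "at w within {0..1} = at w" by (intro at_within_interior) auto
    have dA: "(A has_real_derivative a w) (at w)" using A[of w] w01 nhd by simp
    have dG: "(G has_real_derivative a w * G w - q0 * (\<gamma> * (1 - w) powr (\<gamma> - 1))) (at w)"
    proof -
      define d where "d = lam * (heat c w (T w) / \<phi> (T w))"
      have "(G has_real_derivative c * d - T w * d - q0 * (\<gamma> * (1 - w) powr (\<gamma> - 1))) (at w)"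
        unfolding G_def heat_def
        by (auto intro!: derivative_eq_intros TD(9)[OF w01, folded d_def] burnt_deriv w01)
      moreover have "c * d - T w * d = a w * G w" by (simp add: a_def G_def d_def algebra_simps diff_divide_distrib)
      ultimately show ?thesis by simp
    qed
    have "(E has_real_derivative - (q0 * (\<gamma> * (1 - w) powr (\<gamma> - 1)) * exp (- A w))) (at w)"
      unfolding E_def by (rule derivative_eq_intros dA dG refl)+ (simp add: algebra_simps)
    moreover have "q0 * (\<gamma> * (1 - w) powr (\<gamma> - 1)) * exp (- A w) > 0"
      using q0 \<gamma>_ge w01 by simp
    ultimately show "\<exists>d. (E has_real_derivative d) (at w) \<and> d < 0" by (intro exI conjI) auto
  qed fact
  also have "E x \<le> 0" using neg by (simp add: E_def G_def mult_nonpos_nonneg)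
  finally show ?thesis by (simp add: E_def G_def mult_less_0_iff)
qed

lemma heat_pos_of_special:
  assumes T: "strong_profile lam c T" and "T 1 = T0 c" and "0 \<le> w" "w < 1"
  shows "heat c w (T w) > 0"
proof (rule ccontr)
  assume "\<not> heat c w (T w) > 0"
  hence "heat c 1 (T 1) < 0" using assms by (intro heat_sign_change[OF T, of w]) auto
  thus False using assms heat_T0[of c 1] strong_profileD(3)[OF T] by simp
qed

lemma heat_neg_beyond_T0:
  assumes "c \<ge> ccj" "x > T0 c"
  shows "heat c 1 x < 0"
proof -
  have "x * (2 * c - x) - T0 c * (2 * c - T0 c) = (x - T0 c) * ((c - x) + (c - T0 c))"
    by (simp add: algebra_simps)
  also have "\<dots> < 0" using assms T0_root(2)[OF assms(1)] by (intro mult_pos_neg) auto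
  finally show ?thesis using T0_root(1)[OF assms(1)]
    by (simp add: heat_def algebra_simps power2_eq_square)
qed

text \<open>
  While \<open>heat\<close> is positive, \<open>T\<close> has increased from \<open>Ti\<close>; once it is not, \<open>T\<close> decreases to its final
  value, which is at least \<open>T\<^sub>0(c) > Ti\<close>.
\<close>

lemma strong_profile_gt_Ti:
  assumes T: "strong_profile lam c T" and w: "0 < w" "w \<le> 1"
  shows "T w > Ti"
proof (cases "heat c w (T w) > 0")
  case True
  have "T 0 < T w"
  proof (rule DERIV_pos_imp_increasing_open[where f = T])
    show "continuous_on {0..w} T"
      by (rule continuous_on_subset[OF strong_profileD(5)[OF T]]) (use w in auto)
    fix s assume s: "0 < s" "s < w"
    have "heat c s (T s) > 0"
      using heat_sign_change[OF T, of s w] s w True by (meson less_imp_le not_le order.asym)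
    moreover have "\<phi> (T s) > 0" using strong_profileD(7)[OF T, of s] s w by (intro \<phi>_pos) auto
    ultimately have "lam * (heat c s (T s) / \<phi> (T s)) > 0" using strong_profileD(2)[OF T] by simp
    thus "\<exists>d. (T has_real_derivative d) (at s) \<and> d > 0"
      using strong_profileD(9)[OF T, of s] s w by auto
  qed (use w in auto)
  thus ?thesis using strong_profileD(6)[OF T] by simp
next
  case False
  have "T w \<ge> T 1"
  proof (rule DERIV_nonpos_imp_decreasing_open[where f = T])
    show "continuous_on {w..1} T"
      by (rule continuous_on_subset[OF strong_profileD(5)[OF T]]) (use w in auto)
    fix s assume s: "w < s" "s < 1"
    have "heat c s (T s) < 0" using heat_sign_change[OF T, of w s] s w False by auto
    moreover have "\<phi> (T s) > 0" using strong_profileD(7)[OF T, of s] s w by (intro \<phi>_pos) auto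
    ultimately have "lam * (heat c s (T s) / \<phi> (T s)) \<le> 0"
      using strong_profileD(2)[OF T] by (simp add: divide_nonpos_pos mult_nonneg_nonpos)
    thus "\<exists>d. (T has_real_derivative d) (at s) \<and> d \<le> 0"
      using strong_profileD(9)[OF T, of s] s w by (intro exI conjI) auto
  qed (use w in auto)
  also have "T 1 \<ge> T0 c" by (rule strong_profileD(4)[OF T])
  finally show ?thesis using Ti_less_T0 strong_profileD(3)[OF T] by force
qed

lemma special_profile_mono:
  assumes T: "strong_profile lam c T" and "T 1 = T0 c" and xy: "0 \<le> x" "x \<le> y" "y \<le> 1"
  shows "T x \<le> T y"
proof (rule DERIV_nonneg_imp_increasing_open[where f = T])
  show "continuous_on {x..y} T"
    by (rule continuous_on_subset[OF strong_profileD(5)[OF T]]) (use xy in auto)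
  fix s assume s: "x < s" "s < y"
  have "heat c s (T s) > 0" using heat_pos_of_special[OF T] assms s by auto
  moreover have "\<phi> (T s) > 0" using strong_profileD(7)[OF T, of s] s xy by (intro \<phi>_pos) auto
  ultimately have "lam * (heat c s (T s) / \<phi> (T s)) \<ge> 0" using strong_profileD(2)[OF T] by simp
  thus "\<exists>d. (T has_real_derivative d) (at s) \<and> d \<ge> 0"
    using strong_profileD(9)[OF T, of s] s xy by auto
qed (use xy in auto)

text \<open>
  Half the minimum of \<open>T * (2 * c - T)\<close> over \<open>Ti \<le> T \<le> T\<^sub>0(c)\<close> and \<open>c \<ge> c\<^sup>c\<^sup>j\<close>.
\<close>

definition heat_lb :: real where "heat_lb = Ti * (2 * ccj - Ti) / 2"

lemma heat_lb_pos: "heat_lb > 0" using Ti0 Ti_less_ccj by (simp add: heat_lb_def)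

text \<open>
  The concave function \<open>x * (2 * c - x)\<close> equals \<open>2 * q0\<close> at \<open>T\<^sub>0(c)\<close> and at \<open>T\<^sub>1(c) = 2 * c - T\<^sub>0(c)\<close>.
  Between them it is at least \<open>2 * q0\<close>; below \<open>T\<^sub>1(c)\<close> it is increasing.
\<close>

lemma heat_lb_le:
  assumes c: "c \<ge> ccj" and x: "Ti \<le> x" "x \<le> T0 c"
  shows "heat_lb \<le> x * (2 * c - x) / 2"
proof (cases "x \<le> 2 * c - T0 c")
  case True
  have "x \<le> c" using True T0_root(2)[OF c] by simp
  hence "0 \<le> (x - Ti) * (2 * c - x - Ti)" using x by (intro mult_nonneg_nonneg) auto
  also have "\<dots> = x * (2 * c - x) - Ti * (2 * c - Ti)" by (simp add: algebra_simps)
  finally have "Ti * (2 * c - Ti) \<le> x * (2 * c - x)" by simp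
  moreover have "Ti * (2 * ccj - Ti) \<le> Ti * (2 * c - Ti)" using c Ti0 by (intro mult_left_mono) auto
  ultimately show ?thesis by (simp add: heat_lb_def)
next
  case False
  hence "0 \<le> (x - (2 * c - T0 c)) * (T0 c - x)" using x by (intro mult_nonneg_nonneg) auto
  also have "\<dots> = x * (2 * c - x) - T0 c * (2 * c - T0 c)" by (simp add: algebra_simps)
  finally have "2 * q0 \<le> x * (2 * c - x)" using T0_root(1)[OF c] by simp
  moreover have "2 * heat_lb \<le> 2 * q0"
  proof -
    have "0 \<le> (ccj - Ti)\<^sup>2" by simp
    thus ?thesis using ccj_sq by (simp add: heat_lb_def power2_eq_square algebra_simps)
  qed
  ultimately show ?thesis by simp
qed

text \<open>
  Up to \<open>early_end\<close> so little fuel is burnt that half of the convective part of \<open>heat\<close> survives, whatever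
  the speed.
\<close>

definition early_end :: real where
  "early_end = (SOME d. 0 < d \<and> d < 1 \<and> (\<forall>w. 0 \<le> w \<and> w \<le> d \<longrightarrow> q0 * burnt w \<le> heat_lb / 2))"

lemma early_end: "0 < early_end" "early_end < 1" "0 \<le> w \<Longrightarrow> w \<le> early_end \<Longrightarrow> q0 * burnt w \<le> heat_lb / 2"
proof -
  have "(burnt \<longlongrightarrow> burnt 0) (at 0)"
    using DERIV_isCont[OF burnt_deriv[of 0]] by (simp add: isCont_def)
  moreover have "0 < heat_lb / (2 * q0)" using heat_lb_pos q0 by simp
  ultimately have "\<forall>\<^sub>F w in at 0. burnt w < heat_lb / (2 * q0)" by (intro order_tendstoD) auto
  then obtain d where d: "d > 0" "\<And>w. w \<noteq> 0 \<Longrightarrow> \<bar>w\<bar> < d \<Longrightarrow> burnt w < heat_lb / (2 * q0)"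
    by (auto simp: eventually_at dist_real_def)
  have "q0 * burnt w \<le> heat_lb / 2" if "0 \<le> w" "w \<le> min (d / 2) (1 / 2)" for w
  proof -
    have "burnt w \<le> heat_lb / (2 * q0)" using d(2)[of w] that d(1) heat_lb_pos q0
      by (cases "w = 0") auto
    thus ?thesis using q0 by (simp add: field_simps)
  qed
  hence "\<exists>d. 0 < d \<and> d < 1 \<and> (\<forall>w. 0 \<le> w \<and> w \<le> d \<longrightarrow> q0 * burnt w \<le> heat_lb / 2)"
    using d(1) by (intro exI[of _ "min (d / 2) (1 / 2)"]) auto
  from someI_ex[OF this] show "0 < early_end" "early_end < 1" "0 \<le> w \<Longrightarrow> w \<le> early_end \<Longrightarrow> q0 * burnt w \<le> heat_lb / 2"
    by (auto simp: early_end_def)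
qed

lemma heat_lower:
  assumes "c \<ge> ccj" "Ti \<le> x" "x \<le> T0 c" "0 \<le> w" "w \<le> early_end"
  shows "x * (2 * c - x) / 4 \<le> heat c w x" "heat_lb / 2 \<le> heat c w x"
proof -
  have "heat c w x = x * (2 * c - x) / 2 - q0 * burnt w"
    by (simp add: heat_def field_simps power2_eq_square)
  thus "x * (2 * c - x) / 4 \<le> heat c w x" "heat_lb / 2 \<le> heat c w x"
    using heat_lb_le[OF assms(1-3)] early_end(3)[OF assms(4,5)] by simp_all
qed

section \<open>The critical parameter\<close>

lemma strong_profile_if_reaches:
  assumes "profile lam c T" "lam > 0" "c \<ge> ccj" "T 1 = T0 c"
  shows "strong_profile lam c T"
  using assms by (simp add: strong_profile_def)

text \<open>
  The problem is almost logistic: up to \<open>early_end\<close>, the logarithm of \<open>T / (2 * c - T)\<close> has derivative at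
  least \<open>lam * inv_rate_lb * c / 2\<close>. Its total increase is bounded, because \<open>T \<ge> Ti\<close> at the start
  and \<open>2 * c - T \<ge> 2 * c - T\<^sub>0(c) \<ge> q0 / c\<close> all along.
\<close>

lemma ln_bound_special:
  assumes T: "profile lam c T" and lam: "lam > 0" and c: "c \<ge> ccj" and fin: "T 1 = T0 c"
  shows "lam * (inv_rate_lb * c * early_end / 2) \<le> ln (4 * c^3 / (q0 * Ti))"
proof -
  have S: "strong_profile lam c T" using assms by (intro strong_profile_if_reaches)
  note SD = strong_profileD[OF S]
  have cpos: "c > 0" using c ccj_pos by simp
  note T0r = T0_root[OF c]
  have T_le: "T w \<le> T0 c" if "0 \<le> w" "w \<le> 1" for w
    using special_profile_mono[OF S fin that(1,2)] fin by simp
  have T_pos: "T w > 0" "2 * c - T w > 0" if "0 \<le> w" "w \<le> 1" for w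
    using SD(7)[OF that] Ti0 T_le[OF that] T0r(3) by auto
  define E where "E = (\<lambda>w. ln (T w) - ln (2 * c - T w) - lam * inv_rate_lb * c / 2 * w)"
  have "E 0 \<le> E early_end"
  proof (rule DERIV_nonneg_imp_increasing_open[where f = E])
    have ct: "continuous_on {0..early_end} T" by (rule profile_cont_sub[OF T]) (use early_end in auto)
    show "continuous_on {0..early_end} E" unfolding E_def
      by (intro continuous_intros ct) (use T_pos early_end in force)+
    fix w assume w: "0 < w" "w < early_end"
    hence w01: "0 < w" "w < 1" using early_end by auto
    define d where "d = lam * (heat c w (T w) / \<phi> (T w))"
    have dT: "(T has_real_derivative d) (at w)" unfolding d_def by (rule SD(9)[OF w01])
    have p: "T w > 0" "2 * c - T w > 0" using T_pos[of w] w01 by auto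
    have Ti: "Ti \<le> T w" "T w \<le> T0 c" using SD(7) T_le w01 by auto
    have "inv_rate_lb \<le> 1 / \<phi> (T w)" using inv_rate_lb(2) Ti by simp
    have "lam * (T w * (2 * c - T w) / 4 * inv_rate_lb) \<le> lam * (heat c w (T w) * (1 / \<phi> (T w)))"
      using heat_lower[OF c Ti, of w] w lam p inv_rate_lb(1) \<open>inv_rate_lb \<le> 1 / \<phi> (T w)\<close> heat_lower(2)[OF c Ti, of w] heat_lb_pos
      by (intro mult_left_mono mult_mono) auto
    also have "lam * (heat c w (T w) * (1 / \<phi> (T w))) = d" by (simp add: d_def)
    finally have d: "lam * inv_rate_lb / 4 * (T w * (2 * c - T w)) \<le> d" by (simp add: mult_ac)
    have "(E has_real_derivative (d / T w + d / (2 * c - T w) - lam * inv_rate_lb * c / 2)) (at w)"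
      unfolding E_def using p by (auto intro!: derivative_eq_intros dT)
    moreover have "d / T w + d / (2 * c - T w) - lam * inv_rate_lb * c / 2 \<ge> 0"
    proof -
      have "d / T w + d / (2 * c - T w) = d * (2 * c) / (T w * (2 * c - T w))"
        using p by (simp add: field_simps)
      moreover have "lam * inv_rate_lb / 4 \<le> d / (T w * (2 * c - T w))"
        using d p by (simp add: pos_le_divide_eq)
      from mult_right_mono[OF this, of "2 * c"] cpos
      have "lam * inv_rate_lb * c / 2 \<le> d * (2 * c) / (T w * (2 * c - T w))" by (simp add: mult_ac)
      ultimately show ?thesis by simp
    qed
    ultimately show "\<exists>y. (E has_real_derivative y) (at w) \<and> y \<ge> 0" by blast
  qed (use early_end in auto)
  hence "lam * (inv_rate_lb * c * early_end / 2) \<le> ln (T early_end) - ln (2 * c - T early_end) - ln Ti + ln (2 * c - Ti)"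
    using SD(6) by (simp add: E_def algebra_simps)
  also have "\<dots> \<le> ln (2 * c) - ln (q0 / c) - ln Ti + ln (2 * c)"
  proof -
    have dl01: "0 \<le> early_end" "early_end \<le> 1" using early_end by auto
    have "ln (T early_end) \<le> ln (2 * c)" using T_pos[OF dl01] cpos by simp
    moreover have "ln (2 * c - Ti) \<le> ln (2 * c)"
      using Ti0 Ti_less_ccj c by (subst ln_le_cancel_iff) auto
    moreover have "ln (q0 / c) \<le> ln (2 * c - T early_end)"
    proof -
      have "2 * q0 \<le> 2 * c * (2 * c - T0 c)"
        using T0r mult_right_mono[of "T0 c" "2 * c" "2 * c - T0 c"] by simp
      hence "q0 / c \<le> 2 * c - T0 c" using cpos by (simp add: field_simps)
      also have "\<dots> \<le> 2 * c - T early_end" using T_le[OF dl01] by simp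
      finally show ?thesis using cpos q0 T_pos[OF dl01] by (subst ln_le_cancel_iff) auto
    qed
    ultimately show ?thesis by linarith
  qed
  also have "\<dots> = ln (4 * c^3 / (q0 * Ti))"
  proof -
    have "4 * c^3 / (q0 * Ti) = 2 * c / (q0 / c) / Ti * (2 * c)"
      using cpos q0 Ti0 by (simp add: field_simps power3_eq_cube)
    moreover have "ln 4 = 2 * ln (2::real)" using ln_mult[of 2 "2::real"] by simp
    ultimately show ?thesis using cpos q0 Ti0 by (simp add: ln_mult ln_div)
  qed
  finally show ?thesis .
qed

text \<open>
  Strict monotonicity of the endpoint in \<open>lam\<close>, with a linear rate that is uniform for bounded
  speeds. The difference \<open>D\<close> of the profiles satisfies \<open>D' \<ge> (lam2 - lam1) * slope - L * \<bar>D\<bar>\<close> with the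
  slope of the lower profile, which is never negative as that profile is special, and is bounded
  away from 0 up to \<open>early_end\<close>. This gap can shrink afterwards only by the factor \<open>exp (- L)\<close>.
\<close>

lemma profile_endpoint_strictly_increasing:
  "\<exists>m>0. \<forall>c lam1 lam2 T1 T2. ccj \<le> c \<and> c \<le> C \<and> 0 < lam1 \<and> lam1 < lam2 \<and> lam2 \<le> A \<and>
     profile lam1 c T1 \<and> T1 1 = T0 c \<and> profile lam2 c T2 \<longrightarrow> m * (lam2 - lam1) \<le> T2 1 - T0 c"
proof -
  obtain B where B: "slope_bounded C B" using slope_bounded_exists by blast
  define L where "L = \<bar>A\<bar> * \<bar>B\<bar>"
  define b where "b = heat_lb / 2 * inv_rate_lb"
  have b: "b > 0" using heat_lb_pos inv_rate_lb(1) by (simp add: b_def)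
  have L: "L \<ge> 0" by (simp add: L_def)
  have "b * early_end * exp (- L) * (lam2 - lam1) \<le> T2 1 - T0 c"
    if c: "ccj \<le> c" "c \<le> C" and lam: "0 < lam1" "lam1 < lam2" "lam2 \<le> A"
      and T1: "profile lam1 c T1" "T1 1 = T0 c" and T2: "profile lam2 c T2" for c lam1 lam2 T1 T2
  proof -
    have S1: "strong_profile lam1 c T1" using T1 lam c by (intro strong_profile_if_reaches) auto
    note SD = strong_profileD[OF S1]
    define D where "D = (\<lambda>w. T2 w - T1 w)"
    define d where "d = (\<lambda>w. lam2 * slope c w (T2 w) - lam1 * slope c w (T1 w))"
    have contD: "continuous_on {x..y} D" if "0 \<le> x" "y \<le> 1" for x y unfolding D_def
      by (intro continuous_intros profile_cont_sub[OF T1(1)] profile_cont_sub[OF T2] that)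
    have dD: "(D has_real_derivative d w) (at w)" if "0 < w" "w < 1" for w unfolding D_def d_def
      by (intro DERIV_diff profileD(3)[OF T1(1)] profileD(3)[OF T2] that)
    have D0: "D 0 = 0" using profileD(2)[OF T1(1)] profileD(2)[OF T2] by (simp add: D_def)
    have heat1: "slope c w (T1 w) = heat c w (T1 w) / \<phi> (T1 w)" if "0 < w" "w < 1" for w
      by (rule slope_clipped) (use SD that in auto)
    have \<phi>1: "\<phi> (T1 w) > 0" if "0 < w" "w < 1" for w using SD(7) that by (intro \<phi>_pos) auto
    have slope1: "slope c w (T1 w) \<ge> 0" if "0 < w" "w < 1" for w
      unfolding heat1[OF that] using \<phi>1[OF that] heat_pos_of_special[OF S1 T1(2), of w] that by simp
    have slope1': "slope c w (T1 w) \<ge> b" if "0 < w" "w < early_end" for w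
    proof -
      have w: "0 < w" "w < 1" using that early_end by auto
      have "T1 w \<le> T0 c" using special_profile_mono[OF S1 T1(2), of w 1] w T1(2) by simp
      hence "heat_lb / 2 \<le> heat c w (T1 w)" using SD w that by (intro heat_lower(2)) auto
      hence "heat_lb / 2 * inv_rate_lb \<le> heat c w (T1 w) * (1 / \<phi> (T1 w))"
        using heat_lb_pos inv_rate_lb(1) inv_rate_lb(2)[of "T1 w"] SD(7)[of w] w by (intro mult_mono) auto
      thus ?thesis using heat1[OF w] by (simp add: b_def)
    qed
    have lower: "(lam2 - lam1) * slope c w (T1 w) - L * \<bar>D w\<bar> \<le> d w" if "0 < w" "w < 1" for w
    proof -
      have "\<bar>lam2 * (slope c w (T2 w) - slope c w (T1 w))\<bar> \<le> \<bar>A\<bar> * (\<bar>B\<bar> * \<bar>D w\<bar>)"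
      proof -
        have "\<bar>slope c w (T2 w) - slope c w (T1 w)\<bar> \<le> B * \<bar>T2 w - T1 w\<bar>"
          using slope_boundedD(3)[OF B c, of w "T2 w" "T1 w"] that by simp
        also have "\<dots> \<le> \<bar>B\<bar> * \<bar>T2 w - T1 w\<bar>" by (intro mult_right_mono) auto
        finally show ?thesis unfolding abs_mult D_def using lam by (intro mult_mono) auto
      qed
      moreover have "d w = (lam2 - lam1) * slope c w (T1 w) + lam2 * (slope c w (T2 w) - slope c w (T1 w))"
        by (simp add: d_def algebra_simps)
      ultimately show ?thesis by (simp add: L_def mult.assoc abs_le_iff)
    qed
    have D_nonneg: "D w \<ge> 0" if w: "0 \<le> w" "w \<le> 1" for w
    proof (rule nonneg_of_deriv_ge[where a = 0 and b = w and D = D and L = L])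
      fix s assume s: "0 < s" "s < w"
      have "L * D s \<le> d s" if "D s < 0"
      proof -
        have "0 \<le> (lam2 - lam1) * slope c s (T1 s)" using slope1[of s] s w lam by simp
        moreover have "L * \<bar>D s\<bar> = - (L * D s)" using that by simp
        ultimately show ?thesis using lower[of s] s w by linarith
      qed
      thus "\<exists>d. (D has_real_derivative d) (at s) \<and> (D s < 0 \<longrightarrow> L * D s \<le> d)"
        using dD[of s] s w by auto
    qed (use w contD D0 in auto)
    have expd: "((\<lambda>w. D w * exp (L * w)) has_real_derivative (d w + L * D w) * exp (L * w)) (at w)"
      if "0 < w" "w < 1" for w
      by (auto intro!: derivative_eq_intros dD that simp: algebra_simps)
    have "D 0 * exp (L * 0) - (lam2 - lam1) * b * 0 \<le> D early_end * exp (L * early_end) - (lam2 - lam1) * b * early_end"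
    proof (rule DERIV_nonneg_imp_increasing_open[where f = "\<lambda>w. D w * exp (L * w) - (lam2 - lam1) * b * w"])
      show "continuous_on {0..early_end} (\<lambda>w. D w * exp (L * w) - (lam2 - lam1) * b * w)"
        by (intro continuous_intros contD) (use early_end in auto)
      fix w assume w: "0 < w" "w < early_end"
      hence w1: "0 < w" "w < 1" using early_end by auto
      have "(lam2 - lam1) * b \<le> (lam2 - lam1) * slope c w (T1 w)"
        using slope1'[OF w] lam by (intro mult_left_mono) auto
      also have "\<dots> \<le> d w + L * D w" using lower[OF w1] D_nonneg[of w] w1 by simp
      finally have 1: "(lam2 - lam1) * b \<le> d w + L * D w" .
      have "(lam2 - lam1) * b * 1 \<le> (d w + L * D w) * exp (L * w)"
      proof (intro mult_mono 1)
        have "0 \<le> (lam2 - lam1) * b" using lam b by simp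
        thus "0 \<le> d w + L * D w" using 1 by linarith
      qed (use L w in auto)
      thus "\<exists>y. ((\<lambda>w. D w * exp (L * w) - (lam2 - lam1) * b * w) has_real_derivative y) (at w) \<and> 0 \<le> y"
        using DERIV_diff[OF expd[OF w1] DERIV_cmult_Id[of "(lam2 - lam1) * b"]]
        by (intro exI[of _ "(d w + L * D w) * exp (L * w) - (lam2 - lam1) * b"]) auto
    qed (use early_end in auto)
    hence "(lam2 - lam1) * b * early_end \<le> D early_end * exp (L * early_end)" using D0 by simp
    also have "\<dots> \<le> D 1 * exp (L * 1)"
    proof (rule DERIV_nonneg_imp_increasing_open[where f = "\<lambda>w. D w * exp (L * w)"])
      show "continuous_on {early_end..1} (\<lambda>w. D w * exp (L * w))"
        by (intro continuous_intros contD) (use early_end in auto)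
      fix w assume "early_end < w" "w < (1::real)"
      hence w1: "0 < w" "w < 1" using early_end by auto
      have "0 \<le> (lam2 - lam1) * slope c w (T1 w)" using slope1[OF w1] lam by simp
      also have "\<dots> \<le> d w + L * D w" using lower[OF w1] D_nonneg[of w] w1 by simp
      finally show "\<exists>y. ((\<lambda>w. D w * exp (L * w)) has_real_derivative y) (at w) \<and> 0 \<le> y"
        using expd[OF w1] by (intro exI[of _ "(d w + L * D w) * exp (L * w)"]) auto
    qed (use early_end in auto)
    finally have "(lam2 - lam1) * b * early_end * exp (- L) \<le> D 1 * exp L * exp (- L)"
      by (intro mult_right_mono) auto
    also have "\<dots> = D 1" by (simp add: exp_minus field_simps)
    finally show ?thesis using T1(2) by (simp add: D_def mult_ac)
  qed
  moreover have "b * early_end * exp (- L) > 0" using b early_end by simp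
  ultimately show ?thesis by blast
qed

text \<open>
  By the intermediate value theorem in \<open>lam\<close>: for \<open>lam = 0\<close> the profile is constantly \<open>Ti\<close>, and for
  large \<open>lam\<close> it reaches \<open>T\<^sub>0(c)\<close> by \<open>early_end\<close>. It cannot fall below \<open>T\<^sub>0(c)\<close> later, because
  \<open>heat\<close> is nonnegative at \<open>T\<^sub>0(c)\<close>.
\<close>

lemma profile_reaches_T0:
  assumes c: "c \<ge> ccj"
  shows "\<exists>lam>0. sol lam c 1 = T0 c"
proof -
  \<comment> \<open>the parameter for which growth at the minimal rate reaches \<open>T\<^sub>0(c)\<close> exactly at \<open>early_end\<close>\<close>
  define A where "A = (T0 c - Ti) / (early_end * (heat_lb / 2 * inv_rate_lb))"
  have b: "heat_lb / 2 * inv_rate_lb > 0" using heat_lb_pos inv_rate_lb(1) by simp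
  have A: "A > 0" using Ti_less_T0[OF c] b early_end by (simp add: A_def)
  have T: "profile A c (sol A c)" using A c by (intro profile_sol) auto
  have "sol A c 1 \<ge> T0 c"
  proof (rule ccontr)
    assume low: "\<not> sol A c 1 \<ge> T0 c"
    have T0b: "Ti \<le> T0 c" "T0 c \<le> 2 * c" using Ti_less_T0[OF c] T0_root[OF c] by auto
    obtain B where B: "slope_bounded c B" using slope_bounded_exists by blast
    have below: "sol A c w < T0 c" if w: "0 \<le> w" "w \<le> 1" for w
    proof (rule ccontr)
      assume above: "\<not> sol A c w < T0 c"
      have "sol A c 1 - T0 c \<ge> 0"
      proof (rule nonneg_of_deriv_ge[where a = w and b = 1 and D = "\<lambda>w. sol A c w - T0 c" and L = "A * B"])
        show "continuous_on {w..1} (\<lambda>w. sol A c w - T0 c)"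
          by (intro continuous_intros profile_cont_sub[OF T]) (use w in auto)
        show "sol A c w - T0 c \<ge> 0" using above by simp
        fix s assume s: "w < s" "s < 1"
        have "((\<lambda>w. sol A c w - T0 c) has_real_derivative A * slope c s (sol A c s)) (at s)"
          using profileD(3)[OF T, of s] s w by (auto intro!: derivative_eq_intros)
        moreover have "A * B * (sol A c s - T0 c) \<le> A * slope c s (sol A c s)" if "sol A c s < T0 c"
        proof -
          have "slope c s (T0 c) \<ge> 0"
            using slope_clipped[OF T0b] heat_T0[OF c] burnt_bounds[of s] s w \<phi>_pos[OF T0b(1)] q0
            by simp
          moreover have "\<bar>slope c s (sol A c s) - slope c s (T0 c)\<bar> \<le> B * \<bar>sol A c s - T0 c\<bar>"
            using slope_boundedD(3)[OF B c order_refl, of s "sol A c s" "T0 c"] s w by simp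
          ultimately have "B * (sol A c s - T0 c) \<le> slope c s (sol A c s)"
            using that by (simp add: right_diff_distrib)
          from mult_left_mono[OF this, of A] A show ?thesis by (simp add: mult.assoc)
        qed
        ultimately show "\<exists>d. ((\<lambda>w. sol A c w - T0 c) has_real_derivative d) (at s) \<and>
            (sol A c s - T0 c < 0 \<longrightarrow> A * B * (sol A c s - T0 c) \<le> d)" by auto
      qed (use w in auto)
      with low show False by simp
    qed
    have "sol A c 0 - A * (heat_lb / 2 * inv_rate_lb) * 0 \<le> sol A c early_end - A * (heat_lb / 2 * inv_rate_lb) * early_end"
    proof (rule DERIV_nonneg_imp_increasing_open[where f = "\<lambda>w. sol A c w - A * (heat_lb / 2 * inv_rate_lb) * w"])
      show "continuous_on {0..early_end} (\<lambda>w. sol A c w - A * (heat_lb / 2 * inv_rate_lb) * w)"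
        by (intro continuous_intros profile_cont_sub[OF T]) (use early_end in auto)
      fix w assume w: "0 < w" "w < early_end"
      define x where "x = clip c (sol A c w)"
      have x: "Ti \<le> x" "x \<le> T0 c"
        using below[of w] w early_end T0b by (auto simp: x_def clip_def)
      have "heat_lb / 2 \<le> heat c w x" using heat_lower(2)[OF c x, of w] w by simp
      hence "heat_lb / 2 * inv_rate_lb \<le> heat c w x * (1 / \<phi> x)"
        using inv_rate_lb(1) inv_rate_lb(2)[OF x(1)] heat_lb_pos by (intro mult_mono) auto
      hence "A * (heat_lb / 2 * inv_rate_lb) \<le> A * slope c w (sol A c w)"
        using A by (intro mult_left_mono) (auto simp: slope_def x_def)
      thus "\<exists>y. ((\<lambda>w. sol A c w - A * (heat_lb / 2 * inv_rate_lb) * w) has_real_derivative y) (at w) \<and> 0 \<le> y"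
        using profileD(3)[OF T, of w] w early_end
        by (intro exI[of _ "A * slope c w (sol A c w) - A * (heat_lb / 2 * inv_rate_lb)"])
           (auto intro!: derivative_eq_intros)
    qed (use early_end in auto)
    moreover have "A * (heat_lb / 2 * inv_rate_lb) * early_end = T0 c - Ti" using b early_end inv_rate_lb(1) heat_lb_pos by (simp add: A_def)
    ultimately show False using below[of early_end] early_end profileD(2)[OF T] by simp
  qed
  moreover have "sol 0 c 1 = Ti"
  proof -
    have p: "profile 0 c (\<lambda>_. Ti)" by (simp add: profile_def)
    show ?thesis using profile_unique[OF c order_refl p, of 1] by simp
  qed
  moreover have "continuous_on {0..A} (\<lambda>lam. sol lam c 1)"
  proof -
    obtain M where M: "dependence_bounded A c M" using dependence_bounded_exists by blast
    have "M-lipschitz_on {0..A} (\<lambda>lam. sol lam c 1)"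
    proof (rule lipschitz_onI)
      fix x y assume "x \<in> {0..A}" "y \<in> {0..A}"
      thus "dist (sol x c 1) (sol y c 1) \<le> M * dist x y"
        using dependence_boundedD(2)[OF M, of x c c "sol x c" y "sol y c" 1] profile_sol c
        by (simp add: dist_real_def)
    qed (rule dependence_boundedD(1)[OF M])
    thus ?thesis by (rule lipschitz_on_continuous_on)
  qed
  ultimately obtain lam where lam: "0 \<le> lam" "lam \<le> A" "sol lam c 1 = T0 c"
    using IVT'[of "\<lambda>lam. sol lam c 1" 0 "T0 c" A] Ti_less_T0[OF c] A by force
  moreover have "lam \<noteq> 0" using lam(3) \<open>sol 0 c 1 = Ti\<close> Ti_less_T0[OF c] by auto
  ultimately show ?thesis by (intro exI[of _ lam]) auto
qed

definition lam0 :: "real \<Rightarrow> real" where "lam0 c = (SOME lam. lam > 0 \<and> sol lam c 1 = T0 c)"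

lemma lam0: assumes "c \<ge> ccj" shows "lam0 c > 0" "sol (lam0 c) c 1 = T0 c"
  using someI_ex[OF profile_reaches_T0[OF assms]] by (auto simp: lam0_def)

lemma profile_lam0: "c \<ge> ccj \<Longrightarrow> profile (lam0 c) c (sol (lam0 c) c)"
  using lam0 by (intro profile_sol) (auto intro: less_imp_le)

lemma sol_gt_T0:
  assumes "c \<ge> ccj" "lam > lam0 c"
  shows "sol lam c 1 > T0 c"
proof -
  obtain m where m: "m > 0" "\<And>c' lam1 lam2 T1 T2. ccj \<le> c' \<and> c' \<le> c \<and> 0 < lam1 \<and> lam1 < lam2 \<and> lam2 \<le> lam \<and>
     profile lam1 c' T1 \<and> T1 1 = T0 c' \<and> profile lam2 c' T2 \<longrightarrow> m * (lam2 - lam1) \<le> T2 1 - T0 c'"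
    using profile_endpoint_strictly_increasing[of c lam] by blast
  have "profile lam c (sol lam c)" using assms lam0(1)[of c] by (intro profile_sol) auto
  hence "m * (lam - lam0 c) \<le> sol lam c 1 - T0 c"
    using m(2)[of c "lam0 c" lam "sol (lam0 c) c" "sol lam c"] assms lam0 profile_lam0 by auto
  moreover have "m * (lam - lam0 c) > 0" using m(1) assms by simp
  ultimately show ?thesis by simp
qed

lemma lam0_unique:
  assumes c: "c \<ge> ccj" and "lam > 0" and T: "profile lam c T" "T 1 = T0 c"
  shows "lam = lam0 c"
proof (rule linorder_cases[of lam "lam0 c"])
  assume less: "lam < lam0 c"
  obtain m where m: "m > 0" "\<And>c' lam1 lam2 T1 T2. ccj \<le> c' \<and> c' \<le> c \<and> 0 < lam1 \<and> lam1 < lam2 \<and> lam2 \<le> lam0 c \<and>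
     profile lam1 c' T1 \<and> T1 1 = T0 c' \<and> profile lam2 c' T2 \<longrightarrow> m * (lam2 - lam1) \<le> T2 1 - T0 c'"
    using profile_endpoint_strictly_increasing[of c "lam0 c"] by blast
  have "m * (lam0 c - lam) \<le> sol (lam0 c) c 1 - T0 c"
    using m(2)[of c lam "lam0 c" T "sol (lam0 c) c"] assms less profile_lam0 by auto
  hence "m * (lam0 c - lam) \<le> 0" using lam0[OF c] by simp
  moreover have "m * (lam0 c - lam) > 0" using m(1) less by simp
  ultimately show ?thesis by simp
next
  assume "lam > lam0 c"
  thus ?thesis using sol_gt_T0[OF c] profile_unique[OF c _ T(1), of 1] T(2) \<open>lam > 0\<close> by force
qed

section \<open>The turning point\<close>

definition lam_bound :: "real \<Rightarrow> real" where
  "lam_bound c = ln (4 * c^3 / (q0 * Ti)) / (inv_rate_lb * c * early_end / 2)"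

lemma lam0_le_bound:
  assumes "c \<ge> ccj" shows "lam0 c \<le> lam_bound c"
proof -
  have "inv_rate_lb * c * early_end / 2 > 0" using inv_rate_lb(1) early_end assms ccj_pos by simp
  thus ?thesis
    using ln_bound_special[OF profile_lam0[OF assms] lam0(1)[OF assms] assms lam0(2)[OF assms]]
    unfolding lam_bound_def by (subst pos_le_divide_eq) auto
qed

lemma lam_bound_tendsto_0: "(lam_bound \<longlongrightarrow> 0) at_top"
proof -
  define a b where "a = 4 / (q0 * Ti)" and "b = inv_rate_lb * early_end / 2"
  have ab: "a > 0" "b > 0" using q0 Ti0 inv_rate_lb(1) early_end by (auto simp: a_def b_def)
  have "((\<lambda>c. ln a / b * (1 / c) + 3 / b * (ln c / c)) \<longlongrightarrow> ln a / b * 0 + 3 / b * 0) at_top"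
    by (intro tendsto_intros ln_x_over_x_tendsto_0 tendsto_divide_0[OF tendsto_const]
         filterlim_at_top_imp_at_infinity filterlim_ident)
  moreover have "\<forall>\<^sub>F c in at_top. ln a / b * (1 / c) + 3 / b * (ln c / c) = lam_bound c"
    using eventually_gt_at_top[of "0::real"]
  proof eventually_elim
    case (elim c)
    have "ln (4 * c^3 / (q0 * Ti)) = ln (a * c^3)" by (simp add: a_def)
    also have "\<dots> = ln a + 3 * ln c" using ab elim by (simp add: ln_mult ln_realpow)
    finally show ?case using ab elim by (simp add: lam_bound_def b_def field_simps add_divide_distrib)
  qed
  ultimately show ?thesis by (simp add: filterlim_cong[OF refl refl])
qed

lemma continuous_on_lam_bound: "continuous_on {ccj..C} lam_bound"
  unfolding lam_bound_def using inv_rate_lb(1) early_end(1) ccj_pos q0 Ti0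
  by (intro continuous_intros) (auto simp: zero_less_divide_iff)

lemma continuous_on_T0: "continuous_on S T0"
  unfolding T_zero_def by (intro continuous_intros)

text \<open>
  By uniqueness, the graph of \<open>lam0\<close> is the zero set of the continuous function
  \<open>sol lam c 1 - T\<^sub>0(c)\<close> on \<open>lam > 0\<close>. As \<open>lam_bound c \<longlongrightarrow> 0\<close>, only a compact
  part of this graph lies above the level \<open>lam0 c\<^sup>c\<^sup>j\<close>, and the first coordinate attains its maximum
  there.
\<close>

lemma lam0_attains_max: "\<exists>cbar\<ge>ccj. \<forall>c\<ge>ccj. lam0 c \<le> lam0 cbar"
proof -
  define l1 where "l1 = lam0 ccj"
  have l1: "l1 > 0" using lam0 by (simp add: l1_def)
  obtain C0 where C0: "\<And>c. c \<ge> C0 \<Longrightarrow> lam_bound c < l1"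
    using order_tendstoD(2)[OF lam_bound_tendsto_0 l1] by (auto simp: eventually_at_top_linorder)
  define C where "C = max C0 ccj"
  have "bounded (lam_bound ` {ccj..C})"
    by (intro compact_imp_bounded compact_continuous_image continuous_on_lam_bound) auto
  then obtain A where A: "\<forall>c\<in>{ccj..C}. \<bar>lam_bound c\<bar> \<le> A" by (auto simp: bounded_iff)
  define f where "f = (\<lambda>p. sol (fst p) (snd p) 1 - T0 (snd p))"
  define R where "R = {l1..A} \<times> {ccj..C}"
  have contf: "continuous_on R f"
  proof -
    obtain M where M: "dependence_bounded A C M" using dependence_bounded_exists by blast
    have "(2 * M)-lipschitz_on R (\<lambda>p. sol (fst p) (snd p) 1)"
    proof (rule lipschitz_onI)
      fix p q assume pq: "p \<in> R" "q \<in> R"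
      have "profile (fst r) (snd r) (sol (fst r) (snd r))" if "r \<in> R" for r
        using that l1 by (intro profile_sol) (auto simp: R_def)
      from this[OF pq(1)] this[OF pq(2)] pq have "dist (sol (fst p) (snd p) 1) (sol (fst q) (snd q) 1)
          \<le> M * (dist (fst p) (fst q) + dist (snd p) (snd q))"
        using dependence_boundedD(2)[OF M, of "fst p" "snd p" "snd q" "sol (fst p) (snd p)" "fst q"
            "sol (fst q) (snd q)" 1] l1
        by (auto simp: R_def dist_real_def)
      also have "\<dots> \<le> M * (dist p q + dist p q)"
        using dependence_boundedD(1)[OF M] by (intro mult_left_mono add_mono dist_fst_le dist_snd_le)
      finally show "dist (sol (fst p) (snd p) 1) (sol (fst q) (snd q) 1) \<le> 2 * M * dist p q" by simp
    qed (use dependence_boundedD(1)[OF M] in simp)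
    hence "continuous_on R (\<lambda>p. sol (fst p) (snd p) 1)" by (rule lipschitz_on_continuous_on)
    thus ?thesis unfolding f_def
      by (intro continuous_intros continuous_on_compose2[OF continuous_on_T0[of UNIV]]) auto
  qed
  define S where "S = {p \<in> R. f p = 0}"
  have "compact R" unfolding R_def by (intro compact_Times) auto
  moreover have "closed S" unfolding S_def
    by (intro continuous_closed_preimage_constant contf compact_imp_closed[OF \<open>compact R\<close>])
  ultimately have "compact (R \<inter> S)" by (rule compact_Int_closed)
  moreover have "R \<inter> S = S" by (auto simp: S_def)
  ultimately have "compact S" by simp
  have inS: "(lam0 c, c) \<in> S" if "c \<ge> ccj" "lam0 c \<ge> l1" for c
  proof -
    have "\<not> c \<ge> C0" using C0[of c] lam0_le_bound[OF that(1)] that by auto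
    hence "c \<in> {ccj..C}" using that by (auto simp: C_def)
    moreover from this have "lam0 c \<le> A" using A lam0_le_bound[OF that(1)] by force
    ultimately show ?thesis using that lam0(2)[OF that(1)] by (auto simp: S_def R_def f_def)
  qed
  have "S \<noteq> {}" using inS[of ccj] by (auto simp: l1_def)
  then obtain p where p: "p \<in> S" "\<And>q. q \<in> S \<Longrightarrow> fst q \<le> fst p"
    using continuous_attains_sup[OF \<open>compact S\<close> \<open>S \<noteq> {}\<close> continuous_on_fst[OF continuous_on_id]]
    by blast
  obtain l cbar where pl: "p = (l, cbar)" by (cases p)
  have lc: "l1 \<le> l" "ccj \<le> cbar" "sol l cbar 1 = T0 cbar"
    using p(1) by (auto simp: pl S_def R_def f_def)
  have "l = lam0 cbar"
    using lc l1 by (intro lam0_unique[OF lc(2) _ profile_sol]) auto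
  moreover have "lam0 c \<le> l" if "c \<ge> ccj" for c
    using p(2)[OF inS[OF that]] lc by (cases "lam0 c \<ge> l1") (auto simp: pl)
  ultimately show ?thesis using lc by blast
qed

lemma sol_ge_T0: "c \<ge> ccj \<Longrightarrow> lam \<ge> lam0 c \<Longrightarrow> sol lam c 1 \<ge> T0 c"
  using sol_gt_T0[of c lam] lam0(2)[of c] by (cases "lam = lam0 c") auto

text \<open>
  Otherwise, for \<open>lam = lam0 c\<^sup>c\<^sup>j\<close>, the endpoint at speed \<open>c = c\<^sup>c\<^sup>j + e\<close> would be at least \<open>T\<^sub>0(c)\<close>.
  But the endpoint grows at most linearly in \<open>e\<close>, whereas \<open>T\<^sub>0(c) - c\<^sup>c\<^sup>j\<close> exceeds
  \<open>sqrt (c\<^sup>c\<^sup>j * e)\<close>.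
\<close>

lemma lam0_not_max_at_ccj: "\<exists>c>ccj. lam0 c > lam0 ccj"
proof (rule ccontr)
  assume "\<not> (\<exists>c>ccj. lam0 c > lam0 ccj)"
  hence max: "\<And>c. c > ccj \<Longrightarrow> lam0 c \<le> lam0 ccj" by force
  define l where "l = lam0 ccj"
  have l: "l > 0" using lam0 by (simp add: l_def)
  obtain M where M: "dependence_bounded l (ccj + 1) M" using dependence_bounded_exists by blast
  have M0: "M \<ge> 0" by (rule dependence_boundedD(1)[OF M])
  \<comment> \<open>small enough that \<open>M\<^sup>2 * e < c\<^sup>c\<^sup>j\<close>, which contradicts \<open>sqrt (c\<^sup>c\<^sup>j * e) \<le> M * e\<close>\<close>
  define e where "e = min 1 (ccj / (2 * (M\<^sup>2 + 1)))"
  have M2: "M\<^sup>2 + 1 > 0" by (simp add: add_nonneg_pos)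
  have e: "0 < e" "e \<le> 1" "e \<le> ccj / (2 * (M\<^sup>2 + 1))" using ccj_pos M2 by (auto simp: e_def)
  define c where "c = ccj + e"
  have c: "ccj \<le> c" "c \<le> ccj + 1" using e by (auto simp: c_def)
  have T0cj: "sol l ccj 1 = ccj" using lam0(2)[of ccj] ccj_sq by (simp add: l_def T_zero_def)
  have "T0 c \<le> sol l c 1" using max[of c] e by (intro sol_ge_T0 c) (auto simp: l_def c_def)
  also have "\<dots> \<le> ccj + M * e"
    using dependence_boundedD(2)[OF M, of l c ccj "sol l c" l "sol l ccj" 1] l c e T0cj profile_sol
    by (auto simp: c_def)
  finally have "sqrt (c\<^sup>2 - 2 * q0) \<le> M * e" using c by (simp add: T_zero_def)
  hence "c\<^sup>2 - 2 * q0 \<le> (M * e)\<^sup>2" by (rule sqrt_le_D)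
  moreover have "ccj * e \<le> c\<^sup>2 - 2 * q0"
    using ccj_pos e mult_pos_pos[OF ccj_pos e(1)] by (simp add: c_def power2_sum ccj_sq)
  ultimately have "ccj * e \<le> (M\<^sup>2 * e) * e" by (simp add: power2_eq_square mult_ac)
  hence "ccj \<le> M\<^sup>2 * e" using e by simp
  also have "\<dots> \<le> (M\<^sup>2 + 1) * (ccj / (2 * (M\<^sup>2 + 1)))" using e by (intro mult_mono) auto
  also have "\<dots> = ccj / 2"
  proof -
    have "P * (ccj / (2 * P)) = ccj / 2" if "P > 0" for P :: real using that by simp
    thus ?thesis using M2 by blast
  qed
  finally show False using ccj_pos by simp
qed

lemma T0_C2: assumes "a > ccj" shows "C2_on {a..b} T0"
proof -
  have p: "c\<^sup>2 - 2 * q0 > 0" if "c \<in> {a..b}" for c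
  proof -
    have "ccj < c" using that assms by auto
    hence "ccj\<^sup>2 < c\<^sup>2" using ccj_pos by (intro power_strict_mono) auto
    thus ?thesis using ccj_sq by simp
  qed
  define r where "r = (\<lambda>c. sqrt (c\<^sup>2 - 2 * q0))"
  have r: "r c > 0" if "c \<in> {a..b}" for c using p[OF that] by (simp add: r_def)
  have dr: "(r has_real_derivative c / r c) (at c within {a..b})" if "c \<in> {a..b}" for c
    unfolding r_def using p[OF that] by (auto intro!: derivative_eq_intros simp: field_simps)
  have cr: "continuous_on {a..b} r" by (rule DERIV_continuous_on[OF dr])
  have "T0 = (\<lambda>c. c + r c)" by (auto simp: T_zero_def r_def)
  moreover have "C2_on {a..b} (\<lambda>c. c + r c)" unfolding C2_on_def
    by (rule exI[of _ "\<lambda>c. 1 + c / r c"], rule exI[of _ "\<lambda>c. 1 / r c - c / (r c)\<^sup>2 * (c / r c)"])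
       (auto intro!: derivative_eq_intros continuous_intros dr cr
         simp: r[THEN less_imp_neq, THEN not_sym] power2_eq_square diff_divide_distrib
         dest: r[THEN less_imp_neq])
  ultimately show ?thesis by simp
qed

text \<open>
  Let \<open>S\<close> be the second difference of the profiles for the speeds \<open>cbar - e\<close>, \<open>cbar\<close>, \<open>cbar + e\<close> at the
  fixed parameter \<open>lam0 cbar\<close>. The first order terms of its equation are linear in \<open>S\<close>, and
  the rest is of order \<open>e\<^sup>2\<close> because first differences are of order \<open>e\<close>; Gronwall's inequality gives
  \<open>S = O(e\<^sup>2)\<close>. Maximality at \<open>cbar\<close> guarantees that all three profiles end at or above equilibrium, so
  the smooth unclipped equation applies.
\<close>

lemma excess_second_difference:
  assumes cbar: "cbar > ccj" and max: "\<And>c. c \<ge> ccj \<Longrightarrow> lam0 c \<le> lam0 cbar"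
  shows "\<exists>Q e0. e0 > 0 \<and> cbar - e0 > ccj \<and> (\<forall>e. 0 \<le> e \<and> e \<le> e0 \<longrightarrow>
     (sol (lam0 cbar) (cbar + e) 1 - T0 (cbar + e)) + (sol (lam0 cbar) (cbar - e) 1 - T0 (cbar - e))
       \<le> Q * e\<^sup>2)"
proof -
  define l where "l = lam0 cbar"
  have l: "l > 0" using lam0(1)[of cbar] cbar by (simp add: l_def)
  define e0 where "e0 = (cbar - ccj) / 2"
  have e0: "e0 > 0" "cbar - e0 > ccj" using cbar by (auto simp: e0_def field_simps)
  define C where "C = cbar + e0"
  have C: "C > 0" "cbar \<le> C" using cbar ccj_pos e0 by (auto simp: C_def)
  obtain N1 where N1: "N1 \<ge> 0" "C2_bounded N1 {cbar - e0..cbar + e0} T0"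
    using C2_on_imp_C2_bounded[OF T0_C2[OF e0(2), of "cbar + e0"]] by blast
  obtain N where N: "N \<ge> 0" and h0: "C2_bounded N {Ti..2 * C} (\<lambda>T. 1 / \<phi> T)"
    and h1: "C2_bounded N {Ti..2 * C} (\<lambda>T. T / \<phi> T)"
    and h2: "C2_bounded N {Ti..2 * C} (\<lambda>T. T\<^sup>2 / \<phi> T)"
    using rate_weights_C2_bounded by blast
  obtain M where M: "dependence_bounded l C M" using dependence_bounded_exists by blast
  have M0: "M \<ge> 0" by (rule dependence_boundedD(1)[OF M])
  define L where "L = l * ((C + 1 / 2 + q0) * N)"
  define J where "J = l * ((C + 1 / 2 + q0) * N * (2 * M\<^sup>2) + 2 * N * M)"
  have LJ: "L \<ge> 0" "J \<ge> 0" using l C N M0 q0 by (auto simp: L_def J_def)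
  have "(sol l (cbar + e) 1 - T0 (cbar + e)) + (sol l (cbar - e) 1 - T0 (cbar - e))
       \<le> (J * exp (L + 1) + N1 * 2) * e\<^sup>2" if e: "0 \<le> e" "e \<le> e0" for e
  proof -
    have range: "ccj \<le> c \<and> c \<le> C \<and> strong_profile l c (sol l c)"
      if "c \<in> {cbar - e0..cbar + e0}" for c
    proof -
      have c: "ccj \<le> c" "c \<le> C" using that e0 by (auto simp: C_def)
      show ?thesis using c max[of c] l sol_ge_T0[of c l] profile_sol[of c l]
        by (simp add: strong_profile_def l_def)
    qed
    define x where "x = sol l cbar" define y where "y = sol l (cbar + e)"
    define z where "z = sol l (cbar - e)"
    have X: "strong_profile l cbar x" and Y: "strong_profile l (cbar + e) y"
      and Z: "strong_profile l (cbar - e) z"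
      unfolding x_def y_def z_def using e e0 range by auto
    have cs: "ccj \<le> cbar + e" "cbar + e \<le> C" "ccj \<le> cbar - e" "cbar - e \<le> C" "cbar - e \<le> cbar"
      using e e0 cbar by (auto simp: C_def)
    define S where "S = (\<lambda>w. y w + z w - 2 * x w)"
    have "\<bar>S 1\<bar> \<le> (J * e\<^sup>2) * exp (L + 1)"
    proof (rule gronwall_abs[where D = S and L = L and w = 1])
      show "continuous_on {0..1} S" unfolding S_def
        by (intro continuous_intros strong_profileD(5)[OF X] strong_profileD(5)[OF Y]
            strong_profileD(5)[OF Z])
      show "S 0 = 0" using strong_profileD(6)[OF X] strong_profileD(6)[OF Y] strong_profileD(6)[OF Z]
        by (simp add: S_def)
      fix w :: real assume w: "0 < w" "w < 1"
      hence w': "0 \<le> w" "w \<le> 1" by auto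
      have I: "x w \<in> {Ti..2 * C}" "y w \<in> {Ti..2 * C}" "z w \<in> {Ti..2 * C}"
        using strong_profileD(7,8)[OF X w'] strong_profileD(7,8)[OF Y w']
          strong_profileD(7,8)[OF Z w'] cs C by auto
      have dy: "\<bar>y w - x w\<bar> \<le> M * e" and dz: "\<bar>z w - x w\<bar> \<le> M * e"
        using dependence_boundedD(2)[OF M, of l "cbar + e" cbar y l x w]
          dependence_boundedD(2)[OF M, of l "cbar - e" cbar z l x w]
          strong_profileD(1)[OF X] strong_profileD(1)[OF Y] strong_profileD(1)[OF Z]
          l cs w' C cbar e by auto
      have sq: "(y w - x w)\<^sup>2 \<le> M\<^sup>2 * e\<^sup>2" "(z w - x w)\<^sup>2 \<le> M\<^sup>2 * e\<^sup>2"
        using power_mono[OF dy, of 2] power_mono[OF dz, of 2] by (simp_all add: power_mult_distrib)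
      define r where "r = N * (\<bar>S w\<bar> + 2 * M\<^sup>2 * e\<^sup>2)"
      have r_up: "N * (\<bar>y w + z w - 2 * x w\<bar> + (y w - x w)\<^sup>2 + (z w - x w)\<^sup>2) \<le> r"
        unfolding r_def S_def using sq by (intro mult_left_mono N) auto
      define h0' where "h0' = (\<lambda>T. 1 / \<phi> T)"
      define h1' where "h1' = (\<lambda>T. T / \<phi> T)"
      define h2' where "h2' = (\<lambda>T. T\<^sup>2 / \<phi> T)"
      define D0 where "D0 = h0' (y w) + h0' (z w) - 2 * h0' (x w)"
      define D1 where "D1 = h1' (y w) + h1' (z w) - 2 * h1' (x w)"
      define D2 where "D2 = h2' (y w) + h2' (z w) - 2 * h2' (x w)"
      have D: "\<bar>D0\<bar> \<le> r" "\<bar>D1\<bar> \<le> r" "\<bar>D2\<bar> \<le> r"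
        using C2_boundedD(3)[OF h0 I] C2_boundedD(3)[OF h1 I] C2_boundedD(3)[OF h2 I] r_up
        unfolding D0_def D1_def D2_def h0'_def h1'_def h2'_def by linarith+
      have d: "\<bar>e * (h1' (y w) - h1' (z w))\<bar> \<le> e * (N * (2 * M * e))"
      proof -
        have "\<bar>h1' (y w) - h1' (z w)\<bar> \<le> N * \<bar>y w - z w\<bar>"
          unfolding h1'_def by (rule C2_boundedD(2)[OF h1 I(2,3)])
        also have "\<dots> \<le> N * (2 * M * e)" using dy dz by (intro mult_left_mono N) linarith
        finally show ?thesis using e by (simp add: abs_mult mult_left_mono)
      qed
      define b where "b = burnt w"
      have b: "0 \<le> b" "b \<le> 1" using burnt_bounds[OF w'] by (auto simp: b_def)
      define G where "G = (\<lambda>c T. c * h1' T - h2' T / 2 - q0 * b * h0' T)"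
      have G: "heat c w T / \<phi> T = G c T" for c T
        by (simp add: heat_def G_def h0'_def h1'_def h2'_def b_def diff_divide_distrib)
      have "(S has_real_derivative l * G (cbar + e) (y w) + l * G (cbar - e) (z w)
          - 2 * (l * G cbar (x w))) (at w)"
        unfolding S_def using strong_profileD(9)[OF X w] strong_profileD(9)[OF Y w]
          strong_profileD(9)[OF Z w] unfolding G
        by (auto intro!: derivative_eq_intros)
      moreover have "l * G (cbar + e) (y w) + l * G (cbar - e) (z w) - 2 * (l * G cbar (x w))
          = l * (cbar * D1 + e * (h1' (y w) - h1' (z w)) - D2 / 2 - q0 * b * D0)"
        by (simp add: G_def D0_def D1_def D2_def field_simps)
      moreover have "\<bar>l * (cbar * D1 + e * (h1' (y w) - h1' (z w)) - D2 / 2 - q0 * b * D0)\<bar>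
          \<le> L * \<bar>S w\<bar> + J * e\<^sup>2"
      proof -
        have r0: "r \<ge> 0" using D(1) by linarith
        have 1: "\<bar>cbar * D1\<bar> \<le> C * r" unfolding abs_mult
          using D C cbar ccj_pos by (intro mult_mono) auto
        have 2: "\<bar>q0 * b * D0\<bar> \<le> (q0 * 1) * r" unfolding abs_mult
          using D b q0 by (intro mult_mono) auto
        have tri: "\<bar>p + q - s / 2 - t\<bar> \<le> p' + q' + s' / 2 + t'"
          if "\<bar>p\<bar> \<le> p'" "\<bar>q\<bar> \<le> q'" "\<bar>s\<bar> \<le> s'" "\<bar>t\<bar> \<le> t'" for p q s t p' q' s' t' :: real
          using that by linarith
        have "\<bar>cbar * D1 + e * (h1' (y w) - h1' (z w)) - D2 / 2 - q0 * b * D0\<bar>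
            \<le> C * r + e * (N * (2 * M * e)) + r / 2 + (q0 * 1) * r"
          by (rule tri[OF 1 d D(3) 2])
        hence "l * \<bar>cbar * D1 + e * (h1' (y w) - h1' (z w)) - D2 / 2 - q0 * b * D0\<bar>
            \<le> l * (C * r + e * (N * (2 * M * e)) + r / 2 + (q0 * 1) * r)"
          using l by (intro mult_left_mono) auto
        also have "\<dots> = L * \<bar>S w\<bar> + J * e\<^sup>2"
          by (simp add: L_def J_def r_def algebra_simps power2_eq_square)
        finally show ?thesis using l by (simp add: abs_mult)
      qed
      ultimately show "\<exists>d. (S has_real_derivative d) (at w) \<and> \<bar>d\<bar> \<le> L * \<bar>S w\<bar> + J * e\<^sup>2"
        by auto
    qed (use LJ in auto)
    moreover have "\<bar>T0 (cbar + e) + T0 (cbar - e) - 2 * T0 cbar\<bar>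
        \<le> N1 * (\<bar>(cbar + e) + (cbar - e) - 2 * cbar\<bar> + ((cbar + e) - cbar)\<^sup>2 + ((cbar - e) - cbar)\<^sup>2)"
      using e e0 by (intro C2_boundedD(3)[OF N1(2)]) auto
    hence "\<bar>T0 (cbar + e) + T0 (cbar - e) - 2 * T0 cbar\<bar> \<le> N1 * (2 * e\<^sup>2)" by simp
    moreover have "x 1 = T0 cbar" using lam0(2)[of cbar] cbar by (simp add: x_def l_def)
    ultimately have "(y 1 - T0 (cbar + e)) + (z 1 - T0 (cbar - e)) \<le> (J * e\<^sup>2) * exp (L + 1) + N1 * (2 * e\<^sup>2)"
      unfolding S_def by linarith
    thus ?thesis by (simp add: y_def z_def algebra_simps)
  qed
  thus ?thesis unfolding l_def using e0 by blast
qed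

text \<open>
  The excess of the endpoint over \<open>T\<^sub>0(c)\<close> at the parameter \<open>lam0 cbar\<close> is nonnegative for every speed,
  so its values at \<open>cbar + e\<close> and at \<open>cbar - e\<close> are each bounded by their sum. The excess in turn controls
  \<open>lam0 cbar - lam0 c\<close>.
\<close>

lemma lam0_quadratic_near_max:
  assumes cbar: "cbar > ccj" and max: "\<And>c. c \<ge> ccj \<Longrightarrow> lam0 c \<le> lam0 cbar"
  shows "\<exists>Q\<ge>0. \<exists>e0>0. \<forall>c. \<bar>c - cbar\<bar> < e0 \<longrightarrow> c > ccj \<and> lam0 cbar - lam0 c \<le> Q * (c - cbar)\<^sup>2"
proof -
  define l where "l = lam0 cbar"
  obtain Q e0 where e0: "e0 > 0" "cbar - e0 > ccj"
    and Q: "\<And>e. 0 \<le> e \<Longrightarrow> e \<le> e0 \<Longrightarrow>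
      (sol l (cbar + e) 1 - T0 (cbar + e)) + (sol l (cbar - e) 1 - T0 (cbar - e)) \<le> Q * e\<^sup>2"
    using excess_second_difference[OF assms] unfolding l_def by blast
  obtain m where m: "m > 0" "\<And>c lam1 lam2 T1 T2. ccj \<le> c \<and> c \<le> cbar + e0 \<and> 0 < lam1 \<and> lam1 < lam2 \<and> lam2 \<le> l \<and>
     profile lam1 c T1 \<and> T1 1 = T0 c \<and> profile lam2 c T2 \<longrightarrow> m * (lam2 - lam1) \<le> T2 1 - T0 c"
    using profile_endpoint_strictly_increasing[of "cbar + e0" l] by blast
  have "c > ccj \<and> l - lam0 c \<le> \<bar>Q\<bar> / m * (c - cbar)\<^sup>2" if c: "\<bar>c - cbar\<bar> < e0" for c
  proof -
    have cc: "ccj < c" "c \<le> cbar + e0" using c e0 by auto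
    define e where "e = \<bar>c - cbar\<bar>"
    have e: "0 \<le> e" "e \<le> e0" using c by (auto simp: e_def)
    have nonneg: "sol l c' 1 - T0 c' \<ge> 0" if "c' \<ge> ccj" for c'
      using sol_ge_T0[OF that] max[OF that] by (simp add: l_def)
    have "sol l c 1 - T0 c \<le> Q * e\<^sup>2"
      using Q[OF e] nonneg[of "cbar + e"] nonneg[of "cbar - e"] e e0
      by (cases "c \<ge> cbar") (auto simp: e_def)
    also have "\<dots> \<le> \<bar>Q\<bar> * (c - cbar)\<^sup>2" by (simp add: e_def mult_right_mono)
    finally have ex: "sol l c 1 - T0 c \<le> \<bar>Q\<bar> * (c - cbar)\<^sup>2" .
    have "m * (l - lam0 c) \<le> \<bar>Q\<bar> * (c - cbar)\<^sup>2"
    proof (cases "lam0 c < l")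
      case True
      have "l > 0" using lam0(1)[of c] True cc by simp
      hence "m * (l - lam0 c) \<le> sol l c 1 - T0 c"
        using m(2)[of c "lam0 c" l "sol (lam0 c) c" "sol l c"] True cc lam0 profile_lam0 profile_sol
        by auto
      thus ?thesis using ex by simp
    next
      case False
      hence "m * (l - lam0 c) \<le> 0" using m(1) by (simp add: mult_nonneg_nonpos)
      also have "0 \<le> \<bar>Q\<bar> * (c - cbar)\<^sup>2" by simp
      finally show ?thesis .
    qed
    thus ?thesis using cc m(1) by (simp add: field_simps)
  qed
  thus ?thesis using m(1) e0(1) unfolding l_def
    by (intro exI[of _ "\<bar>Q\<bar> / m"] exI[of _ e0] conjI) auto
qed

lemma inverse_lam0_derivative_zero:
  assumes cbar: "cbar > ccj" and max: "\<And>c. c \<ge> ccj \<Longrightarrow> lam0 c \<le> lam0 cbar"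
  shows "((\<lambda>c. 1 / (k * lam0 c)) has_real_derivative 0) (at cbar)"
proof -
  define l where "l = lam0 cbar"
  have l: "l > 0" using lam0(1)[of cbar] cbar by (simp add: l_def)
  obtain Q e0 where Q: "Q \<ge> 0" and e0: "e0 > 0"
    and near: "\<And>c. \<bar>c - cbar\<bar> < e0 \<Longrightarrow> c > ccj \<and> l - lam0 c \<le> Q * (c - cbar)\<^sup>2"
    using lam0_quadratic_near_max[OF assms] unfolding l_def by blast
  \<comment> \<open>close enough to \<open>cbar\<close> that \<open>lam0 c \<ge> l / 2\<close>\<close>
  define e where "e = min e0 (min 1 (l / (2 * (Q + 1))))"
  show ?thesis
  proof (rule has_real_derivative_zero_of_quadratic_bound)
    show "e > 0" using e0 l Q by (simp add: e_def)
    fix c assume c: "\<bar>c - cbar\<bar> < e"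
    hence c': "\<bar>c - cbar\<bar> < e0" "\<bar>c - cbar\<bar> < 1" "\<bar>c - cbar\<bar> < l / (2 * (Q + 1))"
      by (auto simp: e_def)
    note n = near[OF c'(1)]
    have "Q * (c - cbar)\<^sup>2 \<le> l / 2"
    proof -
      have "(c - cbar)\<^sup>2 = \<bar>c - cbar\<bar> * \<bar>c - cbar\<bar>" by (simp add: power2_eq_square)
      also have "\<dots> \<le> \<bar>c - cbar\<bar> * 1" using c'(2) by (intro mult_left_mono) auto
      also have "\<dots> \<le> l / (2 * (Q + 1))" using c'(3) by simp
      finally have "Q * (c - cbar)\<^sup>2 \<le> (Q + 1) * (l / (2 * (Q + 1)))" using Q by (intro mult_mono) auto
      also have "\<dots> = l / 2" using Q by (simp add: field_simps)
      finally show ?thesis .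
    qed
    hence half: "lam0 c \<ge> l / 2" using n by linarith
    have le: "lam0 c \<le> l" using max[of c] n by (simp add: l_def)
    have pos: "lam0 c > 0" using half l by linarith
    have "\<bar>1 / (k * lam0 c) - 1 / (k * l)\<bar> = (l - lam0 c) / (k * l * lam0 c)"
      using pos l k_pos le by (simp add: field_simps abs_of_nonneg)
    also have "\<dots> \<le> (Q * (c - cbar)\<^sup>2) / (k * l * (l / 2))"
      using n half l k_pos Q by (intro frac_le mult_left_mono) auto
    also have "\<dots> = (2 * Q / (k * l * l)) * (c - cbar)\<^sup>2" by simp
    finally show "\<bar>1 / (k * lam0 c) - 1 / (k * lam0 cbar)\<bar> \<le> (2 * Q / (k * l * l)) * (c - cbar)\<^sup>2"
      by (simp add: l_def)
  qed
qed

lemma turning_point_exists: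
  "\<exists>cbar>ccj. (\<forall>c\<ge>ccj. lam0 c \<le> lam0 cbar) \<and>
     ((\<lambda>c. 1 / (k * lam0 c)) has_real_derivative 0) (at cbar)"
proof -
  obtain cbar where cbar: "cbar \<ge> ccj" "\<And>c. c \<ge> ccj \<Longrightarrow> lam0 c \<le> lam0 cbar"
    using lam0_attains_max by blast
  obtain c where "c > ccj" "lam0 c > lam0 ccj" using lam0_not_max_at_ccj by blast
  hence "cbar \<noteq> ccj" using cbar(2)[of c] by auto
  hence "cbar > ccj" using cbar(1) by simp
  thus ?thesis using cbar(2) inverse_lam0_derivative_zero by blast
qed

section \<open>From special waves to profiles\<close>

lemma \<gamma>_mult: "\<gamma> * (1 - \<alpha>) = 1" "\<gamma> * k = K" "\<gamma> * \<alpha> = \<gamma> - 1"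
  using \<alpha>1 by (simp_all add: \<gamma>_def k_def field_simps)

text \<open>
  Along the reaction zone \<open>U = 1 - Z powr (1 - \<alpha>)\<close> has derivative \<open>- k * \<phi> T\<close>, so it is a strictly
  decreasing coordinate; expressing \<open>T\<close> in it turns the wave equations into the profile equation. The
  bound \<open>T \<le> 2 * c\<close>, needed to undo the clipping, holds since \<open>heat\<close> is negative beyond \<open>2 * c\<close>.
\<close>

lemma profile_of_special_wave:
  assumes W: "reactive_wave q0 K \<alpha> Ti \<phi> \<beta> c l T Z" and behind: "\<forall>\<xi>\<le>- l. T \<xi> = T0 c"
  shows "\<exists>P. profile (1 / (\<beta> * k)) c P \<and> P 1 = T0 c"
proof -
  note Wd = W[unfolded reactive_wave_def]
  have \<beta>: "\<beta> > 0" and c: "c \<ge> ccj" and l: "l > 0" and contZ: "continuous_on UNIV Z"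
    and T_0: "T 0 = Ti" and T_neg: "\<And>\<xi>. \<xi> < 0 \<Longrightarrow> T \<xi> > Ti" and Z0: "Z 0 = 1" and Zl: "Z (- l) = 0"
    using Wd by auto
  have zone: "Z \<xi> > 0" "\<beta> * deriv T \<xi> = - c * T \<xi> + (T \<xi>)\<^sup>2 / 2 + q0 * (1 - Z \<xi>)"
    "(Z has_real_derivative K * \<phi> (T \<xi>) * Z \<xi> powr \<alpha>) (at \<xi>)" if "- l < \<xi>" "\<xi> < 0" for \<xi>
    using Wd that by auto
  obtain D where D: "\<And>\<xi>. (T has_vector_derivative D \<xi>) (at \<xi>)"
    using Wd unfolding C1_differentiable_on_def by auto
  hence dT: "(T has_real_derivative deriv T \<xi>) (at \<xi>)" for \<xi>
    by (metis DERIV_imp_deriv has_real_derivative_iff_has_vector_derivative)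
  hence contT: "continuous_on S T" for S
    by (meson DERIV_isCont continuous_at_imp_continuous_on)
  have Tge: "T \<xi> \<ge> Ti" if "\<xi> \<le> 0" for \<xi> using T_neg[of \<xi>] T_0 that by (cases "\<xi> = 0") auto
  have Znn: "Z \<xi> \<ge> 0" if "- l \<le> \<xi>" "\<xi> \<le> 0" for \<xi>
    using zone(1)[of \<xi>] Z0 Zl that by (cases "\<xi> = 0"; cases "\<xi> = - l") auto
  define U where "U = (\<lambda>\<xi>. 1 - Z \<xi> powr (1 - \<alpha>))"
  have contU: "continuous_on {- l..0} U" unfolding U_def
    by (intro continuous_intros continuous_on_powr' continuous_on_subset[OF contZ])
       (use Znn \<alpha>1 in auto)
  have dU: "(U has_real_derivative - (k * \<phi> (T \<xi>))) (at \<xi>)" if \<xi>: "- l < \<xi>" "\<xi> < 0" for \<xi>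
  proof -
    have "(U has_real_derivative - ((1 - \<alpha>) * Z \<xi> powr (1 - \<alpha> - 1) * (K * \<phi> (T \<xi>) * Z \<xi> powr \<alpha>))) (at \<xi>)"
      unfolding U_def
      by (rule DERIV_cong[OF DERIV_diff[OF DERIV_const
            DERIV_chain2[OF has_real_derivative_powr[OF zone(1)[OF \<xi>]] zone(3)[OF \<xi>]]]]) simp
    moreover have "Z \<xi> powr (1 - \<alpha> - 1) * Z \<xi> powr \<alpha> = 1"
      using zone(1)[OF \<xi>] by (simp flip: powr_add)
    ultimately show ?thesis by (simp add: k_def mult_ac)
  qed
  have U0: "U 0 = 0" "U (- l) = 1" using Z0 Zl by (auto simp: U_def)
  have burntU: "burnt (U \<xi>) = 1 - Z \<xi>" if "- l \<le> \<xi>" "\<xi> \<le> 0" for \<xi>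
    using Znn[OF that] \<gamma>_mult(1) by (simp add: burnt_def U_def powr_powr mult.commute)
  have "k * \<phi> (T \<xi>) > 0" if "\<xi> < 0" for \<xi> using Tge[of \<xi>] \<phi>_pos k_pos that by simp
  hence "\<exists>X. continuous_on {U 0..U (- l)} X \<and> X (U (- l)) = - l \<and> X (U 0) = 0 \<and> U 0 < U (- l) \<and>
     (\<forall>w\<in>{U 0..U (- l)}. X w \<in> {- l..0} \<and> U (X w) = w) \<and>
     (\<forall>w\<in>{U 0<..<U (- l)}. X w \<in> {- l<..<0} \<and>
        (X has_real_derivative 1 / (- (k * \<phi> (T (X w))))) (at w))"
    by (intro decreasing_inverse[where f' = "\<lambda>\<xi>. - (k * \<phi> (T \<xi>))"] contU dU) (use l in auto)
  then obtain X where contX: "continuous_on {0..1} X" and X01: "X 1 = - l" "X 0 = 0"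
    and X: "\<And>w. 0 \<le> w \<Longrightarrow> w \<le> 1 \<Longrightarrow> X w \<in> {- l..0} \<and> U (X w) = w"
    and dX: "\<And>w. 0 < w \<Longrightarrow> w < 1 \<Longrightarrow> X w \<in> {- l<..<0} \<and>
        (X has_real_derivative 1 / (- (k * \<phi> (T (X w))))) (at w)"
    unfolding U0 by auto
  define P where "P = (\<lambda>w. T (X w))"
  have Pge: "P w \<ge> Ti" if "0 \<le> w" "w \<le> 1" for w using X[OF that] Tge by (simp add: P_def)
  have contP: "continuous_on {0..1} P" unfolding P_def
    by (rule continuous_on_compose2[OF contT[of UNIV] contX]) auto
  have dP: "(P has_real_derivative 1 / (\<beta> * k) * (heat c w (P w) / \<phi> (P w))) (at w)"
    if w: "0 < w" "w < 1" for w
  proof -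
    have Xw: "- l < X w" "X w < 0" "U (X w) = w" using dX[OF w] X[of w] w by auto
    have "\<beta> * deriv T (X w) = - heat c w (P w)"
    proof -
      have bZ: "burnt w = 1 - Z (X w)" using burntU[of "X w"] Xw by simp
      show ?thesis using zone(2)[OF Xw(1,2)] unfolding heat_def P_def bZ by (simp add: algebra_simps)
    qed
    hence dTX: "deriv T (X w) = - heat c w (P w) / \<beta>" using \<beta> by (simp add: field_simps)
    have "(P has_real_derivative deriv T (X w) * (1 / (- (k * \<phi> (T (X w)))))) (at w)"
      unfolding P_def by (rule DERIV_chain2[OF dT]) (use dX[OF w] in auto)
    thus ?thesis unfolding dTX P_def[symmetric] by (simp add: P_def mult_ac)
  qed
  have Ple: "P w \<le> 2 * c" if w: "0 \<le> w" "w \<le> 1" for w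
  proof -
    have "2 * c - P w \<ge> 0"
    proof (rule nonneg_of_deriv_ge[where a = 0 and b = w and D = "\<lambda>w. 2 * c - P w" and L = 0])
      show "continuous_on {0..w} (\<lambda>w. 2 * c - P w)"
        by (intro continuous_intros continuous_on_subset[OF contP]) (use w in auto)
      show "2 * c - P 0 \<ge> 0" using X01 T_0 c ccj_pos Ti_less_ccj by (simp add: P_def)
      fix s assume s: "0 < s" "s < w"
      have "heat c s (P s) \<le> 0" if "P s > 2 * c"
      proof -
        have "heat c s (P s) = P s * (2 * c - P s) / 2 - q0 * burnt s"
          by (simp add: heat_def field_simps power2_eq_square)
        moreover have "P s * (2 * c - P s) \<le> 0" using that c ccj_pos by (intro mult_nonneg_nonpos) auto
        moreover have "q0 * burnt s \<ge> 0" using burnt_bounds[of s] s w q0 by simp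
        ultimately show ?thesis by simp
      qed
      hence "1 / (\<beta> * k) * (heat c s (P s) / \<phi> (P s)) \<le> 0" if "P s > 2 * c"
        using that \<beta> k_pos \<phi>_pos[OF Pge[of s]] s w
        by (intro mult_nonneg_nonpos divide_nonpos_pos) auto
      thus "\<exists>d. ((\<lambda>w. 2 * c - P w) has_real_derivative d) (at s) \<and> (2 * c - P s < 0 \<longrightarrow> 0 * (2 * c - P s) \<le> d)"
        using dP[of s] s w
        by (intro exI[of _ "- (1 / (\<beta> * k) * (heat c s (P s) / \<phi> (P s)))"])
           (auto intro!: derivative_eq_intros)
    qed (use w in auto)
    thus ?thesis by simp
  qed
  have "profile (1 / (\<beta> * k)) c P" unfolding profile_def
    using contP dP X01 T_0 slope_clipped[OF Pge Ple] by (simp add: P_def)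
  moreover have "P 1 = T0 c" using X01 behind by (simp add: P_def)
  ultimately show ?thesis by blast
qed

end

section \<open>From profiles to waves\<close>

text \<open>
  The converse construction. For \<open>c = c\<^sup>c\<^sup>j\<close> the equilibrium \<open>T\<^sub>0(c)\<close> is degenerate and an overshoot decays
  only algebraically, so this case is restricted to profiles that end exactly at \<open>T\<^sub>0(c)\<close>.
\<close>

locale wave_profile = combustion +
  fixes lam c :: real and P :: "real \<Rightarrow> real"
  assumes strong: "strong_profile lam c P" and endpoint: "P 1 = T0 c \<or> c > ccj"
begin

lemmas PD = strong_profileD[OF strong]

definition \<beta> :: real where "\<beta> = 1 / (lam * k)"

lemma \<beta>_pos: "\<beta> > 0" using PD(2) k_pos by (simp add: \<beta>_def)

lemma c_pos: "c > 0" using PD(3) ccj_pos by simp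

lemma \<phi>P_pos: "0 \<le> w \<Longrightarrow> w \<le> 1 \<Longrightarrow> k * \<phi> (P w) > 0"
  using PD(7) \<phi>_pos k_pos by simp

text \<open>
  The position \<open>\<xi>\<close> at which the reaction coordinate has the value \<open>w\<close>; \<open>progress\<close> below is its inverse.
\<close>

definition position :: "real \<Rightarrow> real" where "position w = - integral {0..w} (\<lambda>s. 1 / (k * \<phi> (P s)))"

lemma continuous_on_integrand: "continuous_on {0..1} (\<lambda>s. 1 / (k * \<phi> (P s)))"
  by (intro continuous_intros continuous_on_\<phi>_comp[where R = "2 * c"] PD(5))
     (use PD(7,8) \<phi>P_pos in \<open>force simp: less_le\<close>)+

lemma position_within: "w \<in> {0..1} \<Longrightarrow> (position has_real_derivative - (1 / (k * \<phi> (P w)))) (at w within {0..1})"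
  unfolding position_def by (auto intro!: derivative_eq_intros integral_has_real_derivative continuous_on_integrand)

lemma position_deriv:
  assumes "0 < w" "w < 1" shows "(position has_real_derivative - (1 / (k * \<phi> (P w)))) (at w)"
proof -
  have "at w within {0..1} = at w" using assms by (intro at_within_interior) auto
  thus ?thesis using position_within[of w] assms by simp
qed

lemma position_0: "position 0 = 0" by (simp add: position_def)

definition l :: real where "l = - position 1"

definition progress :: "real \<Rightarrow> real" where
  "progress = (SOME progress. continuous_on {- l..0} progress \<and> progress 0 = 0 \<and> progress (- l) = 1 \<and> - l < 0 \<and>
     (\<forall>\<xi>\<in>{- l..0}. progress \<xi> \<in> {0..1} \<and> position (progress \<xi>) = \<xi>) \<and>
     (\<forall>\<xi>\<in>{- l<..<0}. progress \<xi> \<in> {0<..<1} \<and> (progress has_real_derivative - (k * \<phi> (P (progress \<xi>)))) (at \<xi>)))"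

lemma progress: "continuous_on {- l..0} progress" "progress 0 = 0" "progress (- l) = 1" "l > 0"
  and progress_range: "- l \<le> \<xi> \<Longrightarrow> \<xi> \<le> 0 \<Longrightarrow> 0 \<le> progress \<xi> \<and> progress \<xi> \<le> 1 \<and> position (progress \<xi>) = \<xi>"
  and progress_deriv: "- l < \<xi> \<Longrightarrow> \<xi> < 0 \<Longrightarrow> 0 < progress \<xi> \<and> progress \<xi> < 1 \<and>
     (progress has_real_derivative - (k * \<phi> (P (progress \<xi>)))) (at \<xi>)"
proof -
  have "\<exists>progress. continuous_on {position 1..position 0} progress \<and> progress (position 0) = 0 \<and> progress (position 1) = 1 \<and> position 1 < position 0 \<and>
     (\<forall>\<xi>\<in>{position 1..position 0}. progress \<xi> \<in> {0..1} \<and> position (progress \<xi>) = \<xi>) \<and>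
     (\<forall>\<xi>\<in>{position 1<..<position 0}. progress \<xi> \<in> {0<..<1} \<and>
        (progress has_real_derivative 1 / (- (1 / (k * \<phi> (P (progress \<xi>)))))) (at \<xi>))"
    by (intro decreasing_inverse[where f' = "\<lambda>w. - (1 / (k * \<phi> (P w)))"] position_deriv
         DERIV_continuous_on[OF position_within]) (use \<phi>P_pos in auto)
  hence "\<exists>progress. continuous_on {- l..0} progress \<and> progress 0 = 0 \<and> progress (- l) = 1 \<and> - l < 0 \<and>
     (\<forall>\<xi>\<in>{- l..0}. progress \<xi> \<in> {0..1} \<and> position (progress \<xi>) = \<xi>) \<and>
     (\<forall>\<xi>\<in>{- l<..<0}. progress \<xi> \<in> {0<..<1} \<and> (progress has_real_derivative - (k * \<phi> (P (progress \<xi>)))) (at \<xi>))"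
    by (simp add: position_0 l_def)
  from someI_ex[OF this] show "continuous_on {- l..0} progress" "progress 0 = 0" "progress (- l) = 1" "l > 0"
    and "- l \<le> \<xi> \<Longrightarrow> \<xi> \<le> 0 \<Longrightarrow> 0 \<le> progress \<xi> \<and> progress \<xi> \<le> 1 \<and> position (progress \<xi>) = \<xi>"
    and "- l < \<xi> \<Longrightarrow> \<xi> < 0 \<Longrightarrow> 0 < progress \<xi> \<and> progress \<xi> < 1 \<and>
     (progress has_real_derivative - (k * \<phi> (P (progress \<xi>)))) (at \<xi>)"
    unfolding progress_def[symmetric] by auto
qed

text \<open>
  The explicit solution of the logistic equation ahead of the reaction zone.
\<close>

definition front :: "real \<Rightarrow> real" where
  "front \<xi> = 2 * c / (1 + (2 * c / Ti - 1) * exp (c / \<beta> * \<xi>))"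

text \<open>
  The explicit solution behind the reaction zone: \<open>gap = T\<^sub>0(c) - T\<^sub>1(c)\<close>, and
  \<open>decay = (T - T\<^sub>0(c)) / (T - T\<^sub>1(c))\<close> is an exponential function of \<open>\<xi>\<close>. If the profile ends at \<open>T\<^sub>0(c)\<close>,
  then \<open>ratio = 0\<close>, also in the degenerate case \<open>gap = 0\<close> where it is \<open>0 / 0\<close>, and the tail is
  constant.
\<close>

definition gap :: real where "gap = 2 * (T0 c - c)"
definition ratio :: real where "ratio = (P 1 - T0 c) / (P 1 - (2 * c - T0 c))"
definition decay :: "real \<Rightarrow> real" where "decay \<xi> = ratio * exp (gap / (2 * \<beta>) * (\<xi> + l))"
definition tail :: "real \<Rightarrow> real" where "tail \<xi> = T0 c + gap * (decay \<xi> / (1 - decay \<xi>))"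

definition T :: "real \<Rightarrow> real" where
  "T \<xi> = (if \<xi> \<le> - l then tail \<xi> else if \<xi> \<le> 0 then P (progress \<xi>) else front \<xi>)"
definition Z :: "real \<Rightarrow> real" where
  "Z \<xi> = (if \<xi> \<le> - l then 0 else if \<xi> \<le> 0 then (1 - progress \<xi>) powr \<gamma> else 1)"
text \<open>
  The three equations for \<open>T\<close> are one equation in terms of \<open>Z\<close>. Its right-hand side is continuous across
  the ends of the reaction zone, which is why \<open>T\<close> is continuously differentiable.
\<close>

definition dT :: "real \<Rightarrow> real" where
  "dT \<xi> = (- c * T \<xi> + (T \<xi>)\<^sup>2 / 2 + q0 * (1 - Z \<xi>)) / \<beta>"

lemma Ti_less: "Ti < 2 * c" using PD(3) ccj_pos Ti_less_ccj by simp

lemma front_weight: "2 * c / Ti - 1 > 0" using Ti_less Ti0 by simp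

lemma front_0: "front 0 = Ti" using c_pos Ti0 by (simp add: front_def)

lemma front_less: assumes "\<xi> > 0" shows "front \<xi> < Ti"
proof -
  define B where "B = 2 * c / Ti - 1"
  have B: "B > 0" using front_weight by (simp add: B_def)
  have "exp (c / \<beta> * \<xi>) > 1" using assms c_pos \<beta>_pos by simp
  hence "1 + B * exp (c / \<beta> * \<xi>) > 1 + B" using B by simp
  hence "front \<xi> < 2 * c / (1 + B)"
    unfolding front_def B_def[symmetric] using B c_pos
    by (intro divide_strict_left_mono mult_pos_pos add_pos_pos) auto
  thus ?thesis using c_pos Ti0 by (simp add: B_def)
qed

lemma front_deriv:
  "(front has_real_derivative (- c * front \<xi> + (front \<xi>)\<^sup>2 / 2) / \<beta>) (at \<xi>)"
proof -
  define B where "B = 2 * c / Ti - 1"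
  define u where "u = B * exp (c / \<beta> * \<xi>)"
  have "u > 0" using front_weight by (simp add: u_def B_def)
  have "(front has_real_derivative - (2 * c * (u * (c / \<beta>))) / (1 + u)\<^sup>2) (at \<xi>)"
    unfolding front_def B_def[symmetric] using \<open>u > 0\<close> \<beta>_pos
    by (auto intro!: derivative_eq_intros simp: u_def power2_eq_square mult_ac)
  moreover have "- (2 * c * (u * (c / \<beta>))) / (1 + u)\<^sup>2 = (- c * (2 * c / (1 + u)) + (2 * c / (1 + u))\<^sup>2 / 2) / \<beta>"
    using \<open>u > 0\<close> \<beta>_pos by (simp add: divide_simps power2_eq_square) (simp add: algebra_simps)
  moreover have "front \<xi> = 2 * c / (1 + u)" by (simp add: front_def u_def B_def)
  ultimately show ?thesis by simp
qed

lemma front_tendsto: "(front \<longlongrightarrow> 0) at_top"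
  unfolding front_def
  by (intro tendsto_divide_0[OF tendsto_const] filterlim_at_top_imp_at_infinity
       filterlim_tendsto_add_at_top[OF tendsto_const]
       filterlim_tendsto_pos_mult_at_top[OF tendsto_const front_weight]
       filterlim_compose[OF exp_at_top] filterlim_tendsto_pos_mult_at_top[OF tendsto_const]
       filterlim_ident) (use c_pos \<beta>_pos in auto)

lemma gap_nonneg: "gap \<ge> 0" using T0_root(2)[OF PD(3)] by (simp add: gap_def)

lemma gap_pos: "c > ccj \<Longrightarrow> gap > 0"
proof -
  assume c: "c > ccj"
  hence "ccj\<^sup>2 < c\<^sup>2" using ccj_pos by (intro power_strict_mono) auto
  thus "gap > 0" using ccj_sq by (simp add: gap_def T_zero_def)
qed

lemma ratio_bounds: "0 \<le> ratio" "ratio < 1"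
proof -
  have d: "P 1 - (2 * c - T0 c) = (P 1 - T0 c) + gap" by (simp add: gap_def)
  show "0 \<le> ratio" unfolding ratio_def d using PD(4) gap_nonneg by simp
  show "ratio < 1"
  proof (cases "P 1 = T0 c")
    case False
    hence "gap > 0" "P 1 - T0 c > 0" using gap_pos endpoint PD(4) by auto
    thus ?thesis unfolding ratio_def d by simp
  qed (simp add: ratio_def)
qed

lemma ratio_special: "P 1 = T0 c \<Longrightarrow> ratio = 0" by (simp add: ratio_def)

lemma decay_bounds: assumes "\<xi> \<le> - l" shows "0 \<le> decay \<xi>" "decay \<xi> \<le> ratio" "decay \<xi> < 1"
proof -
  have "gap / (2 * \<beta>) * (\<xi> + l) \<le> 0"
    using assms gap_nonneg \<beta>_pos by (intro mult_nonneg_nonpos) auto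
  hence "exp (gap / (2 * \<beta>) * (\<xi> + l)) \<le> 1" by simp
  thus "decay \<xi> \<le> ratio" unfolding decay_def using ratio_bounds by (intro mult_left_le) auto
  thus "decay \<xi> < 1" using ratio_bounds by simp
  show "0 \<le> decay \<xi>" using ratio_bounds by (simp add: decay_def)
qed

lemma tail_end: "tail (- l) = P 1"
proof (cases "P 1 = T0 c")
  case True
  thus ?thesis by (simp add: tail_def decay_def ratio_special)
next
  case False
  hence pos: "gap > 0" "P 1 - T0 c > 0" using gap_pos endpoint PD(4) by auto
  have d: "P 1 - (2 * c - T0 c) = (P 1 - T0 c) + gap" by (simp add: gap_def)
  have "1 - ratio = gap / ((P 1 - T0 c) + gap)"
    unfolding ratio_def d using pos by (simp add: field_simps)
  moreover have "ratio = (P 1 - T0 c) / ((P 1 - T0 c) + gap)" unfolding ratio_def d ..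
  ultimately have "ratio / (1 - ratio) = (P 1 - T0 c) / gap" using pos by simp
  thus ?thesis using pos by (simp add: tail_def decay_def)
qed

lemma tail_bounds:
  assumes "\<xi> \<le> - l" shows "T0 c \<le> tail \<xi>" "tail \<xi> \<le> P 1"
proof -
  show "T0 c \<le> tail \<xi>" unfolding tail_def using gap_nonneg decay_bounds[OF assms] by simp
  have "decay \<xi> / (1 - decay \<xi>) \<le> ratio / (1 - ratio)"
    using decay_bounds[OF assms] ratio_bounds by (intro frac_le) auto
  hence "tail \<xi> \<le> T0 c + gap * (ratio / (1 - ratio))"
    unfolding tail_def using gap_nonneg by (intro add_left_mono mult_left_mono)
  also have "\<dots> = tail (- l)" by (simp add: tail_def decay_def)
  finally show "tail \<xi> \<le> P 1" by (simp add: tail_end)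
qed

lemma tail_deriv:
  assumes "\<xi> \<le> - l"
  shows "(tail has_real_derivative (- c * tail \<xi> + (tail \<xi>)\<^sup>2 / 2 + q0) / \<beta>) (at \<xi>)"
proof -
  define v where "v = decay \<xi>"
  have v: "0 \<le> v" "v < 1" using decay_bounds[OF assms] by (auto simp: v_def)
  define d where "d = gap / (2 * \<beta>) * v"
  have dd: "(decay has_real_derivative d) (at \<xi>)"
    unfolding d_def v_def decay_def using \<beta>_pos by (auto intro!: derivative_eq_intros)
  have "(tail has_real_derivative gap * (d / (1 - v)\<^sup>2)) (at \<xi>)"
    unfolding tail_def using v
    by (auto intro!: derivative_eq_intros dd simp: v_def[symmetric] power2_eq_square algebra_simps)
  moreover have "- c * tail \<xi> + (tail \<xi>)\<^sup>2 / 2 + q0 = gap * (gap / 2 * v / (1 - v)\<^sup>2)"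
  proof -
    have "2 * q0 = T0 c * (2 * c - T0 c)" using T0_root(1)[OF PD(3)] by simp
    hence "- c * tail \<xi> + (tail \<xi>)\<^sup>2 / 2 + q0 = (tail \<xi> - T0 c) * ((tail \<xi> - T0 c) + gap) / 2"
      by (simp add: gap_def field_simps power2_eq_square)
    also have "tail \<xi> - T0 c = gap * (v / (1 - v))" by (simp add: tail_def v_def)
    also have "gap * (v / (1 - v)) + gap = gap / (1 - v)" using v by (simp add: field_simps)
    finally show ?thesis by (simp add: power2_eq_square mult_ac)
  qed
  moreover have "gap * (d / (1 - v)\<^sup>2) = gap * (gap / 2 * v / (1 - v)\<^sup>2) / \<beta>" by (simp add: d_def)
  ultimately show ?thesis by simp
qed

lemma continuous_T: "continuous_on UNIV T"
proof -
  have front: "continuous_on S front" for S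
    using front_deriv by (meson DERIV_isCont continuous_at_imp_continuous_on)
  have tail: "continuous_on {..- l} tail"
    using tail_deriv by (meson DERIV_isCont atMost_iff continuous_at_imp_continuous_on)
  have mid: "continuous_on {- l..0} (\<lambda>\<xi>. P (progress \<xi>))"
    by (rule continuous_on_compose2[OF PD(5) progress(1)]) (use progress_range in auto)
  have *: "continuous_on {\<xi> \<in> UNIV. - l \<le> \<xi>} (\<lambda>\<xi>. if \<xi> \<le> 0 then P (progress \<xi>) else front \<xi>)"
    by (rule continuous_on_cases_le)
       (auto intro: continuous_on_subset[OF mid] front simp: progress(2) front_0 PD(6) continuous_on_id)
  show ?thesis unfolding T_def[abs_def]
    by (rule continuous_on_cases_le[OF _ *])
       (use progress(3,4) in \<open>auto intro: continuous_on_subset[OF tail] simp: tail_end continuous_on_id\<close>)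
qed

lemma continuous_Z: "continuous_on UNIV Z"
proof -
  have mid: "continuous_on {- l..0} (\<lambda>\<xi>. (1 - progress \<xi>) powr \<gamma>)"
    using \<gamma>_ge progress_range by (intro continuous_on_powr' continuous_intros progress(1)) auto
  have *: "continuous_on {\<xi> \<in> UNIV. - l \<le> \<xi>} (\<lambda>\<xi>. if \<xi> \<le> 0 then (1 - progress \<xi>) powr \<gamma> else 1)"
    by (rule continuous_on_cases_le)
       (auto intro: continuous_on_subset[OF mid] simp: progress(2) continuous_on_id)
  show ?thesis unfolding Z_def[abs_def]
    by (rule continuous_on_cases_le[OF _ *]) (use progress(3,4) in \<open>auto simp: continuous_on_id\<close>)
qed

lemma continuous_dT: "continuous_on UNIV dT"
  unfolding dT_def[abs_def]
  by (intro continuous_intros continuous_T continuous_Z) (use \<beta>_pos in auto)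

lemma T_zone_deriv:
  assumes \<xi>: "- l < \<xi>" "\<xi> < 0"
  shows "(T has_real_derivative dT \<xi>) (at \<xi>)"
    and "(Z has_real_derivative K * \<phi> (T \<xi>) * Z \<xi> powr \<alpha>) (at \<xi>)" and "Z \<xi> > 0"
proof -
  note gd = progress_deriv[OF \<xi>]
  have op: "\<forall>\<^sub>F x in nhds \<xi>. - l < x \<and> x < 0"
    using \<xi> by (intro eventually_conj order_tendstoD[OF filterlim_ident])
  have T\<xi>: "T \<xi> = P (progress \<xi>)" and Z\<xi>: "Z \<xi> = (1 - progress \<xi>) powr \<gamma>" using \<xi> by (auto simp: T_def Z_def)
  have \<phi>p: "\<phi> (P (progress \<xi>)) > 0" using PD(7)[of "progress \<xi>"] gd by (intro \<phi>_pos) auto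
  have "((\<lambda>\<xi>. P (progress \<xi>)) has_real_derivative
      lam * (heat c (progress \<xi>) (P (progress \<xi>)) / \<phi> (P (progress \<xi>))) * - (k * \<phi> (P (progress \<xi>)))) (at \<xi>)"
    by (rule DERIV_chain2) (use PD(9)[of "progress \<xi>"] gd in auto)
  moreover have "lam * (heat c (progress \<xi>) (P (progress \<xi>)) / \<phi> (P (progress \<xi>))) * - (k * \<phi> (P (progress \<xi>))) = dT \<xi>"
  proof -
    have "dT \<xi> = - heat c (progress \<xi>) (P (progress \<xi>)) / \<beta>"
      by (simp add: dT_def T\<xi> Z\<xi> heat_def burnt_def)
    thus ?thesis using \<phi>p PD(2) k_pos by (simp add: \<beta>_def)
  qed
  ultimately have "((\<lambda>\<xi>. P (progress \<xi>)) has_real_derivative dT \<xi>) (at \<xi>)" by simp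
  thus "(T has_real_derivative dT \<xi>) (at \<xi>)"
    by (rule has_real_derivative_cong_eventually) (auto intro: eventually_mono[OF op] simp: T_def)
  have "((\<lambda>\<xi>. (1 - progress \<xi>) powr \<gamma>) has_real_derivative \<gamma> * (1 - progress \<xi>) powr (\<gamma> - 1) * (k * \<phi> (P (progress \<xi>)))) (at \<xi>)"
    using gd by (auto intro!: derivative_eq_intros simp: powr_diff)
  moreover have "\<gamma> * (1 - progress \<xi>) powr (\<gamma> - 1) * (k * \<phi> (P (progress \<xi>))) = K * \<phi> (T \<xi>) * Z \<xi> powr \<alpha>"
  proof -
    have "Z \<xi> powr \<alpha> = (1 - progress \<xi>) powr (\<gamma> - 1)" by (simp add: Z\<xi> powr_powr \<gamma>_mult(3))
    hence "\<gamma> * (1 - progress \<xi>) powr (\<gamma> - 1) * (k * \<phi> (P (progress \<xi>))) = (\<gamma> * k) * \<phi> (T \<xi>) * Z \<xi> powr \<alpha>"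
      by (simp add: T\<xi>)
    also note \<gamma>_mult(2)
    finally show ?thesis .
  qed
  ultimately have "((\<lambda>\<xi>. (1 - progress \<xi>) powr \<gamma>) has_real_derivative K * \<phi> (T \<xi>) * Z \<xi> powr \<alpha>) (at \<xi>)" by simp
  thus "(Z has_real_derivative K * \<phi> (T \<xi>) * Z \<xi> powr \<alpha>) (at \<xi>)"
    by (rule has_real_derivative_cong_eventually) (auto intro: eventually_mono[OF op] simp: Z_def)
  show "Z \<xi> > 0" using gd by (simp add: Z\<xi>)
qed

lemma T_deriv: "(T has_real_derivative dT \<xi>) (at \<xi>)"
proof -
  have off: "(T has_real_derivative dT x) (at x)" if x: "x \<noteq> 0" "x \<noteq> - l" for x
  proof -
    consider "x < - l" | "- l < x" "x < 0" | "0 < x" using x by linarith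
    thus ?thesis
    proof cases
      case 1
      have "(tail has_real_derivative dT x) (at x)"
        using tail_deriv[of x] 1 by (simp add: dT_def T_def Z_def)
      moreover have "\<forall>\<^sub>F y in nhds x. tail y = T y"
        using eventually_nhds_in_open[of "{..<- l}" x] 1 by (auto elim!: eventually_mono simp: T_def)
      ultimately show ?thesis by (rule has_real_derivative_cong_eventually)
    next
      case 2
      thus ?thesis by (rule T_zone_deriv(1))
    next
      case 3
      have "(front has_real_derivative dT x) (at x)"
        using front_deriv[of x] 3 progress(4) by (simp add: dT_def T_def Z_def)
      moreover have "\<forall>\<^sub>F y in nhds x. front y = T y"
        using eventually_nhds_in_open[of "{0<..}" x] 3 progress(4) by (auto elim!: eventually_mono simp: T_def)
      ultimately show ?thesis by (rule has_real_derivative_cong_eventually)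
    qed
  qed
  have "\<forall>\<^sub>F x in at \<xi>. x \<notin> {0, - l}"
    using eventually_neq_at_within[of 0 \<xi> UNIV] eventually_neq_at_within[of "- l" \<xi> UNIV]
    by eventually_elim auto
  hence "\<forall>\<^sub>F x in at \<xi>. (T has_real_derivative dT x) (at x)"
    by eventually_elim (auto intro: off)
  moreover have "isCont T \<xi>" "isCont dT \<xi>"
    using continuous_T continuous_dT by (auto simp: continuous_on_eq_continuous_at)
  ultimately show ?thesis by (intro has_real_derivative_of_limit)
qed

lemma exponential_tail:
  "\<bar>tail \<xi> - T0 c\<bar> \<le> gap * (ratio / (1 - ratio)) * exp (gap / (2 * \<beta>) * l) * exp (gap / (2 * \<beta>) * \<xi>)"
  if "\<xi> \<le> - l"
proof -
  note d = decay_bounds[OF that]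
  have "\<bar>tail \<xi> - T0 c\<bar> = gap * (decay \<xi> / (1 - decay \<xi>))"
    using gap_nonneg d by (simp add: tail_def)
  also have "\<dots> \<le> gap * (decay \<xi> / (1 - ratio))"
    using gap_nonneg d ratio_bounds by (intro mult_left_mono divide_left_mono) auto
  also have "\<dots> = gap * (ratio / (1 - ratio)) * exp (gap / (2 * \<beta>) * l) * exp (gap / (2 * \<beta>) * \<xi>)"
    by (simp add: decay_def ring_distribs exp_add)
  finally show ?thesis .
qed

lemma T_tendsto_back: "(T \<longlongrightarrow> T0 c) at_bot"
proof -
  have ev: "\<forall>\<^sub>F \<xi> in at_bot. \<xi> \<le> - l" by (rule eventually_le_at_bot)
  show ?thesis
  proof (cases "P 1 = T0 c")
    case True
    have "\<forall>\<^sub>F \<xi> in at_bot. T \<xi> = T0 c"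
      using ev by eventually_elim (simp add: T_def tail_def decay_def ratio_special[OF True])
    thus ?thesis by (rule tendsto_eventually)
  next
    case False
    hence "gap > 0" using endpoint gap_pos by blast
    hence r: "gap / (2 * \<beta>) > 0" using \<beta>_pos by simp
    define A where "A = gap * (ratio / (1 - ratio)) * exp (gap / (2 * \<beta>) * l)"
    have lim: "((\<lambda>\<xi>. A * exp (gap / (2 * \<beta>) * \<xi>)) \<longlongrightarrow> A * 0) at_bot"
      by (intro tendsto_mult tendsto_const filterlim_compose[OF exp_at_bot]
          filterlim_tendsto_pos_mult_at_bot[OF tendsto_const r] filterlim_ident)
    have bd: "\<forall>\<^sub>F \<xi> in at_bot. norm (T \<xi> - T0 c) \<le> A * exp (gap / (2 * \<beta>) * \<xi>)"
      using ev
    proof eventually_elim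
      case (elim \<xi>)
      thus ?case using exponential_tail[OF elim] by (simp add: T_def A_def)
    qed
    have "((\<lambda>\<xi>. T \<xi> - T0 c) \<longlongrightarrow> 0) at_bot" using Lim_null_comparison[OF bd] lim by simp
    thus ?thesis by (rule LIM_zero_cancel)
  qed
qed

lemma T_at_0: "T 0 = Ti" using progress(2,4) PD(6) by (simp add: T_def)

lemma T_at_end: "T (- l) = P 1" by (simp add: T_def tail_end)

lemma T_gt: assumes "\<xi> < 0" shows "T \<xi> > Ti"
proof (cases "\<xi> \<le> - l")
  case True
  thus ?thesis using tail_bounds(1)[OF True] Ti_less_T0[OF PD(3)] by (simp add: T_def)
next
  case False
  thus ?thesis using progress_deriv[of \<xi>] assms strong_profile_gt_Ti[OF strong, of "progress \<xi>"] by (simp add: T_def)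
qed

lemma strong_wave: "strong_wave q0 K \<alpha> Ti \<phi> \<beta> c l T Z"
proof -
  have dv: "deriv T \<xi> = dT \<xi>" for \<xi> by (rule DERIV_imp_deriv[OF T_deriv])
  have eq: "\<beta> * deriv T \<xi> = - c * T \<xi> + (T \<xi>)\<^sup>2 / 2 + q0 * (1 - Z \<xi>)" for \<xi>
    unfolding dv dT_def using \<beta>_pos by simp
  have "T C1_differentiable_on UNIV"
    unfolding C1_differentiable_on_def using T_deriv continuous_dT
    by (intro exI[of _ dT]) (simp add: has_real_derivative_iff_has_vector_derivative)
  moreover have "(T \<longlongrightarrow> 0) at_top"
  proof (rule Lim_transform_eventually[OF front_tendsto])
    show "\<forall>\<^sub>F \<xi> in at_top. front \<xi> = T \<xi>"
      using eventually_gt_at_top[of 0] by eventually_elim (use progress(4) in \<open>simp add: T_def\<close>)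
  qed
  moreover have "T 0 = Ti" "Z 0 = 1" "Z (- l) = 0" using progress(2,4) PD(6) by (auto simp: T_def Z_def)
  moreover have "T \<xi> < Ti" "Z \<xi> = 1" if "\<xi> > 0" for \<xi>
    using that progress(4) front_less by (auto simp: T_def Z_def)
  moreover have "Z \<xi> = 0" if "\<xi> < - l" for \<xi> using that by (simp add: Z_def)
  ultimately show ?thesis unfolding strong_wave_def reactive_wave_def
    using \<beta>_pos PD(3) progress(4) continuous_Z T_gt T_zone_deriv(2,3) T_tendsto_back eq by auto
qed

lemma special_wave:
  assumes "P 1 = T0 c" shows "special_strong_wave q0 K \<alpha> Ti \<phi> \<beta> c l T Z"
proof -
  have "T \<xi> = T0 c" if "\<xi> \<le> - l" for \<xi>
    using that by (simp add: T_def tail_def decay_def ratio_special[OF assms])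
  thus ?thesis unfolding special_strong_wave_def using strong_wave by blast
qed

text \<open>
  At the end of the reaction zone \<open>T > T\<^sub>0(c)\<close>, hence \<open>heat < 0\<close> and \<open>T\<close> has just decreased as a function of
  \<open>w\<close>. So the maximum of the profile is interior, and it is the global one because the tail is at most
  \<open>P 1\<close> and the front below \<open>Ti\<close>.
\<close>

lemma bump_wave:
  assumes "P 1 > T0 c" shows "bump_strong_wave q0 K \<alpha> Ti \<phi> \<beta> c l T Z"
proof -
  have c: "c > ccj" using assms endpoint by auto
  obtain m where m: "m \<in> {0..1}" "\<And>w. w \<in> {0..1} \<Longrightarrow> P w \<le> P m"
    using continuous_attains_sup[of "{0..1}" P] PD(5) by force
  have "P m \<ge> P 1" using m(2)[of 1] by simp
  hence "m \<noteq> 0" using PD(6) assms Ti_less_T0[OF PD(3)] by auto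
  obtain w where w: "0 < w" "w < 1" "P 1 < P w"
  proof -
    have "continuous_on {0..1} (\<lambda>w. heat c w (P w))" by (intro continuous_on_heat_comp PD(5)) auto
    moreover have "heat c 1 (P 1) < 0" by (rule heat_neg_beyond_T0[OF PD(3) assms])
    ultimately have "\<forall>\<^sub>F w in at 1 within {0..1}. heat c w (P w) < 0"
      by (intro order_tendstoD(2)[where y = "heat c 1 (P 1)"]) (auto simp: continuous_on_def)
    then obtain d where d: "d > 0"
      "\<And>w. w \<in> {0..1} \<Longrightarrow> w \<noteq> 1 \<Longrightarrow> dist w 1 < d \<Longrightarrow> heat c w (P w) < 0"
      by (auto simp: eventually_at)
    define w where "w = max (1 / 2) (1 - d / 2)"
    have w: "0 < w" "w < 1" "1 - w < d" using d(1) by (auto simp: w_def)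
    have "P 1 < P w"
    proof (rule DERIV_neg_imp_decreasing_open[where f = P])
      show "continuous_on {w..1} P" by (rule continuous_on_subset[OF PD(5)]) (use w in auto)
      fix s assume s: "w < s" "s < 1"
      have "heat c s (P s) < 0" using d(2)[of s] s w by (auto simp: dist_real_def)
      moreover have "\<phi> (P s) > 0" using PD(7)[of s] s w by (intro \<phi>_pos) auto
      ultimately have "lam * (heat c s (P s) / \<phi> (P s)) < 0"
        using PD(2) by (intro mult_pos_neg divide_neg_pos)
      thus "\<exists>y. (P has_real_derivative y) (at s) \<and> y < 0" using PD(9)[of s] s w by auto
    qed (use w in auto)
    thus thesis using that w by blast
  qed
  hence Pm: "P m > P 1" using m(2)[of w] by simp
  hence "m \<noteq> 1" by auto
  hence m01: "0 < m" "m < 1" using m(1) \<open>m \<noteq> 0\<close> by auto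
  obtain \<xi>m where \<xi>m: "- l \<le> \<xi>m" "\<xi>m \<le> 0" "progress \<xi>m = m"
    using IVT2'[of progress 0 m "- l"] progress m01 by auto
  hence \<xi>m': "- l < \<xi>m" "\<xi>m < 0" using m01 progress(2,3) by (auto simp: order_le_less)
  hence T\<xi>m: "T \<xi>m = P m" using \<xi>m by (simp add: T_def)
  have max: "T \<xi> \<le> T \<xi>m" for \<xi>
  proof -
    consider "\<xi> \<le> - l" | "- l < \<xi>" "\<xi> \<le> 0" | "\<xi> > 0" by linarith
    thus ?thesis
    proof cases
      case 1
      thus ?thesis using tail_bounds(2)[OF 1] Pm by (simp add: T_def T\<xi>m[unfolded T_def])
    next
      case 2
      thus ?thesis using m(2)[of "progress \<xi>"] progress_range[of \<xi>] unfolding T\<xi>m by (simp add: T_def)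
    next
      case 3
      thus ?thesis using front_less[OF 3] m(2)[of 0] progress(4) unfolding T\<xi>m by (simp add: T_def PD(6))
    qed
  qed
  have "\<not> mono T"
  proof
    assume "mono T"
    moreover have "- l \<le> 0" using progress(4) by simp
    ultimately have "T (- l) \<le> T 0" by (rule monoD)
    thus False using T_gt[of "- l"] progress(4) unfolding T_at_0 by linarith
  qed
  moreover have "\<not> antimono T"
  proof
    assume "antimono T"
    moreover have "- l \<le> \<xi>m" using \<xi>m' by simp
    ultimately have "T \<xi>m \<le> T (- l)" by (rule antimonoD)
    thus False using Pm unfolding T\<xi>m T_at_end by linarith
  qed
  moreover have "\<exists>A r. r > 0 \<and> (\<forall>\<xi>\<le>- l. \<bar>T \<xi> - T0 c\<bar> \<le> A * exp (r * \<xi>))"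
    using exponential_tail gap_pos[OF c] \<beta>_pos
    by (intro exI[of _ "gap * (ratio / (1 - ratio)) * exp (gap / (2 * \<beta>) * l)"]
        exI[of _ "gap / (2 * \<beta>)"]) (auto simp: T_def)
  ultimately show ?thesis unfolding bump_strong_wave_def using strong_wave c max \<xi>m' by blast
qed

end

section \<open>Speed dependence of the viscosity\<close>

context combustion
begin

lemma wave_profile_sol:
  assumes "c \<ge> ccj" "lam \<ge> lam0 c" "lam = lam0 c \<or> c > ccj"
  shows "wave_profile q0 K \<alpha> Ti \<phi> lam c (sol lam c)"
proof (intro wave_profile.intro wave_profile_axioms.intro combustion_axioms)
  have "lam > 0" using lam0(1)[OF assms(1)] assms(2) by simp
  thus "strong_profile lam c (sol lam c)"
    using assms by (simp add: strong_profile_def profile_sol sol_ge_T0)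
  show "sol lam c 1 = T0 c \<or> c > ccj" using assms lam0(2) by auto
qed

lemma special_wave_lam0:
  assumes "c \<ge> ccj"
  shows "\<exists>l T Z. special_strong_wave q0 K \<alpha> Ti \<phi> (1 / (k * lam0 c)) c l T Z"
proof -
  interpret W: wave_profile q0 K \<alpha> Ti \<phi> "lam0 c" c "sol (lam0 c) c"
    using assms by (intro wave_profile_sol) auto
  show ?thesis using W.special_wave lam0(2)[OF assms] by (auto simp: W.\<beta>_def mult.commute)
qed

lemma beta0_eq:
  assumes c: "c \<ge> ccj"
  shows "beta0 q0 K \<alpha> Ti \<phi> c = 1 / (k * lam0 c)"
  unfolding beta0_def
proof (rule the_equality)
  show "1 / (k * lam0 c) > 0 \<and> (\<exists>l T Z. reactive_wave q0 K \<alpha> Ti \<phi> (1 / (k * lam0 c)) c l T Z \<and>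
      (\<forall>\<xi>\<le>- l. T \<xi> = T0 c))"
    using special_wave_lam0[OF c] k_pos lam0(1)[OF c]
    unfolding special_strong_wave_def strong_wave_def by auto
  fix \<beta> assume \<beta>: "\<beta> > 0 \<and> (\<exists>l T Z. reactive_wave q0 K \<alpha> Ti \<phi> \<beta> c l T Z \<and>
      (\<forall>\<xi>\<le>- l. T \<xi> = T0 c))"
  then obtain P where P: "profile (1 / (\<beta> * k)) c P" "P 1 = T0 c"
    using profile_of_special_wave by blast
  have "1 / (\<beta> * k) = lam0 c" using \<beta> k_pos by (intro lam0_unique[OF c _ P]) auto
  hence "1 / (k * lam0 c) = 1 / (k * (1 / (\<beta> * k)))" by simp
  also have "\<dots> = \<beta>" using \<beta> k_pos by simp
  finally show "\<beta> = 1 / (k * lam0 c)" by simp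
qed

lemma bump_wave_exists:
  assumes c: "c > ccj" and \<beta>: "\<beta> > 0" "\<beta> < 1 / (k * lam0 c)"
  shows "\<exists>l T Z. bump_strong_wave q0 K \<alpha> Ti \<phi> \<beta> c l T Z"
proof -
  define lam where "lam = 1 / (\<beta> * k)"
  have lam: "lam > lam0 c" using \<beta> k_pos lam0(1)[of c] c by (simp add: lam_def field_simps)
  interpret W: wave_profile q0 K \<alpha> Ti \<phi> lam c "sol lam c"
    using c lam by (intro wave_profile_sol) auto
  have "W.\<beta> = 1 / (lam * k)" by (rule W.\<beta>_def)
  also have "\<dots> = \<beta>" using \<beta> k_pos by (simp add: lam_def)
  finally have "W.\<beta> = \<beta>" .
  thus ?thesis using W.bump_wave sol_gt_T0[of c lam] c lam by auto
qed

end

theorem theorem1p4: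
  fixes q0 K \<alpha> Ti :: real and \<phi> :: "real \<Rightarrow> real"
  assumes "q0 > 0" and "K > 0" and "0 \<le> \<alpha>" and "\<alpha> < 1"
    and "0 < Ti" and "Ti < sqrt (2 * q0)"
    and "ignition_rate Ti \<phi>"
  shows "\<exists>\<beta>bar cbar. \<beta>bar > 0 \<and> cbar > c_cj q0 \<and>
    (beta0 q0 K \<alpha> Ti \<phi> cbar = \<beta>bar \<and>
     (beta0 q0 K \<alpha> Ti \<phi> has_real_derivative 0) (at cbar)) \<and>
    (0 < \<beta>bar \<and> (\<forall>c\<ge>c_cj q0. \<beta>bar \<le> beta0 q0 K \<alpha> Ti \<phi> c)) \<and>
    (\<exists>l T Z. special_strong_wave q0 K \<alpha> Ti \<phi> \<beta>bar cbar l T Z) \<and>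
    (\<forall>\<beta>. 0 < \<beta> \<and> \<beta> < \<beta>bar \<longrightarrow>
       (\<forall>c>c_cj q0. \<exists>l T Z. bump_strong_wave q0 K \<alpha> Ti \<phi> \<beta> c l T Z))"
proof -
  interpret combustion q0 K \<alpha> Ti \<phi> using assms by unfold_locales
  obtain cbar where cbar: "cbar > ccj" and max: "\<And>c. c \<ge> ccj \<Longrightarrow> lam0 c \<le> lam0 cbar"
    and der: "((\<lambda>c. 1 / (k * lam0 c)) has_real_derivative 0) (at cbar)"
    using turning_point_exists by blast
  define \<beta>bar where "\<beta>bar = 1 / (k * lam0 cbar)"
  have pos: "\<beta>bar > 0" using k_pos lam0(1)[of cbar] cbar by (simp add: \<beta>bar_def)
  have below: "\<beta>bar \<le> 1 / (k * lam0 c)" if "c \<ge> ccj" for c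
    unfolding \<beta>bar_def using max[OF that] lam0(1)[OF that] k_pos
    by (intro frac_le mult_left_mono) auto
  have "(beta0 q0 K \<alpha> Ti \<phi> has_real_derivative 0) (at cbar)"
  proof (rule has_real_derivative_cong_eventually[OF der])
    show "\<forall>\<^sub>F c in nhds cbar. 1 / (k * lam0 c) = beta0 q0 K \<alpha> Ti \<phi> c"
      using eventually_nhds_in_open[of "{ccj<..}" cbar] cbar
      by (auto elim!: eventually_mono simp: beta0_eq)
  qed
  moreover have "beta0 q0 K \<alpha> Ti \<phi> cbar = \<beta>bar" using beta0_eq[of cbar] cbar by (simp add: \<beta>bar_def)
  moreover have "\<forall>c\<ge>ccj. \<beta>bar \<le> beta0 q0 K \<alpha> Ti \<phi> c" using below by (simp add: beta0_eq)
  moreover have "\<exists>l T Z. special_strong_wave q0 K \<alpha> Ti \<phi> \<beta>bar cbar l T Z"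
    unfolding \<beta>bar_def using cbar by (intro special_wave_lam0) auto
  moreover have "\<exists>l T Z. bump_strong_wave q0 K \<alpha> Ti \<phi> \<beta> c l T Z"
    if "0 < \<beta>" "\<beta> < \<beta>bar" "c > ccj" for \<beta> c
    using that below[of c] by (intro bump_wave_exists) auto
  ultimately show ?thesis using pos cbar by blast
qed

end
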